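(* Let $p_{\rm c}:=\frac{N}{N-2\beta}$, $p\in[p_{\rm c},\infty)$, $\ell:=\frac{N}{2\beta}(p-1)$, $q\in[1,\ell]$, let $\hat q\in(\ell,\ell p]$ with $\hat q\ge p$, and let $u_0\in L^q(\mathbb{R}^N)\cap L^{\hat q}(\mathbb{R}^N)$. If $u$ is an $L^{\hat q}$-solution of $\partial_t^\alpha u+(-\Delta)^\beta u=|u|^{p-1}u$ with initial datum $u_0$ and existence time $T$, then $u$ is also an $L^q$-solution (with initial datum $u_0$ and existence time $T$). Moreover, $u\in C([0,T);L^q(\mathbb{R}^N))$.
   Context: Throughout, $N\ge1$ is an integer, $\alpha\in(0,1)$, $\beta\in(0,1]$, and $N>4\beta$. $\partial_t^\alpha$ is the Caputo derivative, $\partial_t^\alpha u(x,t)=\frac1{\Gamma(1-\alpha)}\partial_t\int_0^t\frac{u(x,s)-u(x,0)}{(t-s)^\alpha}ds$, and $(-\Delta)^\beta$ is the operator with Fourier symbol $|\xi|^{2\beta}$. $Z$ is the fundamental solution of $\partial_t^\alpha u+(-\Delta)^\beta u=0$ (initial datum a Dirac mass at $0$), and $Y(x,t)={}^{R}\partial_t^{1-\alpha}Z(x,t)=\frac{1}{\Gamma(\alpha)}\partial_t\int_0^t\frac{Z(x,s)}{(t-s)^{1-\alpha}}ds$. Equivalently, in terms of spatial Fourier transforms, $\hat Z(\xi,t)=E_{\alpha,1}(-|\xi|^{2\beta}t^\alpha)$ and $\hat Y(\xi,t)=t^{\alpha-1}E_{\alpha,\alpha}(-|\xi|^{2\beta}t^\alpha)$,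 with $E_{\alpha,\gamma}$ the Mittag-Leffler functions. For $m\in[1,\infty]$ and $u_0\in L^m(\mathbb{R}^N)$, an $L^m$-solution of $\partial_t^\alpha u+(-\Delta)^\beta u=|u|^{p-1}u$ with initial datum $u_0$ and existence time $T\in(0,\infty]$ is a function $u\in L^\infty_{\rm loc}([0,T);L^m(\mathbb{R}^N))$ such that, for almost all $t\in(0,T)$, $$u(x,t)=\int_{\mathbb{R}^N} u_0(y)Z(x-y,t)\,dy+\int_0^t\int_{\mathbb{R}^N}|u(y,s)|^{p-1}u(y,s)Y(x-y,t-s)\,dy\,ds$$ as an identity in $L^m(\mathbb{R}^N)$, and $\operatorname{ess\,lim}_{t\to0^+}\|u(\cdot,t)-u_0\|_{L^m(\mathbb{R}^N)}=0$. Membership in $C([0,T);L^q(\mathbb{R}^N))$ is understood for the representative given by the right-hand side of this formula for all $t\in(0,T)$, with value $u_0$ at $t=0$. *)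

theory Defs
  imports "HOL-Analysis.Analysis"
begin

definition in_Lp :: "real \<Rightarrow> ('a::euclidean_space \<Rightarrow> real) \<Rightarrow> bool" where
  "in_Lp m f \<longleftrightarrow> f \<in> borel_measurable lborel \<and> integrable lborel (\<lambda>x. \<bar>f x\<bar> powr m)"

definition Lp_norm :: "real \<Rightarrow> ('a::euclidean_space \<Rightarrow> real) \<Rightarrow> real" where
  "Lp_norm m f = (\<integral>x. \<bar>f x\<bar> powr m \<partial>lborel) powr (1 / m)"

text \<open>
  \<open>L\<^sup>\<infinity>\<^sub>l\<^sub>o\<^sub>c([0,T); L\<^sup>m(\<real>\<^sup>N))\<close> for \<open>m < \<infinity>\<close>: an element is represented by a jointly
  measurable function of \<open>(x, t)\<close>; the value at \<open>t = 0\<close> is irrelevant.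
\<close>

definition in_Linf_loc_Lp :: "real \<Rightarrow> ereal \<Rightarrow> ('a::euclidean_space \<Rightarrow> real \<Rightarrow> real) \<Rightarrow> bool" where
  "in_Linf_loc_Lp m T u \<longleftrightarrow>
     set_borel_measurable borel (UNIV \<times> {t. 0 < t \<and> ereal t < T}) (\<lambda>(x, t). u x t) \<and>
     (\<forall>\<tau>>0. ereal \<tau> < T \<longrightarrow>
        (\<exists>C. AE t in lborel. 0 < t \<and> t < \<tau> \<longrightarrow>
           in_Lp m (\<lambda>x. u x t) \<and> Lp_norm m (\<lambda>x. u x t) \<le> C))"

definition in_C_Lp :: "real \<Rightarrow> ereal \<Rightarrow> ('a::euclidean_space \<Rightarrow> real \<Rightarrow> real) \<Rightarrow> bool" where
  "in_C_Lp m T v \<longleftrightarrow>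
     (\<forall>t. 0 \<le> t \<and> ereal t < T \<longrightarrow> in_Lp m (\<lambda>x. v x t)) \<and>
     (\<forall>t. 0 \<le> t \<and> ereal t < T \<longrightarrow>
        ((\<lambda>s. Lp_norm m (\<lambda>x. v x s - v x t)) \<longlongrightarrow> 0) (at t within {s. 0 \<le> s \<and> ereal s < T}))"

definition ess_tendsto_0 :: "(real \<Rightarrow> real) \<Rightarrow> bool" where
  "ess_tendsto_0 g \<longleftrightarrow> (\<forall>\<epsilon>>0. \<exists>\<delta>>0. AE t in lborel. 0 < t \<and> t < \<delta> \<longrightarrow> \<bar>g t\<bar> \<le> \<epsilon>)"

definition rl_integral ::
    "real \<Rightarrow> (real \<Rightarrow> 'b::{banach, second_countable_topology}) \<Rightarrow> real \<Rightarrow> 'b" where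
  "rl_integral \<gamma> f t =
     (1 / Gamma \<gamma>) *\<^sub>R (LINT s:{0<..<t}|lborel. (t - s) powr (\<gamma> - 1) *\<^sub>R f s)"

definition has_rl_derivative ::
    "real \<Rightarrow> (real \<Rightarrow> 'b::{banach, second_countable_topology}) \<Rightarrow> 'b \<Rightarrow> real \<Rightarrow> bool" where
  "has_rl_derivative \<gamma> f D t \<longleftrightarrow> (rl_integral (1 - \<gamma>) f has_vector_derivative D) (at t)"

definition has_caputo_derivative ::
    "real \<Rightarrow> (real \<Rightarrow> 'b::{banach, second_countable_topology}) \<Rightarrow> 'b \<Rightarrow> real \<Rightarrow> bool" where
  "has_caputo_derivative \<gamma> f D t \<longleftrightarrow> has_rl_derivative \<gamma> (\<lambda>s. f s - f 0) D t"

definition fourier :: "('a::euclidean_space \<Rightarrow> real) \<Rightarrow> 'a \<Rightarrow> complex" where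
  "fourier f \<xi> = (\<integral>x. exp (- \<i> * complex_of_real (x \<bullet> \<xi>)) * complex_of_real (f x) \<partial>lborel)"

text \<open>
  The fundamental solution of \<open>\<partial>\<^sub>t\<^sup>\<alpha> u + (-\<Delta>)\<^sup>\<beta> u = 0\<close>. Since \<open>(-\<Delta>)\<^sup>\<beta>\<close> is the operator with
  symbol \<open>|\<xi>|\<^sup>2\<^sup>\<beta>\<close>, the equation is imposed on the spatial Fourier transform, where the initial
  Dirac mass becomes the constant 1. This determines \<open>Z(\<cdot>,t)\<close> almost everywhere (its transform
  is \<open>E\<^sub>\<alpha>\<^sub>,\<^sub>1(-|\<xi>|\<^sup>2\<^sup>\<beta> t\<^sup>\<alpha>)\<close>). That transform is not integrable in \<open>\<xi>\<close> in the relevant range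
  of dimensions, so \<open>Z\<close> is not introduced by an inversion integral.
\<close>

definition fundamental_solution ::
    "real \<Rightarrow> real \<Rightarrow> ('a::euclidean_space \<Rightarrow> real \<Rightarrow> real) \<Rightarrow> bool" where
  "fundamental_solution \<alpha> \<beta> Z \<longleftrightarrow>
     set_borel_measurable borel (UNIV \<times> {0<..}) (\<lambda>(x, t). Z x t) \<and>
     (\<forall>t>0. integrable lborel (\<lambda>x. Z x t)) \<and>
     (\<forall>\<xi>. \<exists>z. z 0 = 1 \<and> (\<forall>t>0. z t = fourier (\<lambda>x. Z x t) \<xi>) \<and> continuous_on {0..} z \<and>
        (\<forall>t>0. has_caputo_derivative \<alpha> z (- complex_of_real (norm \<xi> powr (2 * \<beta>)) * z t) t))"

text \<open>
  \<open>Y\<close> is the Riemann--Liouville derivative of order \<open>1 - \<alpha>\<close> of \<open>Z\<close> in \<open>t\<close>. It is taken pointwise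
  for almost every \<open>x\<close>, because \<open>Z\<close> and \<open>Y\<close> may be singular at \<open>x = 0\<close> and are in any case
  only determined up to null sets. Integrability of \<open>Y(\<cdot>,t)\<close> is a known property of this
  kernel, recorded here so that its Fourier transform makes sense.
\<close>

definition source_kernel ::
    "real \<Rightarrow> ('a::euclidean_space \<Rightarrow> real \<Rightarrow> real) \<Rightarrow> ('a \<Rightarrow> real \<Rightarrow> real) \<Rightarrow> bool" where
  "source_kernel \<alpha> Z Y \<longleftrightarrow>
     set_borel_measurable borel (UNIV \<times> {0<..}) (\<lambda>(x, t). Y x t) \<and>
     (\<forall>t>0. integrable lborel (\<lambda>x. Y x t)) \<and>
     (AE x in lborel. \<forall>t>0. has_rl_derivative (1 - \<alpha>) (Z x) (Y x t) t)"

definition mild_rhs ::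
    "real \<Rightarrow> ('a::euclidean_space \<Rightarrow> real \<Rightarrow> real) \<Rightarrow> ('a \<Rightarrow> real \<Rightarrow> real) \<Rightarrow>
     ('a \<Rightarrow> real) \<Rightarrow> ('a \<Rightarrow> real \<Rightarrow> real) \<Rightarrow> 'a \<Rightarrow> real \<Rightarrow> real" where
  "mild_rhs p Z Y u0 u x t =
     (\<integral>y. u0 y * Z (x - y) t \<partial>lborel) +
     (LINT s:{0<..<t}|lborel.
        (\<integral>y. \<bar>u y s\<bar> powr (p - 1) * u y s * Y (x - y) (t - s) \<partial>lborel))"

text \<open>
  The Bochner integral is total (0 for non-integrable functions), so convergence of the two
  integrals in \<^const>\<open>mild_rhs\<close> has to be stated separately.
\<close>

definition mild_rhs_converges ::
    "real \<Rightarrow> ('a::euclidean_space \<Rightarrow> real \<Rightarrow> real) \<Rightarrow> ('a \<Rightarrow> real \<Rightarrow> real) \<Rightarrow>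
     ('a \<Rightarrow> real) \<Rightarrow> ('a \<Rightarrow> real \<Rightarrow> real) \<Rightarrow> 'a \<Rightarrow> real \<Rightarrow> bool" where
  "mild_rhs_converges p Z Y u0 u x t \<longleftrightarrow>
     integrable lborel (\<lambda>y. u0 y * Z (x - y) t) \<and>
     set_integrable lborel (UNIV \<times> {0<..<t})
       (\<lambda>(y, s). \<bar>u y s\<bar> powr (p - 1) * u y s * Y (x - y) (t - s))"

definition Lm_solution ::
    "real \<Rightarrow> real \<Rightarrow> ('a::euclidean_space \<Rightarrow> real \<Rightarrow> real) \<Rightarrow> ('a \<Rightarrow> real \<Rightarrow> real) \<Rightarrow>
     ('a \<Rightarrow> real) \<Rightarrow> ereal \<Rightarrow> ('a \<Rightarrow> real \<Rightarrow> real) \<Rightarrow> bool" where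
  "Lm_solution m p Z Y u0 T u \<longleftrightarrow>
     in_Lp m u0 \<and> in_Linf_loc_Lp m T u \<and>
     (AE t in lborel. 0 < t \<and> ereal t < T \<longrightarrow>
        (AE x in lborel. mild_rhs_converges p Z Y u0 u x t \<and> u x t = mild_rhs p Z Y u0 u x t)) \<and>
     ess_tendsto_0 (\<lambda>t. Lp_norm m (\<lambda>x. u x t - u0 x))"

definition mild_rep ::
    "real \<Rightarrow> ('a::euclidean_space \<Rightarrow> real \<Rightarrow> real) \<Rightarrow> ('a \<Rightarrow> real \<Rightarrow> real) \<Rightarrow>
     ('a \<Rightarrow> real) \<Rightarrow> ('a \<Rightarrow> real \<Rightarrow> real) \<Rightarrow> 'a \<Rightarrow> real \<Rightarrow> real" where
  "mild_rep p Z Y u0 u x t = (if t = 0 then u0 x else mild_rhs p Z Y u0 u x t)"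

end

theory Submission imports Defs "HOL-Probability.Characteristic_Functions"
begin

text \<open>
  All size estimates on the kernels that enter are for \<open>L\<^sup>1\<close> norms: \<open>\<parallel>Z(\<cdot>,t)\<parallel>\<^sub>1\<close> does not depend on \<open>t\<close>,
  \<open>\<integral>Z(x,t) dx = 1\<close>, and \<open>\<parallel>Y(\<cdot>,t)\<parallel>\<^sub>1\<close> is a constant times \<open>t powr (\<alpha> - 1)\<close>, hence integrable near
  \<open>t = 0\<close>. The mass comes from the Caputo equation at frequency \<open>0\<close>, the norms from
  self-similarity with the exponent \<open>\<kappa> = \<alpha> / (2 \<beta>)\<close>. Rescaling time by \<open>c\<close> in the Caputo equation with parameter \<open>|\<xi>|\<^sup>2\<^sup>\<beta>\<close> gives the equation with parameter
  \<open>|c\<^sup>\<kappa> \<xi>|\<^sup>2\<^sup>\<beta>\<close>, so uniqueness for this scalar equation (\<open>caputo_uniqueness\<close>, from a maximum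
  principle for the primitive) identifies the transforms of \<open>Z(\<cdot>, c t)\<close> and of
  \<open>c\<^sup>-\<^sup>\<kappa>\<^sup>N Z(c\<^sup>-\<^sup>\<kappa> \<cdot>, t)\<close>, and injectivity of the Fourier transform (\<open>fourier_inject\<close>) identifies the
  functions. Fractional integration in time preserves this law, and difference quotients carry it
  over to \<open>Y\<close> (\<open>source_kernel_rescale\<close>).

  Consequently \<open>t \<mapsto> Z(t) * u\<^sub>0\<close> is an average of dilated translates of \<open>u\<^sub>0\<close>, continuous into every
  \<open>L\<^sup>m\<close> that contains \<open>u\<^sub>0\<close>, up to and including \<open>t = 0\<close>. The Duhamel term is the convolution on
  \<open>\<real>\<^sup>N \<times> \<real>\<close> of \<open>|u|\<^sup>p\<^sup>-\<^sup>1 u\<close> with an \<open>L\<^sup>1\<close> kernel. By Minkowski's inequality and continuity of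
  translations in \<open>L\<^sup>1\<close>, it is bounded and continuous in time with values in \<open>L\<^sup>r\<close> as soon as
  \<open>u\<close> is bounded in \<open>L\<^sup>r\<^sup>p\<close> and \<open>r \<ge> 1\<close> (\<open>st_conv_bound\<close>, \<open>st_conv_continuous\<close>).

  It remains to move the exponent from \<open>q'\<close> down to \<open>q\<close>. If \<open>q p \<le> q'\<close>, a bound on \<open>u\<close> in
  \<open>L\<^sup>r\<^sup>p\<close> gives one in \<open>L\<^sup>r\<close>, because \<open>u\<^sub>0 \<in> L\<^sup>r\<close> for \<open>q \<le> r \<le> q'\<close>; each round divides the exponent by
  \<open>p > 1\<close>, so finitely many rounds reach \<open>q p\<close> (\<open>bounded_exponent_bootstrap\<close>), and one more application
  puts the Duhamel term into \<open>C([0,\<tau>); L\<^sup>q)\<close>. If \<open>q p > q'\<close>, then \<open>q' / p < q < q'\<close>: the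
  Duhamel term is continuous in \<open>L\<^bsup>q'/p\<^esup>\<close> and bounded in \<open>L\<^bsup>q'\<^esup>\<close>, since it equals \<open>u - Z * u\<^sub>0\<close> for
  almost every \<open>t\<close> and Fatou's lemma extends the bound to every \<open>t\<close> (\<open>duhamel_bound_upper\<close>); interpolation gives
  continuity in \<open>L\<^sup>q\<close> (\<open>duhamel_in_Lq\<close>).
\<close>

section \<open>Powers of norms and integrals against a weight\<close>

text \<open>
  The \<open>r\<close>-th power of the \<open>L\<^sup>r\<close> norm, with value \<open>\<infinity>\<close> outside \<open>L\<^sup>r\<close>. Working with the power in
  \<open>ennreal\<close> makes estimates linear in this quantity, lets Tonelli apply without integrability
  side conditions, and replaces Minkowski's triangle inequality by a quasi-triangle inequality.
\<close>
definition Lp_mass :: "real \<Rightarrow> ('a::euclidean_space \<Rightarrow> real) \<Rightarrow> ennreal" where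
  "Lp_mass r f = (\<integral>\<^sup>+x. ennreal (\<bar>f x\<bar> powr r) \<partial>lborel)"

lemma in_Lp_iff_Lp_mass:
  "in_Lp r f \<longleftrightarrow> f \<in> borel_measurable borel \<and> Lp_mass r f < \<infinity>"
  unfolding in_Lp_def Lp_mass_def by (auto simp: integrable_iff_bounded)

lemma Lp_norm_eq_Lp_mass:
  "f \<in> borel_measurable borel \<Longrightarrow> Lp_norm r f = enn2real (Lp_mass r f) powr (1 / r)"
  unfolding Lp_norm_def Lp_mass_def by (subst integral_eq_nn_integral) auto

lemma Lp_mass_cong_AE:
  "AE x in lborel. f x = g x \<Longrightarrow> Lp_mass r f = Lp_mass r g"
  unfolding Lp_mass_def by (rule nn_integral_cong_AE) auto

lemma Lp_mass_add:
  assumes [measurable]: "f \<in> borel_measurable borel" "g \<in> borel_measurable borel" and r: "0 \<le> r"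
  shows "Lp_mass r (\<lambda>x. f x + g x) \<le> ennreal (2 powr r) * (Lp_mass r f + Lp_mass r g)"
proof -
  have *: "\<bar>a + b\<bar> powr r \<le> 2 powr r * (\<bar>a\<bar> powr r + \<bar>b\<bar> powr r)" for a b :: real
  proof -
    have "\<bar>a + b\<bar> powr r \<le> (2 * max \<bar>a\<bar> \<bar>b\<bar>) powr r"
      by (intro powr_mono2 r) auto
    also have "\<dots> = 2 powr r * (max \<bar>a\<bar> \<bar>b\<bar>) powr r"
      by (simp add: powr_mult)
    also have "\<dots> \<le> 2 powr r * (\<bar>a\<bar> powr r + \<bar>b\<bar> powr r)"
      by (intro mult_left_mono) (auto simp: max_def)
    finally show ?thesis .
  qed
  have "Lp_mass r (\<lambda>x. f x + g x) \<le> (\<integral>\<^sup>+x. ennreal (2 powr r) * (ennreal (\<bar>f x\<bar> powr r) + ennreal (\<bar>g x\<bar> powr r)) \<partial>lborel)"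
    unfolding Lp_mass_def using *
    by (intro nn_integral_mono) (simp flip: ennreal_plus ennreal_mult add: ennreal_leI)
  also have "\<dots> = ennreal (2 powr r) * (Lp_mass r f + Lp_mass r g)"
    unfolding Lp_mass_def by (simp add: nn_integral_cmult nn_integral_add)
  finally show ?thesis .
qed

lemma Lp_mass_minus: "Lp_mass r (\<lambda>x. - f x) = Lp_mass r f"
  by (simp add: Lp_mass_def)

lemma Lp_mass_diff_commute: "Lp_mass r (\<lambda>x. f x - g x) = Lp_mass r (\<lambda>x. g x - f x)"
  by (simp add: Lp_mass_def abs_minus_commute)

lemma Lp_mass_diff:
  assumes "f \<in> borel_measurable borel" "g \<in> borel_measurable borel" "0 \<le> r"
  shows "Lp_mass r (\<lambda>x. f x - g x) \<le> ennreal (2 powr r) * (Lp_mass r f + Lp_mass r g)"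
  using Lp_mass_add[of f "\<lambda>x. - g x" r] assms by (simp add: Lp_mass_minus)

text \<open>
  Where \<open>|f| \<le> R\<close> the power \<open>|f|\<^sup>s\<close> is controlled by \<open>|f|\<^sup>r\<close>, elsewhere by \<open>|f|\<^sup>q\<close>. The free height
  \<open>R\<close> makes this a substitute for log-convexity of the norms: for \<open>s < q\<close>, large \<open>R\<close> makes the second
  term small, and then a small \<open>L\<^sup>r\<close> mass makes the first one small.
\<close>
lemma Lp_mass_interpolate:
  assumes [measurable]: "f \<in> borel_measurable borel" and "0 < R" "r \<le> s" "s \<le> q"
  shows "Lp_mass s f \<le> ennreal (R powr (s - r)) * Lp_mass r f + ennreal (R powr (s - q)) * Lp_mass q f"
proof -
  have *: "\<bar>a\<bar> powr s \<le> R powr (s - r) * \<bar>a\<bar> powr r + R powr (s - q) * \<bar>a\<bar> powr q" for a :: real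
  proof (cases "a = 0")
    case False
    show ?thesis
    proof (cases "\<bar>a\<bar> \<le> R")
      case True
      have "\<bar>a\<bar> powr s = \<bar>a\<bar> powr (s - r) * \<bar>a\<bar> powr r"
        by (simp flip: powr_add)
      also have "\<dots> \<le> R powr (s - r) * \<bar>a\<bar> powr r"
        using assms True by (intro mult_right_mono powr_mono2) auto
      finally show ?thesis by (smt (verit) mult_nonneg_nonneg powr_ge_zero)
    next
      case F: False
      have "\<bar>a\<bar> powr s = \<bar>a\<bar> powr (s - q) * \<bar>a\<bar> powr q"
        by (simp flip: powr_add)
      also have "\<dots> \<le> R powr (s - q) * \<bar>a\<bar> powr q"
        using assms F by (intro mult_right_mono powr_mono2') auto
      finally show ?thesis by (smt (verit) mult_nonneg_nonneg powr_ge_zero)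
    qed
  qed auto
  have "Lp_mass s f \<le> (\<integral>\<^sup>+x. ennreal (R powr (s - r)) * ennreal (\<bar>f x\<bar> powr r) + ennreal (R powr (s - q)) * ennreal (\<bar>f x\<bar> powr q) \<partial>lborel)"
    unfolding Lp_mass_def using *
    by (intro nn_integral_mono) (simp flip: ennreal_plus ennreal_mult add: ennreal_leI)
  also have "\<dots> = ennreal (R powr (s - r)) * Lp_mass r f + ennreal (R powr (s - q)) * Lp_mass q f"
    unfolding Lp_mass_def by (simp add: nn_integral_cmult nn_integral_add)
  finally show ?thesis .
qed

lemma Lp_mass_between:
  assumes "f \<in> borel_measurable borel" "r \<le> s" "s \<le> q"
  shows "Lp_mass s f \<le> Lp_mass r f + Lp_mass q f"
  using Lp_mass_interpolate[of f 1 r s q] assms by simp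

lemma nn_integral_lborel_affine:
  fixes f :: "'a::euclidean_space \<Rightarrow> ennreal"
  assumes [measurable]: "f \<in> borel_measurable borel" and c: "c \<noteq> 0"
  shows "(\<integral>\<^sup>+x. f x \<partial>lborel) = ennreal (\<bar>c\<bar> ^ DIM('a)) * (\<integral>\<^sup>+x. f (t + c *\<^sub>R x) \<partial>lborel)"
  by (subst lborel_affine[OF c, of t])
     (simp add: nn_integral_density nn_integral_distr nn_integral_cmult ennreal_power)

lemma nn_integral_lborel_reflect:
  fixes f :: "'a::euclidean_space \<Rightarrow> ennreal"
  assumes [measurable]: "f \<in> borel_measurable borel"
  shows "(\<integral>\<^sup>+x. f (t - x) \<partial>lborel) = (\<integral>\<^sup>+x. f x \<partial>lborel)"
  using nn_integral_lborel_affine[OF assms, of "-1" t] by simp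

lemma nn_integral_lborel_translate:
  fixes f :: "'a::euclidean_space \<Rightarrow> ennreal"
  assumes [measurable]: "f \<in> borel_measurable borel"
  shows "(\<integral>\<^sup>+x. f (x - t) \<partial>lborel) = (\<integral>\<^sup>+x. f x \<partial>lborel)"
  using nn_integral_lborel_affine[OF assms, of 1 "-t"] by simp

lemma integrable_lborel_affine:
  fixes f :: "'a::euclidean_space \<Rightarrow> 'b::{banach, second_countable_topology}"
  assumes f: "integrable lborel f" and c: "c \<noteq> 0"
  shows "integrable lborel (\<lambda>x. f (t + c *\<^sub>R x))"
  using f f[THEN borel_measurable_integrable] c unfolding integrable_iff_bounded
  by (subst (asm) nn_integral_lborel_affine[where c=c and t=t]) (auto simp: ennreal_mult_less_top)

lemma integral_lborel_affine:
  fixes f :: "'a::euclidean_space \<Rightarrow> 'b::{banach, second_countable_topology}"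
  assumes [measurable]: "f \<in> borel_measurable borel" and c: "c \<noteq> 0"
  shows "(\<integral>x. f x \<partial>lborel) = \<bar>c\<bar> ^ DIM('a) *\<^sub>R (\<integral>x. f (t + c *\<^sub>R x) \<partial>lborel)"
  by (subst lborel_affine[OF c, of t])
    (simp add: integral_density integral_distr)

lemma integral_lborel_reflect:
  fixes f :: "'a::euclidean_space \<Rightarrow> 'b::{banach, second_countable_topology}"
  assumes [measurable]: "f \<in> borel_measurable borel"
  shows "(\<integral>x. f (t - x) \<partial>lborel) = (\<integral>x. f x \<partial>lborel)"
  using integral_lborel_affine[OF assms, of "-1" t] by simp

lemma AE_lborel_scale:
  fixes P :: "'a::euclidean_space \<Rightarrow> bool"
  assumes "AE x in lborel. P x" "c \<noteq> 0"
  shows "AE x in lborel. P (c *\<^sub>R x)"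
proof -
  obtain N where N: "N \<in> null_sets lborel" "{x. \<not> P x} \<subseteq> N"
    using assms(1) by (auto simp: eventually_ae_filter)
  hence [measurable]: "N \<in> sets borel" by (auto simp: null_sets_def)
  have "AE x in lborel. c *\<^sub>R x \<notin> N"
  proof -
    have "(\<integral>\<^sup>+x. indicator N x \<partial>(lborel::'a measure)) = 0"
      using N by (simp add: null_sets_def)
    hence "(\<integral>\<^sup>+x. indicator N (0 + c *\<^sub>R x) \<partial>(lborel::'a measure)) = 0"
      using assms(2) by (subst (asm) nn_integral_lborel_affine[of _ c 0]) auto
    thus ?thesis
      by (subst (asm) nn_integral_0_iff_AE) (auto simp: indicator_def)
  qed
  thus ?thesis using N by (auto elim!: eventually_mono)
qed

lemma AE_lborel_reflect:
  fixes P :: "'a::euclidean_space \<Rightarrow> bool"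
  assumes "AE x in lborel. P x"
  shows "AE x in lborel. P (t - x)"
proof -
  obtain N where N: "N \<in> null_sets lborel" "{x. \<not> P x} \<subseteq> N"
    using assms(1) by (auto simp: eventually_ae_filter)
  hence [measurable]: "N \<in> sets borel" by (auto simp: null_sets_def)
  have "AE x in lborel. t - x \<notin> N"
  proof -
    have "(\<integral>\<^sup>+x. indicator N x \<partial>(lborel::'a measure)) = 0"
      using N by (simp add: null_sets_def)
    hence "(\<integral>\<^sup>+x. indicator N (t - x) \<partial>(lborel::'a measure)) = 0"
      by (subst nn_integral_lborel_reflect) auto
    thus ?thesis
      by (subst (asm) nn_integral_0_iff_AE) (auto simp: indicator_def)
  qed
  thus ?thesis using N by (auto elim!: eventually_mono)
qed

lemma Lp_mass_translate:
  "f \<in> borel_measurable borel \<Longrightarrow> Lp_mass r (\<lambda>x. f (x - t)) = Lp_mass r f"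
  unfolding Lp_mass_def by (subst nn_integral_lborel_translate[symmetric, where t=t]) auto

text \<open>
  Convexity of \<open>x powr r\<close>: its graph lies above the tangent at \<open>1\<close>.
\<close>
lemma powr_tangent:
  fixes x r :: real
  assumes "0 \<le> x" "1 \<le> r"
  shows "r * x \<le> x powr r + (r - 1)"
proof (cases "x = 0")
  case False
  have "(x powr r) powr (1/r) * 1 powr (1 - 1/r) \<le> (1/r) * (x powr r) + (1 - 1/r) * 1"
    using assms False by (intro Youngs_inequality_0) auto
  hence "x \<le> (1/r) * (x powr r) + (1 - 1/r)"
    using assms False by (simp add: powr_powr)
  hence "r * x \<le> r * ((1/r) * (x powr r) + (1 - 1/r))"
    using assms by (intro mult_left_mono) auto
  also have "\<dots> = x powr r + (r - 1)" using assms by (simp add: distrib_left right_diff_distrib)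
  finally show ?thesis .
qed (use assms in auto)

text \<open>
  Jensen's inequality for the finite measure \<open>|K| d\<nu>\<close>. With \<open>a\<close> and \<open>m\<close> the integrals of
  \<open>|h|\<^sup>r |K|\<close> and \<open>|K|\<close>, integrate the tangent inequality at \<open>|h| / c\<close> against \<open>|K|\<close>; the optimal
  height is \<open>c = (a / m) powr (1/r)\<close>.
\<close>
lemma weighted_jensen:
  fixes h K :: "'w \<Rightarrow> real"
  assumes [measurable]: "h \<in> borel_measurable \<nu>" and K: "integrable \<nu> K" and r: "1 \<le> r"
    and fin: "(\<integral>\<^sup>+w. ennreal (\<bar>h w\<bar> powr r * \<bar>K w\<bar>) \<partial>\<nu>) < \<infinity>"
  shows "integrable \<nu> (\<lambda>w. h w * K w)"
    and "ennreal (\<bar>\<integral>w. h w * K w \<partial>\<nu>\<bar> powr r)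
       \<le> ennreal ((\<integral>w. \<bar>K w\<bar> \<partial>\<nu>) powr (r - 1)) * (\<integral>\<^sup>+w. ennreal (\<bar>h w\<bar> powr r * \<bar>K w\<bar>) \<partial>\<nu>)"
proof -
  have [measurable]: "K \<in> borel_measurable \<nu>" using K by auto
  have iA: "integrable \<nu> (\<lambda>w. \<bar>h w\<bar> powr r * \<bar>K w\<bar>)"
    using fin by (auto simp: integrable_iff_bounded abs_mult)
  have iM: "integrable \<nu> (\<lambda>w. \<bar>K w\<bar>)" using K by auto
  have le: "\<bar>h w\<bar> \<le> \<bar>h w\<bar> powr r + 1" for w
  proof (cases "\<bar>h w\<bar> \<le> 1")
    case False
    hence "\<bar>h w\<bar> powr 1 \<le> \<bar>h w\<bar> powr r" using r by (intro powr_mono) auto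
    thus ?thesis using False by (simp add: powr_one_gt_zero_iff)
  qed (smt (verit) powr_ge_zero)
  show I: "integrable \<nu> (\<lambda>w. h w * K w)"
  proof (rule Bochner_Integration.integrable_bound)
    show "integrable \<nu> (\<lambda>w. \<bar>h w\<bar> powr r * \<bar>K w\<bar> + \<bar>K w\<bar>)" using iA iM by auto
    show "AE x in \<nu>. norm (h x * K x) \<le> norm (\<bar>h x\<bar> powr r * \<bar>K x\<bar> + \<bar>K x\<bar>)"
    proof (rule AE_I2)
      fix x
      have "\<bar>h x\<bar> * \<bar>K x\<bar> \<le> (\<bar>h x\<bar> powr r + 1) * \<bar>K x\<bar>"
        using le[of x] by (intro mult_right_mono) auto
      thus "norm (h x * K x) \<le> norm (\<bar>h x\<bar> powr r * \<bar>K x\<bar> + \<bar>K x\<bar>)"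
        by (simp add: abs_mult algebra_simps)
    qed
  qed auto
  define a m where "a = (\<integral>w. \<bar>h w\<bar> powr r * \<bar>K w\<bar> \<partial>\<nu>)" and "m = (\<integral>w. \<bar>K w\<bar> \<partial>\<nu>)"
  have a0: "a \<ge> 0" "m \<ge> 0" unfolding a_def m_def by auto
  have eqa: "(\<integral>\<^sup>+w. ennreal (\<bar>h w\<bar> powr r * \<bar>K w\<bar>) \<partial>\<nu>) = ennreal a"
    unfolding a_def by (rule nn_integral_eq_integral[OF iA]) auto
  have "\<bar>\<integral>w. h w * K w \<partial>\<nu>\<bar> powr r \<le> m powr (r - 1) * a"
  proof (cases "a = 0 \<or> m = 0")
    case True
    have "AE w in \<nu>. h w * K w = 0"
    proof (cases "m = 0")
      case True
      hence "AE w in \<nu>. \<bar>K w\<bar> = 0"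
        unfolding m_def using iM by (subst (asm) integral_nonneg_eq_0_iff_AE) auto
      thus ?thesis by eventually_elim auto
    next
      case False
      with \<open>a = 0 \<or> m = 0\<close> have "a = 0" by auto
      hence "AE w in \<nu>. \<bar>h w\<bar> powr r * \<bar>K w\<bar> = 0"
        unfolding a_def using iA by (subst (asm) integral_nonneg_eq_0_iff_AE) auto
      thus ?thesis by eventually_elim auto
    qed
    hence "(\<integral>w. h w * K w \<partial>\<nu>) = 0" by (subst integral_cong_AE[where g="\<lambda>_. 0"]) auto
    thus ?thesis using a0 by simp
  next
    case False
    hence pos: "a > 0" "m > 0" using a0 by auto
    define c where "c = (a / m) powr (1/r)"
    have c: "c > 0" using pos by (simp add: c_def)
    have cr: "c powr r = a / m" using pos r by (simp add: c_def powr_powr)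
    have pt: "r * (\<bar>h w * K w\<bar> / c) \<le> \<bar>h w\<bar> powr r * \<bar>K w\<bar> / c powr r + (r - 1) * \<bar>K w\<bar>" for w
    proof -
      have "r * (\<bar>h w\<bar> / c) \<le> (\<bar>h w\<bar> / c) powr r + (r - 1)"
        using c r by (intro powr_tangent) auto
      hence "r * (\<bar>h w\<bar> / c) * \<bar>K w\<bar> \<le> ((\<bar>h w\<bar> / c) powr r + (r - 1)) * \<bar>K w\<bar>"
        by (intro mult_right_mono) auto
      thus ?thesis using c by (simp add: powr_divide abs_mult algebra_simps)
    qed
    have "r * ((\<integral>w. \<bar>h w * K w\<bar> \<partial>\<nu>) / c) = (\<integral>w. r * (\<bar>h w * K w\<bar> / c) \<partial>\<nu>)"
      by simp
    also have "\<dots> \<le> (\<integral>w. \<bar>h w\<bar> powr r * \<bar>K w\<bar> / c powr r + (r - 1) * \<bar>K w\<bar> \<partial>\<nu>)"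
      using I iA iM K pt by (intro integral_mono Bochner_Integration.integrable_add integrable_mult_right integrable_divide integrable_abs) auto
    also have "\<dots> = a / c powr r + (r - 1) * m"
      unfolding a_def m_def using iA iM by (subst Bochner_Integration.integral_add) auto
    also have "\<dots> = r * m" unfolding cr using pos by (simp add: field_simps)
    finally have "(\<integral>w. \<bar>h w * K w\<bar> \<partial>\<nu>) \<le> c * m"
      using r c by (simp add: field_simps)
    moreover have "\<bar>\<integral>w. h w * K w \<partial>\<nu>\<bar> \<le> (\<integral>w. \<bar>h w * K w\<bar> \<partial>\<nu>)"
      using integral_norm_bound[of \<nu> "\<lambda>w. h w * K w"] by simp
    ultimately have "\<bar>\<integral>w. h w * K w \<partial>\<nu>\<bar> powr r \<le> (c * m) powr r"
      using r by (intro powr_mono2) linarith+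
    also have "\<dots> = m powr (r - 1) * a"
      using pos c cr by (simp add: powr_mult powr_diff)
    finally show ?thesis .
  qed
  thus "ennreal (\<bar>\<integral>w. h w * K w \<partial>\<nu>\<bar> powr r)
       \<le> ennreal ((\<integral>w. \<bar>K w\<bar> \<partial>\<nu>) powr (r - 1)) * (\<integral>\<^sup>+w. ennreal (\<bar>h w\<bar> powr r * \<bar>K w\<bar>) \<partial>\<nu>)"
    unfolding eqa m_def[symmetric] using a0 by (simp flip: ennreal_mult add: ennreal_leI)
qed

text \<open>
  Jensen's inequality in \<open>w\<close> for each \<open>x\<close>, followed by Tonelli. The right-hand side keeps the mass of
  \<open>H (\<cdot>, w)\<close> under the integral, so that dominated convergence in \<open>w\<close> can later be applied to it;
  this is the common source of all kernel estimates below.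
\<close>
lemma minkowski_weighted:
  fixes H :: "'a::euclidean_space \<Rightarrow> 'w \<Rightarrow> real"
  assumes "sigma_finite_measure \<nu>" and [measurable]: "(\<lambda>(x, w). H x w) \<in> borel_measurable (lborel \<Otimes>\<^sub>M \<nu>)"
    and K: "integrable \<nu> K" and r: "1 \<le> r"
    and fin: "(\<integral>\<^sup>+w. ennreal \<bar>K w\<bar> * Lp_mass r (\<lambda>x. H x w) \<partial>\<nu>) < \<infinity>"
  shows "AE x in lborel. integrable \<nu> (\<lambda>w. H x w * K w)"
    and "Lp_mass r (\<lambda>x. \<integral>w. H x w * K w \<partial>\<nu>)
       \<le> ennreal ((\<integral>w. \<bar>K w\<bar> \<partial>\<nu>) powr (r - 1)) * (\<integral>\<^sup>+w. ennreal \<bar>K w\<bar> * Lp_mass r (\<lambda>x. H x w) \<partial>\<nu>)"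
proof -
  interpret \<nu>: sigma_finite_measure \<nu> by fact
  interpret P: pair_sigma_finite lborel \<nu> by standard
  have [measurable]: "K \<in> borel_measurable \<nu>" using K by auto
  have "(\<integral>\<^sup>+x. \<integral>\<^sup>+w. ennreal (\<bar>H x w\<bar> powr r * \<bar>K w\<bar>) \<partial>\<nu> \<partial>lborel) =
      (\<integral>\<^sup>+w. \<integral>\<^sup>+x. ennreal (\<bar>H x w\<bar> powr r * \<bar>K w\<bar>) \<partial>lborel \<partial>\<nu>)"
    by (rule P.Fubini'[symmetric]) auto
  also have "\<dots> = (\<integral>\<^sup>+w. ennreal \<bar>K w\<bar> * Lp_mass r (\<lambda>x. H x w) \<partial>\<nu>)"
    unfolding Lp_mass_def
    by (intro nn_integral_cong, subst nn_integral_cmult[symmetric])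
       (auto simp flip: ennreal_mult simp: mult.commute)
  finally have eq: "(\<integral>\<^sup>+x. \<integral>\<^sup>+w. ennreal (\<bar>H x w\<bar> powr r * \<bar>K w\<bar>) \<partial>\<nu> \<partial>lborel) =
      (\<integral>\<^sup>+w. ennreal \<bar>K w\<bar> * Lp_mass r (\<lambda>x. H x w) \<partial>\<nu>)" .
  have ae: "AE x in lborel. (\<integral>\<^sup>+w. ennreal (\<bar>H x w\<bar> powr r * \<bar>K w\<bar>) \<partial>\<nu>) \<noteq> \<infinity>"
    using fin eq by (intro nn_integral_noteq_infinite) auto
  show "AE x in lborel. integrable \<nu> (\<lambda>w. H x w * K w)"
    using ae by eventually_elim (rule weighted_jensen(1)[OF _ K r], auto simp: less_top)
  have "Lp_mass r (\<lambda>x. \<integral>w. H x w * K w \<partial>\<nu>) \<le>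
     (\<integral>\<^sup>+x. ennreal ((\<integral>w. \<bar>K w\<bar> \<partial>\<nu>) powr (r - 1)) * (\<integral>\<^sup>+w. ennreal (\<bar>H x w\<bar> powr r * \<bar>K w\<bar>) \<partial>\<nu>) \<partial>lborel)"
    unfolding Lp_mass_def
  proof (rule nn_integral_mono_AE)
    show "AE x in lborel. ennreal (\<bar>\<integral>w. H x w * K w \<partial>\<nu>\<bar> powr r) \<le> ennreal ((\<integral>w. \<bar>K w\<bar> \<partial>\<nu>) powr (r - 1)) * (\<integral>\<^sup>+w. ennreal (\<bar>H x w\<bar> powr r * \<bar>K w\<bar>) \<partial>\<nu>)"
      using ae by eventually_elim (rule weighted_jensen(2)[OF _ K r], auto simp: less_top)
  qed
  also have "\<dots> = ennreal ((\<integral>w. \<bar>K w\<bar> \<partial>\<nu>) powr (r - 1)) * (\<integral>\<^sup>+w. ennreal \<bar>K w\<bar> * Lp_mass r (\<lambda>x. H x w) \<partial>\<nu>)"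
    by (subst nn_integral_cmult) (auto simp: eq)
  finally show "Lp_mass r (\<lambda>x. \<integral>w. H x w * K w \<partial>\<nu>)
       \<le> ennreal ((\<integral>w. \<bar>K w\<bar> \<partial>\<nu>) powr (r - 1)) * (\<integral>\<^sup>+w. ennreal \<bar>K w\<bar> * Lp_mass r (\<lambda>x. H x w) \<partial>\<nu>)" .
qed

section \<open>Continuity of translations and of dilated averages\<close>

lemma ennreal_tendsto_0I:
  fixes X :: "nat \<Rightarrow> ennreal"
  assumes "\<And>e::real. e > 0 \<Longrightarrow> eventually (\<lambda>n. X n \<le> ennreal e) sequentially"
  shows "X \<longlonglongrightarrow> 0"
proof (rule order_tendstoI)
  fix a :: ennreal assume "0 < a"
  then obtain e where e: "0 < e" "ennreal e < a"
    by (metis ennreal_0 ennreal_rat_dense ennreal_less_iff less_le order_refl linear ennreal_neg not_less)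
  show "eventually (\<lambda>n. X n < a) sequentially"
    using assms[OF e(1)] by eventually_elim (use e in auto)
qed auto

lemma Lp_mass_dominated_convergence:
  fixes f :: "'a::euclidean_space \<Rightarrow> real"
  assumes [measurable]: "\<And>n. g n \<in> borel_measurable borel" "f \<in> borel_measurable borel" "w \<in> borel_measurable borel"
    and r: "0 < r" and bd: "\<And>n. AE x in lborel. \<bar>g n x - f x\<bar> \<le> w x" and w: "Lp_mass r w < \<infinity>"
    and lim: "AE x in lborel. (\<lambda>n. g n x) \<longlonglongrightarrow> f x"
  shows "(\<lambda>n. Lp_mass r (\<lambda>x. g n x - f x)) \<longlonglongrightarrow> 0"
proof -
  have "(\<lambda>n. \<integral>\<^sup>+x. ennreal (\<bar>g n x - f x\<bar> powr r) \<partial>lborel) \<longlonglongrightarrow> (\<integral>\<^sup>+x. 0 \<partial>(lborel::'a measure))"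
  proof (rule nn_integral_dominated_convergence[where w="\<lambda>x. ennreal (\<bar>w x\<bar> powr r)"])
    show "AE x in lborel. ennreal (\<bar>g n x - f x\<bar> powr r) \<le> ennreal (\<bar>w x\<bar> powr r)" for n
      using bd[of n] by eventually_elim (use r in \<open>auto intro!: ennreal_leI powr_mono2\<close>)
    show "AE x in lborel. (\<lambda>n. ennreal (\<bar>g n x - f x\<bar> powr r)) \<longlonglongrightarrow> 0"
      using lim
    proof eventually_elim
      case (elim x)
      hence "(\<lambda>n. g n x - f x) \<longlonglongrightarrow> 0" by (simp add: LIM_zero_iff)
      hence "(\<lambda>n. \<bar>g n x - f x\<bar>) \<longlonglongrightarrow> 0" by (simp add: tendsto_rabs_zero_iff)
      hence "(\<lambda>n. \<bar>g n x - f x\<bar> powr r) \<longlonglongrightarrow> 0 powr r" using r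
        by (intro tendsto_powr2) (auto intro: always_eventually)
      thus ?case using r by (simp add: tendsto_ennrealI ennreal_0[symmetric] del: ennreal_0)
    qed
  qed (use w in \<open>auto simp: Lp_mass_def\<close>)
  thus ?thesis by (simp add: Lp_mass_def)
qed

definition clamp_to :: "real \<Rightarrow> real \<Rightarrow> real" where
  "clamp_to k y = max (- k) (min k y)"

definition bump :: "real \<Rightarrow> 'a::euclidean_space \<Rightarrow> real" where
  "bump k x = max 0 (min 1 (k + 1 - norm x))"

lemma continuous_clamp_to: "continuous_on A f \<Longrightarrow> continuous_on A (\<lambda>x. clamp_to k (f x))"
  unfolding clamp_to_def by (intro continuous_intros)

lemma continuous_bump: "continuous_on A (bump k)"
  unfolding bump_def by (intro continuous_intros)

lemma borel_measurable_bump [measurable]: "bump k \<in> borel_measurable borel"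
  by (intro borel_measurable_continuous_onI continuous_bump)

lemma borel_measurable_clamp_to [measurable]: "clamp_to k \<in> borel_measurable borel"
  unfolding clamp_to_def by measurable

text \<open>
  Truncate \<open>f\<close> in height and in space, then use that a measurable function is an almost everywhere
  limit of continuous ones. Truncating these in the same way keeps them dominated by one bounded
  function with bounded support.
\<close>
lemma Lp_dense_continuous:
  fixes f :: "'a::euclidean_space \<Rightarrow> real"
  assumes [measurable]: "f \<in> borel_measurable borel" and r: "0 < r"
    and fin: "Lp_mass r f < \<infinity>" and e: "0 < (e::real)"
  obtains g k where "continuous_on UNIV g" "0 \<le> k" "\<And>x. \<bar>g x\<bar> \<le> k" "\<And>x. norm x > k + 1 \<Longrightarrow> g x = 0"
    "Lp_mass r (\<lambda>x. g x - f x) \<le> ennreal e"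
proof -
  define F where "F n x = clamp_to (real n) (f x) * bump (real n) x" for n x
  have [measurable]: "F n \<in> borel_measurable borel" for n unfolding F_def by measurable
  have "(\<lambda>n. Lp_mass r (\<lambda>x. F n x - f x)) \<longlonglongrightarrow> 0"
  proof (rule Lp_mass_dominated_convergence[where w="\<lambda>x. \<bar>f x\<bar>"])
    have b: "\<bar>F n x - f x\<bar> \<le> \<bar>f x\<bar>" for n x
    proof -
      have B: "0 \<le> bump (real n) x" "bump (real n) x \<le> 1" by (auto simp: bump_def)
      show ?thesis
      proof (cases "f x \<ge> 0")
        case True
        hence C: "0 \<le> clamp_to (real n) (f x)" "clamp_to (real n) (f x) \<le> f x" by (auto simp: clamp_to_def)
        hence "0 \<le> F n x" "F n x \<le> f x * 1" unfolding F_def using B True by (auto intro!: mult_mono mult_nonneg_nonneg simp del: mult_1_right)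
        thus ?thesis using True by auto
      next
        case False
        hence C: "0 \<le> - clamp_to (real n) (f x)" "- clamp_to (real n) (f x) \<le> - f x" by (auto simp: clamp_to_def)
        have "0 \<le> (- clamp_to (real n) (f x)) * bump (real n) x" using C B by (intro mult_nonneg_nonneg)
        moreover have "(- clamp_to (real n) (f x)) * bump (real n) x \<le> (- f x) * 1" 
          using C B False by (intro mult_mono) auto
        ultimately show ?thesis using False unfolding F_def by auto
      qed
    qed
    show "AE x in lborel. \<bar>F n x - f x\<bar> \<le> \<bar>f x\<bar>" for n using b by auto
    show "AE x in lborel. (\<lambda>n. F n x) \<longlonglongrightarrow> f x"
    proof (rule AE_I2)
      fix x
      obtain n0 where n0: "real n0 \<ge> max (norm x) \<bar>f x\<bar>" using real_arch_simple by blast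
      have "eventually (\<lambda>n. F n x = f x) sequentially"
        using eventually_ge_at_top[of n0]
      proof eventually_elim
        case (elim n)
        hence "real n \<ge> norm x" "real n \<ge> \<bar>f x\<bar>" using n0 by auto
        thus ?case by (auto simp: F_def clamp_to_def bump_def)
      qed
      thus "(\<lambda>n. F n x) \<longlonglongrightarrow> f x" by (rule tendsto_eventually)
    qed
  qed (use r fin in \<open>auto simp: Lp_mass_def\<close>)
  define e' where "e' = e / (2 * 2 powr r)"
  have e': "e' > 0" using e by (simp add: e'_def)
  hence "0 < ennreal e'" by simp
  with \<open>(\<lambda>n. Lp_mass r (\<lambda>x. F n x - f x)) \<longlonglongrightarrow> 0\<close>
  have "eventually (\<lambda>n. Lp_mass r (\<lambda>x. F n x - f x) < ennreal e') sequentially"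
    by (rule order_tendstoD(2))
  then obtain k where k: "Lp_mass r (\<lambda>x. F k x - f x) < ennreal e'" by (auto simp: eventually_sequentially)
  have "f measurable_on UNIV"
    using assms(1) by (intro lebesgue_measurable_imp_measurable_on measurable_completion) auto
  then obtain N g where N: "negligible N" and g: "\<And>n. continuous_on UNIV (g n)" "\<And>x. x \<notin> N \<Longrightarrow> (\<lambda>n. g n x) \<longlonglongrightarrow> f x"
    unfolding measurable_on_def by auto
  have aeN: "AE x in lborel. x \<notin> N"
    using N unfolding negligible_iff_null_sets by (metis AE_completion_iff AE_not_in)
  define G where "G n x = clamp_to (real k) (g n x) * bump (real k) x" for n x
  have Gc: "continuous_on UNIV (G n)" for n unfolding G_def 
    by (intro continuous_intros continuous_clamp_to continuous_bump g)
  have [measurable]: "G n \<in> borel_measurable borel" for n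
    using Gc by (rule borel_measurable_continuous_onI)
  have [measurable]: "cball 0 (real k + 1) \<in> sets (borel :: 'a measure)"
    by (intro borel_closed closed_cball)
  define w where "w x = 2 * real k * indicator (cball 0 (real k + 1)) x" for x :: 'a
  have [measurable]: "w \<in> borel_measurable borel"
    unfolding w_def by (intro borel_measurable_times borel_measurable_indicator) auto
  have small: "\<bar>clamp_to (real k) y * bump (real k) x\<bar> \<le> real k" "norm x > real k + 1 \<Longrightarrow> bump (real k) x = 0" for y :: real and x :: 'a
  proof -
    have "\<bar>clamp_to (real k) y\<bar> \<le> real k" by (auto simp: clamp_to_def)
    moreover have "\<bar>bump (real k) x\<bar> \<le> 1" by (auto simp: bump_def)
    ultimately have "\<bar>clamp_to (real k) y\<bar> * \<bar>bump (real k) x\<bar> \<le> real k * 1" by (intro mult_mono) auto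
    thus "\<bar>clamp_to (real k) y * bump (real k) x\<bar> \<le> real k" by (simp add: abs_mult)
  qed (auto simp: bump_def)
  have "(\<lambda>n. Lp_mass r (\<lambda>x. G n x - F k x)) \<longlonglongrightarrow> 0"
  proof (rule Lp_mass_dominated_convergence[where w=w])
    have "\<bar>G n x - F k x\<bar> \<le> w x" for n x
    proof (cases "norm x > real k + 1")
      case True thus ?thesis using small(2)[OF True] by (simp add: G_def F_def w_def)
    next
      case False
      thus ?thesis using small(1)[of "g n x" x] small(1)[of "f x" x] unfolding G_def[symmetric] F_def[symmetric] w_def by (auto simp: abs_le_iff)
    qed
    thus "AE x in lborel. \<bar>G n x - F k x\<bar> \<le> w x" for n by auto
    have "Lp_mass r w = (\<integral>\<^sup>+x. ennreal ((2 * real k) powr r) * indicator (cball 0 (real k + 1)) x \<partial>(lborel::'a measure))"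
      unfolding Lp_mass_def w_def by (intro nn_integral_cong) (auto simp: indicator_def)
    also have "\<dots> < \<infinity>" by (subst nn_integral_cmult) (use emeasure_lborel_cball_finite[of "0::'a"] in \<open>auto simp: ennreal_mult_less_top\<close>)
    finally show "Lp_mass r w < \<infinity>" .
    show "AE x in lborel. (\<lambda>n. G n x) \<longlonglongrightarrow> F k x"
      using aeN
    proof eventually_elim
      case (elim x)
      hence "(\<lambda>n. g n x) \<longlonglongrightarrow> f x" by (rule g)
      thus ?case unfolding G_def F_def clamp_to_def by (intro tendsto_intros)
    qed
  qed (use r in auto)
  hence "eventually (\<lambda>n. Lp_mass r (\<lambda>x. G n x - F k x) < ennreal e') sequentially"
    by (rule order_tendstoD(2)) (use e' in simp)
  then obtain n where n: "Lp_mass r (\<lambda>x. G n x - F k x) < ennreal e'" by (auto simp: eventually_sequentially)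
  have "Lp_mass r (\<lambda>x. G n x - f x) = Lp_mass r (\<lambda>x. (G n x - F k x) + (F k x - f x))" by simp
  also have "\<dots> \<le> ennreal (2 powr r) * (Lp_mass r (\<lambda>x. G n x - F k x) + Lp_mass r (\<lambda>x. F k x - f x))"
    using r by (intro Lp_mass_add) auto
  also have "\<dots> \<le> ennreal (2 powr r) * (ennreal e' + ennreal e')"
    using n k by (intro mult_left_mono add_mono) auto
  also have "\<dots> = ennreal e"
    using e e' by (simp flip: ennreal_plus ennreal_mult add: e'_def)
  finally have "Lp_mass r (\<lambda>x. G n x - f x) \<le> ennreal e" .
  moreover have "\<bar>G n x\<bar> \<le> real k" "norm x > real k + 1 \<Longrightarrow> G n x = 0" for x
    using small(1)[of "g n x" x] small(2)[of x] by (auto simp: G_def)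
  ultimately show thesis using Gc by (intro that[of "G n" "real k"]) auto
qed

text \<open>
  For a bounded continuous function with bounded support this is dominated convergence, and the general
  case follows by approximation because translation preserves the mass.
\<close>
lemma Lp_mass_translation_continuous:
  fixes f :: "'a::euclidean_space \<Rightarrow> real"
  assumes [measurable]: "f \<in> borel_measurable borel" and r: "0 < r"
    and fin: "Lp_mass r f < \<infinity>" and h: "h \<longlonglongrightarrow> 0"
  shows "(\<lambda>n. Lp_mass r (\<lambda>x. f (x - h n) - f x)) \<longlonglongrightarrow> 0"
proof (rule ennreal_tendsto_0I)
  fix e :: real assume e: "e > 0"
  define C where "C = 2 powr r"
  have C: "C > 0" by (simp add: C_def)
  define e' where "e' = e / (C + 2 * C * C)"
  have e': "e' > 0" unfolding e'_def using e C by (intro divide_pos_pos add_pos_pos mult_pos_pos) auto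
  obtain g k where g: "continuous_on UNIV g" "0 \<le> k" "\<And>x. \<bar>g x\<bar> \<le> k" "\<And>x. norm x > k + 1 \<Longrightarrow> g x = 0"
    "Lp_mass r (\<lambda>x. g x - f x) \<le> ennreal e'"
    using Lp_dense_continuous[OF assms(1) r fin e'] by metis
  have [measurable]: "g \<in> borel_measurable borel"
    using g(1) by (rule borel_measurable_continuous_onI)
  obtain b where b: "\<And>n. norm (h n) \<le> b"
    using h by (meson Bseq_def convergent_imp_Bseq convergentI)
  have b0: "0 \<le> b" using b[of 0] norm_ge_zero[of "h 0"] by linarith
  have [measurable]: "cball 0 (k + 1 + b) \<in> sets (borel :: 'a measure)"
    by (intro borel_closed closed_cball)
  define w where "w x = 2 * k * indicator (cball 0 (k + 1 + b)) x" for x :: 'a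
  have [measurable]: "w \<in> borel_measurable borel"
    unfolding w_def by (intro borel_measurable_times borel_measurable_indicator) auto
  have "(\<lambda>n. Lp_mass r (\<lambda>x. g (x - h n) - g x)) \<longlonglongrightarrow> 0"
  proof (rule Lp_mass_dominated_convergence[where w=w])
    have "\<bar>g (x - h n) - g x\<bar> \<le> w x" for n x
    proof (cases "norm x > k + 1 + b")
      case True
      have "norm x \<le> norm (x - h n) + norm (h n)" by (metis add.commute norm_triangle_sub)
      hence "norm (x - h n) > k + 1" using b[of n] True by linarith
      hence "g (x - h n) = 0" by (rule g)
      moreover have "g x = 0" using True b0 by (intro g) auto
      ultimately show ?thesis using g(2) by (simp add: w_def)
    next
      case False
      thus ?thesis using g(3)[of "x - h n"] g(3)[of x] unfolding w_def by (auto simp: abs_le_iff)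
    qed
    thus "AE x in lborel. \<bar>g (x - h n) - g x\<bar> \<le> w x" for n by auto
    have "Lp_mass r w = (\<integral>\<^sup>+x. ennreal ((2 * k) powr r) * indicator (cball 0 (k + 1 + b)) x \<partial>(lborel::'a measure))"
      unfolding Lp_mass_def w_def using g(2) by (intro nn_integral_cong) (auto simp: indicator_def)
    also have "\<dots> < \<infinity>" by (subst nn_integral_cmult) (use emeasure_lborel_cball_finite[of "0::'a"] in \<open>auto simp: ennreal_mult_less_top\<close>)
    finally show "Lp_mass r w < \<infinity>" .
    show "AE x in lborel. (\<lambda>n. g (x - h n)) \<longlonglongrightarrow> g x"
    proof (rule AE_I2)
      fix x
      have "(\<lambda>n. x - h n) \<longlonglongrightarrow> x" using tendsto_diff[OF tendsto_const h, of x] by simp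
      thus "(\<lambda>n. g (x - h n)) \<longlonglongrightarrow> g x"
        using g(1) by (intro isCont_tendsto_compose[of x g]) (auto simp: continuous_on_eq_continuous_at)
    qed
  qed (use r in auto)
  hence "eventually (\<lambda>n. Lp_mass r (\<lambda>x. g (x - h n) - g x) < ennreal e') sequentially"
    by (rule order_tendstoD(2)) (use e' in simp)
  thus "eventually (\<lambda>n. Lp_mass r (\<lambda>x. f (x - h n) - f x) \<le> ennreal e) sequentially"
  proof eventually_elim
    case (elim n)
    have fg: "Lp_mass r (\<lambda>x. f (x - h n) - g (x - h n)) \<le> ennreal e'"
      using g(5) Lp_mass_translate[of "\<lambda>x. f x - g x" r "h n"] by (simp add: Lp_mass_diff_commute[of r f g])
    have "Lp_mass r (\<lambda>x. f (x - h n) - f x) = Lp_mass r (\<lambda>x. (f (x - h n) - g (x - h n)) + ((g (x - h n) - g x) + (g x - f x)))"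
      by simp
    also have "\<dots> \<le> ennreal C * (Lp_mass r (\<lambda>x. f (x - h n) - g (x - h n)) + Lp_mass r (\<lambda>x. (g (x - h n) - g x) + (g x - f x)))"
      unfolding C_def using r by (intro Lp_mass_add) auto
    also have "\<dots> \<le> ennreal C * (Lp_mass r (\<lambda>x. f (x - h n) - g (x - h n)) + ennreal C * (Lp_mass r (\<lambda>x. g (x - h n) - g x) + Lp_mass r (\<lambda>x. g x - f x)))"
      unfolding C_def using r by (intro mult_left_mono add_left_mono Lp_mass_add) auto
    also have "\<dots> \<le> ennreal C * (ennreal e' + ennreal C * (ennreal e' + ennreal e'))"
      using elim fg g(5) by (intro mult_left_mono add_mono) auto
    also have "\<dots> = ennreal (C * (e' + C * (e' + e')))"
      using C e' by (simp flip: ennreal_plus ennreal_mult)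
    also have "C * (e' + C * (e' + e')) = e' * (C + 2 * C * C)" by (simp add: algebra_simps)
    also have "\<dots> = e"
    proof -
      have "C + 2 * C * C > 0" using C by (intro add_pos_pos mult_pos_pos) auto
      thus ?thesis unfolding e'_def by simp
    qed
    finally show ?case .
  qed
qed

text \<open>
  Averages of \<open>f\<close> over translates by \<open>a y\<close>, weighted by \<open>K y\<close>, depend continuously on the dilation
  parameter \<open>a\<close>. For \<open>b = 0\<close> this is the approximate identity property (the limit is
  \<open>(\<integral>K) f\<close>), and for \<open>b > 0\<close> it replaces continuity of the dilated kernels in \<open>L\<^sup>1\<close>.
\<close>
lemma Lp_mass_kernel_average_continuous:
  fixes f K :: "'a::euclidean_space \<Rightarrow> real"
  assumes [measurable]: "f \<in> borel_measurable borel" and r: "1 \<le> r"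
    and fin: "Lp_mass r f < \<infinity>" and K: "integrable lborel K" and a: "a \<longlonglongrightarrow> b"
  shows "(\<lambda>n. Lp_mass r (\<lambda>x. (\<integral>y. f (x - a n *\<^sub>R y) * K y \<partial>lborel) - (\<integral>y. f (x - b *\<^sub>R y) * K y \<partial>lborel))) \<longlonglongrightarrow> 0"
    and "AE x in lborel. integrable lborel (\<lambda>y. f (x - b *\<^sub>R y) * K y)"
    and "Lp_mass r (\<lambda>x. \<integral>y. f (x - b *\<^sub>R y) * K y \<partial>lborel)
           \<le> ennreal ((\<integral>y. \<bar>K y\<bar> \<partial>lborel) powr r) * Lp_mass r f"
proof -
  have [measurable]: "K \<in> borel_measurable borel" using K by auto
  define m where "m = (\<integral>y. \<bar>K y\<bar> \<partial>lborel)"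
  have m0: "0 \<le> m" by (simp add: m_def)
  have Kn: "(\<integral>\<^sup>+y. ennreal \<bar>K y\<bar> \<partial>lborel) = ennreal m"
    unfolding m_def by (rule nn_integral_eq_integral) (use K in auto)
  have tr: "Lp_mass r (\<lambda>x. f (x - s *\<^sub>R y)) = Lp_mass r f" for s y
    by (rule Lp_mass_translate) auto
  have eq: "(\<integral>\<^sup>+y. ennreal \<bar>K y\<bar> * Lp_mass r (\<lambda>x. f (x - s *\<^sub>R y)) \<partial>lborel) = ennreal m * Lp_mass r f" for s
    unfolding tr by (subst nn_integral_multc) (auto simp: Kn)
  have fin': "(\<integral>\<^sup>+y. ennreal \<bar>K y\<bar> * Lp_mass r (\<lambda>x. f (x - s *\<^sub>R y)) \<partial>lborel) < \<infinity>" for s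
    unfolding eq using fin by (simp add: ennreal_mult_less_top)
  have I: "AE x in lborel. integrable lborel (\<lambda>y. f (x - s *\<^sub>R y) * K y)" for s
    by (rule minkowski_weighted(1)[OF sigma_finite_lborel _ K r fin']) auto
  show "AE x in lborel. integrable lborel (\<lambda>y. f (x - b *\<^sub>R y) * K y)" by (rule I)
  have "Lp_mass r (\<lambda>x. \<integral>y. f (x - b *\<^sub>R y) * K y \<partial>lborel) \<le> ennreal (m powr (r - 1)) * (ennreal m * Lp_mass r f)"
    using minkowski_weighted(2)[OF sigma_finite_lborel _ K r fin', of b] unfolding eq m_def[symmetric] by simp
  also have "\<dots> = ennreal (m powr r) * Lp_mass r f"
    using m0 by (cases "m = 0") (auto simp: mult.assoc[symmetric] powr_diff simp flip: ennreal_mult)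
  finally show "Lp_mass r (\<lambda>x. \<integral>y. f (x - b *\<^sub>R y) * K y \<partial>lborel)
           \<le> ennreal ((\<integral>y. \<bar>K y\<bar> \<partial>lborel) powr r) * Lp_mass r f" by (simp add: m_def)
  define B where "B n = (\<integral>\<^sup>+y. ennreal \<bar>K y\<bar> * Lp_mass r (\<lambda>x. f (x - a n *\<^sub>R y) - f (x - b *\<^sub>R y)) \<partial>lborel)" for n
  define C where "C = ennreal (2 powr r) * (Lp_mass r f + Lp_mass r f)"
  have C: "C < \<infinity>" using fin by (simp add: C_def ennreal_mult_less_top)
  have le: "Lp_mass r (\<lambda>x. f (x - s *\<^sub>R y) - f (x - t *\<^sub>R y)) \<le> C" for s t y
    unfolding C_def using Lp_mass_diff[of "\<lambda>x. f (x - s *\<^sub>R y)" "\<lambda>x. f (x - t *\<^sub>R y)" r] r by (simp add: tr)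
  have pw: "(\<lambda>n. Lp_mass r (\<lambda>x. f (x - a n *\<^sub>R y) - f (x - b *\<^sub>R y))) \<longlonglongrightarrow> 0" for y
  proof -
    have "(\<lambda>n. (a n - b) *\<^sub>R y) \<longlonglongrightarrow> 0"
      using tendsto_scaleR[OF tendsto_diff[OF a tendsto_const[of b]] tendsto_const[of y]] by simp
    hence "(\<lambda>n. Lp_mass r (\<lambda>x. f (x - (a n - b) *\<^sub>R y) - f x)) \<longlonglongrightarrow> 0"
      using r fin by (intro Lp_mass_translation_continuous) auto
    moreover have "Lp_mass r (\<lambda>x. f (x - (a n - b) *\<^sub>R y) - f x) = Lp_mass r (\<lambda>x. f (x - a n *\<^sub>R y) - f (x - b *\<^sub>R y))" for n
      by (subst Lp_mass_translate[symmetric, where t="b *\<^sub>R y"]) (auto simp: algebra_simps)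
    ultimately show ?thesis by simp
  qed
  have [measurable]: "(\<lambda>y. Lp_mass r (\<lambda>x. f (x - s *\<^sub>R y) - f (x - t *\<^sub>R y))) \<in> borel_measurable borel" for s t
    unfolding Lp_mass_def by measurable
  have "B \<longlonglongrightarrow> (\<integral>\<^sup>+y. 0 \<partial>(lborel :: 'a measure))"
    unfolding B_def
  proof (rule nn_integral_dominated_convergence[where w="\<lambda>y. ennreal \<bar>K y\<bar> * C"])
    show "AE y in lborel. (\<lambda>n. ennreal \<bar>K y\<bar> * Lp_mass r (\<lambda>x. f (x - a n *\<^sub>R y) - f (x - b *\<^sub>R y))) \<longlonglongrightarrow> 0"
    proof (rule AE_I2)
      fix y
      have "(\<lambda>n. ennreal \<bar>K y\<bar> * Lp_mass r (\<lambda>x. f (x - a n *\<^sub>R y) - f (x - b *\<^sub>R y))) \<longlonglongrightarrow> ennreal \<bar>K y\<bar> * 0"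
        by (intro ennreal_tendsto_cmult pw) auto
      thus "(\<lambda>n. ennreal \<bar>K y\<bar> * Lp_mass r (\<lambda>x. f (x - a n *\<^sub>R y) - f (x - b *\<^sub>R y))) \<longlonglongrightarrow> 0" by simp
    qed
  qed (use C le in \<open>auto intro!: mult_left_mono simp: nn_integral_multc Kn ennreal_mult_less_top\<close>)
  hence B0: "B \<longlonglongrightarrow> 0" by simp
  have Bfin: "B n < \<infinity>" for n
  proof -
    have "B n \<le> (\<integral>\<^sup>+y. ennreal \<bar>K y\<bar> * C \<partial>lborel)" unfolding B_def by (intro nn_integral_mono mult_left_mono le) auto
    also have "\<dots> < \<infinity>" using C by (auto simp: nn_integral_multc Kn ennreal_mult_less_top)
    finally show ?thesis .
  qed
  have bd: "Lp_mass r (\<lambda>x. (\<integral>y. f (x - a n *\<^sub>R y) * K y \<partial>lborel) - (\<integral>y. f (x - b *\<^sub>R y) * K y \<partial>lborel)) \<le> ennreal (m powr (r - 1)) * B n" for n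
  proof -
    have "Lp_mass r (\<lambda>x. (\<integral>y. f (x - a n *\<^sub>R y) * K y \<partial>lborel) - (\<integral>y. f (x - b *\<^sub>R y) * K y \<partial>lborel)) =
      Lp_mass r (\<lambda>x. \<integral>y. (f (x - a n *\<^sub>R y) - f (x - b *\<^sub>R y)) * K y \<partial>lborel)"
    proof (rule Lp_mass_cong_AE)
      show "AE x in lborel. (\<integral>y. f (x - a n *\<^sub>R y) * K y \<partial>lborel) - (\<integral>y. f (x - b *\<^sub>R y) * K y \<partial>lborel)
          = (\<integral>y. (f (x - a n *\<^sub>R y) - f (x - b *\<^sub>R y)) * K y \<partial>lborel)"
        using I[of "a n"] I[of b] by eventually_elim (simp add: left_diff_distrib)
    qed
    also have "\<dots> \<le> ennreal (m powr (r - 1)) * B n"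
      unfolding B_def m_def using Bfin[of n]
      by (intro minkowski_weighted(2)[OF sigma_finite_lborel _ K r]) (auto simp: B_def)
    finally show ?thesis .
  qed
  have "(\<lambda>n. ennreal (m powr (r - 1)) * B n) \<longlonglongrightarrow> ennreal (m powr (r - 1)) * 0"
    by (intro ennreal_tendsto_cmult B0) auto
  hence lim: "(\<lambda>n. ennreal (m powr (r - 1)) * B n) \<longlonglongrightarrow> 0" by simp
  show "(\<lambda>n. Lp_mass r (\<lambda>x. (\<integral>y. f (x - a n *\<^sub>R y) * K y \<partial>lborel) - (\<integral>y. f (x - b *\<^sub>R y) * K y \<partial>lborel))) \<longlonglongrightarrow> 0"
    by (rule tendsto_sandwich[OF _ _ tendsto_const lim]) (use bd in auto)
qed

section \<open>Injectivity of the Fourier transform\<close>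

lemma integrable_lborel_prod_Basis:
  fixes f :: "'a::euclidean_space \<Rightarrow> real \<Rightarrow> 'b::{real_normed_field, banach, second_countable_topology}"
  assumes f: "\<And>b. b \<in> Basis \<Longrightarrow> integrable lborel (f b)"
  shows "integrable lborel (\<lambda>x. \<Prod>b\<in>Basis. f b (x \<bullet> b))"
    and "(\<integral>x. (\<Prod>b\<in>Basis. f b (x \<bullet> b)) \<partial>lborel) = (\<Prod>b\<in>Basis. \<integral>x. f b x \<partial>lborel)"
proof -
  interpret product_sigma_finite "\<lambda>_::'a. lborel :: real measure"
    by standard
  have [measurable]: "\<And>b. b \<in> Basis \<Longrightarrow> f b \<in> borel_measurable borel" using f by auto
  have eq: "(\<Prod>b\<in>Basis. f b ((\<Sum>b'\<in>Basis. x b' *\<^sub>R b') \<bullet> b)) = (\<Prod>b\<in>Basis. f b (x b))" for x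
    by (intro prod.cong refl) simp
  have "integrable (\<Pi>\<^sub>M b\<in>Basis. lborel) (\<lambda>x. \<Prod>b\<in>Basis. f b (x b))"
    by (rule product_integrable_prod) (use f in auto)
  thus "integrable lborel (\<lambda>x. \<Prod>b\<in>Basis. f b (x \<bullet> b))"
    by (subst lborel_eq, subst integrable_distr_eq) (simp_all add: eq)
  have "(\<integral>x. (\<Prod>b\<in>Basis. f b (x \<bullet> b)) \<partial>lborel) = (\<integral>x. (\<Prod>b\<in>Basis. f b (x b)) \<partial>(\<Pi>\<^sub>M b\<in>Basis. lborel))"
    by (subst lborel_eq, subst integral_distr) (simp_all add: eq)
  also have "\<dots> = (\<Prod>b\<in>Basis. \<integral>x. f b x \<partial>lborel)"
    by (rule product_integral_prod) (use f in auto)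
  finally show "(\<integral>x. (\<Prod>b\<in>Basis. f b (x \<bullet> b)) \<partial>lborel) = (\<Prod>b\<in>Basis. \<integral>x. f b x \<partial>lborel)" .
qed

definition gauss :: "'a::euclidean_space \<Rightarrow> real" where
  "gauss x = (\<Prod>b\<in>Basis. std_normal_density (x \<bullet> b))"

lemma borel_measurable_gauss [measurable]: "gauss \<in> borel_measurable borel"
  unfolding gauss_def by measurable

lemma integrable_gauss: "integrable lborel gauss" and integral_gauss: "(\<integral>x. gauss x \<partial>lborel) = 1"
  using integrable_lborel_prod_Basis[of "\<lambda>_. std_normal_density"] unfolding gauss_def by auto

lemma gauss_nonneg: "0 \<le> gauss x"
  unfolding gauss_def by (intro prod_nonneg) auto

lemma integral_std_normal_iexp:
  "(\<integral>x. exp (\<i> * complex_of_real (s * x)) * complex_of_real (std_normal_density x) \<partial>lborel) = complex_of_real (exp (- s\<^sup>2 / 2))"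
proof -
  have "complex_of_real (exp (- s\<^sup>2 / 2)) = char std_normal_distribution s"
    by (simp add: char_std_normal_distribution)
  also have "\<dots> = (\<integral>x. std_normal_density x *\<^sub>R iexp (s * x) \<partial>lborel)"
    unfolding char_def by (subst integral_density) (auto simp: )
  finally show ?thesis by (simp add: scaleR_conv_of_real mult.commute)
qed

text \<open>
  The Gaussian is, up to a constant, its own transform; the integral factors over the coordinates into
  one-dimensional characteristic functions.
\<close>
lemma fourier_gauss:
  fixes v :: "'a::euclidean_space"
  shows "(\<integral>x. exp (\<i> * complex_of_real (v \<bullet> x)) * complex_of_real (gauss x) \<partial>lborel)
     = complex_of_real (sqrt (2 * pi) ^ DIM('a) * gauss v)"
proof -
  let ?f = "\<lambda>b x. exp (\<i> * complex_of_real ((v \<bullet> b) * x)) * complex_of_real (std_normal_density x)"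
  have "exp (\<i> * complex_of_real (v \<bullet> x)) * complex_of_real (gauss x) = (\<Prod>b\<in>Basis. ?f b (x \<bullet> b))" for x
    unfolding gauss_def
    by (simp add: prod.distrib exp_sum[symmetric] sum_distrib_left[symmetric] euclidean_inner[of v x])
  moreover have "integrable lborel (?f b)" for b
    by (rule Bochner_Integration.integrable_bound[OF integrable_normal_density[of 1 0]]) (auto simp: norm_mult)
  ultimately have "(\<integral>x. exp (\<i> * complex_of_real (v \<bullet> x)) * complex_of_real (gauss x) \<partial>lborel)
      = (\<Prod>b\<in>Basis. \<integral>x. ?f b x \<partial>lborel)"
    using integrable_lborel_prod_Basis(2)[of ?f] by simp
  also have "\<dots> = (\<Prod>b\<in>Basis. complex_of_real (exp (- (v \<bullet> b)\<^sup>2 / 2)))"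
    unfolding integral_std_normal_iexp ..
  also have "\<dots> = (\<Prod>b\<in>Basis. complex_of_real (sqrt (2 * pi) * std_normal_density (v \<bullet> b)))"
    by (intro prod.cong refl) (simp add: std_normal_density_def)
  also have "\<dots> = complex_of_real (sqrt (2 * pi) ^ DIM('a) * gauss v)"
    by (simp add: gauss_def prod.distrib)
  finally show ?thesis .
qed

text \<open>
  Writing a rescaled Gaussian as a superposition of characters and applying Fubini, every convolution of
  \<open>f\<close> with such a Gaussian is a superposition of values of \<open>fourier f\<close> and hence vanishes. These
  convolutions converge to \<open>f\<close> in \<open>L\<^sup>1\<close> as the width tends to \<open>0\<close>.
\<close>
lemma fourier_eq_0_imp_AE_0:
  fixes f :: "'a::euclidean_space \<Rightarrow> real"
  assumes f: "integrable lborel f" and z: "\<And>\<xi>. fourier f \<xi> = 0"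
  shows "AE x in lborel. f x = 0"
proof -
  have [measurable]: "f \<in> borel_measurable borel" using f by auto
  define c where "c = sqrt (2 * pi) ^ DIM('a)"
  have c: "c \<noteq> 0" by (simp add: c_def)
  \<comment> \<open>The Gaussian of width \<open>e\<close> centred at \<open>x\<close> is a superposition of characters of frequency \<open>\<xi> / e\<close> with weight \<open>gauss \<xi>\<close>.\<close>
  have conv0: "(\<integral>y. f y * gauss ((1 / e) *\<^sub>R (x - y)) \<partial>lborel) = 0" if e: "e > 0" for e x
  proof -
    let ?F = "\<lambda>y \<xi>. complex_of_real (f y) * (exp (\<i> * complex_of_real (((1 / e) *\<^sub>R (x - y)) \<bullet> \<xi>)) * complex_of_real (gauss \<xi>))"
    have int: "integrable (lborel \<Otimes>\<^sub>M lborel) (\<lambda>(y, \<xi>). ?F y \<xi>)"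
    proof (rule lborel_pair.Fubini_integrable)
      have n: "norm (?F y \<xi>) = \<bar>f y\<bar> * gauss \<xi>" for y \<xi>
        by (simp add: norm_mult gauss_nonneg)
      show "integrable lborel (\<lambda>y. \<integral>\<xi>. norm (case (y, \<xi>) of (y, \<xi>) \<Rightarrow> ?F y \<xi>) \<partial>lborel)"
        unfolding prod.case n using f integral_gauss by simp
      show "AE y in lborel. integrable lborel (\<lambda>\<xi>. case (y, \<xi>) of (y, \<xi>) \<Rightarrow> ?F y \<xi>)"
        unfolding prod.case
      proof (rule AE_I2)
        fix y show "integrable lborel (?F y)"
        proof (rule Bochner_Integration.integrable_bound[of _ "\<lambda>\<xi>. \<bar>f y\<bar> * gauss \<xi>"])
          show "AE \<xi> in lborel. norm (?F y \<xi>) \<le> norm (\<bar>f y\<bar> * gauss \<xi>)"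
            unfolding n by simp
        qed (auto simp: integrable_gauss)
      qed
    qed measurable
    have "complex_of_real (c * (\<integral>y. f y * gauss ((1 / e) *\<^sub>R (x - y)) \<partial>lborel)) = 
        (\<integral>y. complex_of_real (f y) * complex_of_real (c * gauss ((1 / e) *\<^sub>R (x - y))) \<partial>lborel)"
      by (simp flip: integral_mult_right_zero integral_complex_of_real add: mult_ac)
    also have "\<dots> = (\<integral>y. (\<integral>\<xi>. ?F y \<xi> \<partial>lborel) \<partial>lborel)"
      unfolding c_def fourier_gauss[symmetric] by simp
    also have "\<dots> = (\<integral>\<xi>. (\<integral>y. ?F y \<xi> \<partial>lborel) \<partial>lborel)"
      by (rule lborel_pair.Fubini_integral[symmetric, OF int])
    also have "\<dots> = (\<integral>\<xi>. exp (\<i> * complex_of_real (((1 / e) *\<^sub>R x) \<bullet> \<xi>)) * complex_of_real (gauss \<xi>) * fourier f ((1 / e) *\<^sub>R \<xi>) \<partial>(lborel::'a measure))"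
    proof (intro Bochner_Integration.integral_cong refl)
      fix \<xi> :: 'a
      have "?F y \<xi> = exp (\<i> * complex_of_real (((1 / e) *\<^sub>R x) \<bullet> \<xi>)) * complex_of_real (gauss \<xi>) *
          (exp (- \<i> * complex_of_real (y \<bullet> ((1 / e) *\<^sub>R \<xi>))) * complex_of_real (f y))" for y
      proof -
        have "exp (\<i> * complex_of_real (((1 / e) *\<^sub>R (x - y)) \<bullet> \<xi>)) =
          exp (\<i> * complex_of_real (((1 / e) *\<^sub>R x) \<bullet> \<xi>)) * exp (- \<i> * complex_of_real (y \<bullet> ((1 / e) *\<^sub>R \<xi>)))"
          unfolding exp_add[symmetric] by (simp add: inner_diff_left diff_divide_distrib algebra_simps)
        thus ?thesis by simp
      qed
      thus "(\<integral>y. ?F y \<xi> \<partial>lborel) = exp (\<i> * complex_of_real (((1 / e) *\<^sub>R x) \<bullet> \<xi>)) * complex_of_real (gauss \<xi>) * fourier f ((1 / e) *\<^sub>R \<xi>)"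
        unfolding fourier_def by (simp only: integral_mult_right_zero)
    qed
    also have "\<dots> = 0" by (simp add: z)
    finally show ?thesis using c by simp
  qed
  have conv: "(\<integral>y. f (x - e *\<^sub>R y) * gauss y \<partial>lborel) = 0" if e: "e > 0" for e x
  proof -
    have "0 = (\<integral>y. f y * gauss ((1 / e) *\<^sub>R (x - y)) \<partial>lborel)" using conv0[OF e] by simp
    also have "\<dots> = \<bar>-e\<bar> ^ DIM('a) *\<^sub>R (\<integral>y. f (x + (-e) *\<^sub>R y) * gauss ((1 / e) *\<^sub>R (x - (x + (-e) *\<^sub>R y))) \<partial>lborel)"
      using e by (intro integral_lborel_affine) auto
    finally show ?thesis using e by simp
  qed
  have m1: "Lp_mass 1 g = (\<integral>\<^sup>+x. ennreal \<bar>g x\<bar> \<partial>lborel)" for g :: "'a \<Rightarrow> real"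
    unfolding Lp_mass_def by (intro nn_integral_cong) simp
  have "Lp_mass 1 f < \<infinity>"
    using f unfolding m1 by (auto simp: integrable_iff_bounded)
  moreover have "(\<lambda>n. 1 / real (Suc n)) \<longlonglongrightarrow> 0"
    by (rule LIMSEQ_Suc[OF lim_1_over_n])
  ultimately have "(\<lambda>n. Lp_mass 1 (\<lambda>x. (\<integral>y. f (x - (1 / real (Suc n)) *\<^sub>R y) * gauss y \<partial>lborel) - (\<integral>y. f (x - 0 *\<^sub>R y) * gauss y \<partial>lborel))) \<longlonglongrightarrow> 0"
    by (intro Lp_mass_kernel_average_continuous(1) integrable_gauss) auto
  hence "Lp_mass 1 f = 0"
    by (subst (asm) conv) (auto simp: integral_gauss Lp_mass_minus LIMSEQ_const_iff)
  thus ?thesis unfolding m1 by (subst (asm) nn_integral_0_iff_AE) auto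
qed

lemma fourier_inject:
  fixes f g :: "'a::euclidean_space \<Rightarrow> real"
  assumes f: "integrable lborel f" and g: "integrable lborel g" and eq: "\<And>\<xi>. fourier f \<xi> = fourier g \<xi>"
  shows "AE x in lborel. f x = g x"
proof -
  have int: "integrable lborel (\<lambda>x. exp (- \<i> * complex_of_real (x \<bullet> \<xi>)) * complex_of_real (h x))"
    if h: "integrable lborel h" for h :: "'a \<Rightarrow> real" and \<xi>
  proof (rule Bochner_Integration.integrable_bound[OF h])
    have [measurable]: "h \<in> borel_measurable borel" using h by auto
    show "(\<lambda>x. exp (- \<i> * complex_of_real (x \<bullet> \<xi>)) * complex_of_real (h x)) \<in> borel_measurable lborel"
      by measurable
  qed (auto simp: norm_mult)
  have "fourier (\<lambda>x. f x - g x) \<xi> = 0" for \<xi>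
    using eq[of \<xi>] int[OF f, of \<xi>] int[OF g, of \<xi>]
    unfolding fourier_def by (simp add: right_diff_distrib)
  hence "AE x in lborel. f x - g x = 0"
    using f g by (intro fourier_eq_0_imp_AE_0) auto
  thus ?thesis by simp
qed

lemma fourier_scale:
  fixes f :: "'a::euclidean_space \<Rightarrow> real"
  assumes f: "integrable lborel f" and c: "c > 0"
  shows "fourier (\<lambda>x. (1 / c) ^ DIM('a) * f ((1 / c) *\<^sub>R x)) \<xi> = fourier f (c *\<^sub>R \<xi>)"
proof -
  have [measurable]: "f \<in> borel_measurable borel" using f by auto
  have "fourier f (c *\<^sub>R \<xi>) = \<bar>1 / c\<bar> ^ DIM('a) *\<^sub>R 
      (\<integral>x. exp (- \<i> * complex_of_real ((0 + (1 / c) *\<^sub>R x) \<bullet> (c *\<^sub>R \<xi>))) * complex_of_real (f (0 + (1 / c) *\<^sub>R x)) \<partial>lborel)"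
    unfolding fourier_def using c by (intro integral_lborel_affine) auto
  also have "\<dots> = fourier (\<lambda>x. (1 / c) ^ DIM('a) * f ((1 / c) *\<^sub>R x)) \<xi>"
    unfolding fourier_def using c by (simp add: scaleR_conv_of_real mult_ac flip: integral_mult_right_zero)
  finally show ?thesis ..
qed

section \<open>Uniqueness for the scalar Caputo equation\<close>

lemma nn_integral_powr_Ioo:
  assumes g: "0 < \<gamma>" and t: "0 \<le> t"
  shows "(\<integral>\<^sup>+s. ennreal (s powr (\<gamma> - 1)) * indicator {0<..<t} s \<partial>lborel) = ennreal (t powr \<gamma> / \<gamma>)"
proof -
  have "((\<lambda>x. x powr (\<gamma> - 1)) has_integral (t powr \<gamma> / \<gamma>)) {0<..<t}"
    using has_integral_powr_from_0[of "\<gamma> - 1" t] g t by (simp add: has_integral_Icc_iff_Ioo)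
  from nn_integral_has_integral_lebesgue'[OF _ this] show ?thesis by simp
qed

lemma nn_integral_powr_diff_Ioo:
  assumes g: "0 < \<gamma>" and t: "0 \<le> t"
  shows "(\<integral>\<^sup>+s. ennreal ((t - s) powr (\<gamma> - 1)) * indicator {0<..<t} s \<partial>lborel) = ennreal (t powr \<gamma> / \<gamma>)"
proof -
  have "(\<integral>\<^sup>+s. ennreal ((t - s) powr (\<gamma> - 1)) * indicator {0<..<t} s \<partial>lborel) = 
     (\<integral>\<^sup>+s. (\<lambda>s. ennreal (s powr (\<gamma> - 1)) * indicator {0<..<t} s) (t - s) \<partial>lborel)"
    by (intro nn_integral_cong) (auto simp: indicator_def)
  also have "\<dots> = ennreal (t powr \<gamma> / \<gamma>)"
    by (subst nn_integral_lborel_reflect) (use nn_integral_powr_Ioo[OF g t] in auto)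
  finally show ?thesis .
qed

text \<open>
  The weakly singular kernel is integrable and \<open>f\<close> is bounded on \<open>[0,t]\<close>; without this, the
  Riemann--Liouville integral would fall back to the default value \<open>0\<close>.
\<close>
lemma rl_kernel_set_integrable:
  fixes f :: "real \<Rightarrow> 'b::euclidean_space"
  assumes g: "0 < \<gamma>" and t: "0 \<le> t" and f: "continuous_on {0..} f"
  shows "set_integrable lborel {0<..<t} (\<lambda>s. (t - s) powr (\<gamma> - 1) *\<^sub>R f s)"
proof -
  have "bounded (f ` {0..t})"
    by (intro compact_imp_bounded compact_continuous_image continuous_on_subset[OF f]) auto
  then obtain B where B: "\<And>s. s \<in> {0..t} \<Longrightarrow> norm (f s) \<le> B" unfolding bounded_iff by blast
  have "integrable lborel (\<lambda>s. indicator {0<..<t} s *\<^sub>R (t - s) powr (\<gamma> - 1))"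
    using nn_integral_powr_diff_Ioo[OF g t]
    by (intro integrableI_nonneg) (auto simp: indicator_mult_ennreal mult.commute)
  hence "set_integrable lborel {0<..<t} (\<lambda>s. B * (t - s) powr (\<gamma> - 1))"
    unfolding set_integrable_def by (auto dest: integrable_mult_left[of B] simp: mult_ac)
  thus ?thesis
  proof (rule set_integrable_bound)
    have [measurable]: "(\<lambda>s. indicator {0<..<t} s *\<^sub>R f s) \<in> borel_measurable borel"
      by (intro borel_measurable_continuous_on_indicator continuous_on_subset[OF f]) auto
    have "(\<lambda>s. (t - s) powr (\<gamma> - 1) *\<^sub>R (indicator {0<..<t} s *\<^sub>R f s)) \<in> borel_measurable borel"
      by measurable
    thus "set_borel_measurable lborel {0<..<t} (\<lambda>s. (t - s) powr (\<gamma> - 1) *\<^sub>R f s)"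
      unfolding set_borel_measurable_def by (simp add: mult.commute)
    have "norm ((t - s) powr (\<gamma> - 1) *\<^sub>R f s) \<le> norm (B * (t - s) powr (\<gamma> - 1))" if "s \<in> {0<..<t}" for s
    proof -
      have "norm (f s) \<le> B" using that by (intro B) auto
      hence "(t - s) powr (\<gamma> - 1) * norm (f s) \<le> (t - s) powr (\<gamma> - 1) * \<bar>B\<bar>" by (intro mult_left_mono) auto
      thus ?thesis by (simp add: mult.commute abs_mult)
    qed
    thus "AE s in lborel. s \<in> {0<..<t} \<longrightarrow> norm ((t - s) powr (\<gamma> - 1) *\<^sub>R f s) \<le> norm (B * (t - s) powr (\<gamma> - 1))" by auto
  qed
qed

lemma rl_integral_tendsto_0:
  fixes w :: "real \<Rightarrow> real"
  assumes g: "0 < \<gamma>" and w: "continuous_on {0..} w"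
  shows "(rl_integral \<gamma> w \<longlongrightarrow> 0) (at_right 0)"
proof -
  have "bounded (w ` {0..1})"
    by (intro compact_imp_bounded compact_continuous_image continuous_on_subset[OF w]) auto
  then obtain B where B: "\<And>s. s \<in> {0..1} \<Longrightarrow> norm (w s) \<le> B" unfolding bounded_iff by blast
  have bd: "norm (rl_integral \<gamma> w t) \<le> \<bar>1 / Gamma \<gamma>\<bar> * (B * (t powr \<gamma> / \<gamma>))" if t: "0 < t" "t < 1" for t
  proof -
    have si: "set_integrable lborel {0<..<t} (\<lambda>s. (t - s) powr (\<gamma> - 1) *\<^sub>R w s)"
      "set_integrable lborel {0<..<t} (\<lambda>s. (t - s) powr (\<gamma> - 1) *\<^sub>R B)"
      using t by (auto intro!: rl_kernel_set_integrable g w continuous_intros simp del: real_scaleR_def)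
    have "norm (LINT s:{0<..<t}|lborel. (t - s) powr (\<gamma> - 1) *\<^sub>R w s) \<le> (LINT s:{0<..<t}|lborel. (t - s) powr (\<gamma> - 1) *\<^sub>R B)"
      unfolding set_lebesgue_integral_def
    proof (rule order_trans[OF integral_norm_bound], rule integral_mono)
      fix s :: real
      have "\<bar>w s\<bar> \<le> B" if "s \<in> {0<..<t}" using B[of s] that t by auto
      thus "norm (indicator {0<..<t} s *\<^sub>R (t - s) powr (\<gamma> - 1) *\<^sub>R w s) \<le> indicator {0<..<t} s *\<^sub>R (t - s) powr (\<gamma> - 1) *\<^sub>R B"
        by (auto simp: indicator_def abs_mult intro!: mult_left_mono)
    qed (use si in \<open>auto simp: set_integrable_def simp del: real_scaleR_def\<close>)
    also have "\<dots> = B * (LINT s:{0<..<t}|lborel. (t - s) powr (\<gamma> - 1))"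
      unfolding set_lebesgue_integral_def by (simp add: mult.commute mult.left_commute)
    also have "(LINT s:{0<..<t}|lborel. (t - s) powr (\<gamma> - 1)) = t powr \<gamma> / \<gamma>"
      unfolding set_lebesgue_integral_def using nn_integral_powr_diff_Ioo[OF g, of t] t g
      by (intro integral_eq_nn_integral[THEN trans]) (auto simp: indicator_mult_ennreal mult.commute)
    finally have "norm (LINT s:{0<..<t}|lborel. (t - s) powr (\<gamma> - 1) *\<^sub>R w s) \<le> B * (t powr \<gamma> / \<gamma>)" .
    thus ?thesis unfolding rl_integral_def norm_scaleR
      by (rule mult_left_mono) simp
  qed
  have "((\<lambda>t. \<bar>1 / Gamma \<gamma>\<bar> * (B * (t powr \<gamma> / \<gamma>))) \<longlongrightarrow> \<bar>1 / Gamma \<gamma>\<bar> * (B * (0 / \<gamma>))) (at_right 0)"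
  proof -
    have "((\<lambda>t. t powr \<gamma>) \<longlongrightarrow> 0 powr \<gamma>) (at_right 0)"
      using g by (intro tendsto_powr2[OF tendsto_ident_at tendsto_const] eventually_at_rightI[of 0 1]) auto
    hence "((\<lambda>t. t powr \<gamma>) \<longlongrightarrow> 0) (at_right 0)" by simp
    thus ?thesis using g by (intro tendsto_intros) auto
  qed
  hence lim: "((\<lambda>t. \<bar>1 / Gamma \<gamma>\<bar> * (B * (t powr \<gamma> / \<gamma>))) \<longlongrightarrow> 0) (at_right 0)" by simp
  show ?thesis
  proof (rule Lim_null_comparison[OF _ lim])
    show "\<forall>\<^sub>F t in at_right 0. norm (rl_integral \<gamma> w t) \<le> \<bar>1 / Gamma \<gamma>\<bar> * (B * (t powr \<gamma> / \<gamma>))"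
      by (intro eventually_at_rightI[of 0 1]) (use bd in auto)
  qed
qed

lemma primitive_deriv:
  fixes w :: "real \<Rightarrow> real"
  assumes w: "continuous_on {0..} w" and t: "0 < t"
  shows "((\<lambda>t. integral {0..t} w) has_real_derivative w t) (at t)"
proof -
  have "((\<lambda>x. integral {0..x} w) has_real_derivative w t) (at t within {0..t+1})"
    using t by (intro integral_has_real_derivative continuous_on_subset[OF w]) auto
  thus ?thesis using t by (simp add: at_within_Icc_at)
qed

text \<open>
  Both sides have the same derivative on \<open>(0,\<infinity>)\<close> and the same limit \<open>0\<close> at \<open>0\<close>. Passing to the primitive
  of \<open>w\<close> turns an equation for a fractional derivative into one without derivatives of \<open>w\<close>.
\<close>
lemma rl_equation_integrated:
  fixes w :: "real \<Rightarrow> real"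
  assumes g: "0 < \<gamma>" and w: "continuous_on {0..} w"
    and d: "\<And>t. 0 < t \<Longrightarrow> (rl_integral \<gamma> w has_real_derivative - \<mu> * w t) (at t)" and t: "0 < t"
  shows "rl_integral \<gamma> w t = - \<mu> * integral {0..t} w"
proof -
  let ?W = "\<lambda>t. integral {0..t} w"
  have "\<exists>c. \<forall>x\<in>{0<..}. rl_integral \<gamma> w x + \<mu> * ?W x = c"
  proof (rule has_field_derivative_zero_constant)
    fix x :: real assume x: "x \<in> {0<..}"
    have "((\<lambda>x. rl_integral \<gamma> w x + \<mu> * ?W x) has_real_derivative (- \<mu> * w x + \<mu> * w x)) (at x)"
      using x d by (intro DERIV_add DERIV_cmult primitive_deriv w) auto
    thus "((\<lambda>x. rl_integral \<gamma> w x + \<mu> * ?W x) has_real_derivative 0) (at x within {0<..})"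
      by (auto intro: has_field_derivative_at_within)
  qed auto
  then obtain c where c: "\<And>x. x > 0 \<Longrightarrow> rl_integral \<gamma> w x + \<mu> * ?W x = c" by auto
  have "continuous_on {0..1} ?W"
    by (intro indefinite_integral_continuous_1 integrable_continuous_real continuous_on_subset[OF w]) auto
  hence "(?W \<longlongrightarrow> ?W 0) (at 0 within {0..1})" unfolding continuous_on_def by (rule bspec) simp
  moreover have "at 0 within {0..1} = at_right (0::real)"
    by (simp add: at_within_Icc_at_right)
  ultimately have "(?W \<longlongrightarrow> 0) (at_right 0)" by simp
  hence "((\<lambda>x. rl_integral \<gamma> w x + \<mu> * ?W x) \<longlongrightarrow> 0 + \<mu> * 0) (at_right 0)"
    by (intro tendsto_intros rl_integral_tendsto_0 g w)
  moreover have "((\<lambda>x. rl_integral \<gamma> w x + \<mu> * ?W x) \<longlongrightarrow> c) (at_right 0)"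
    by (intro tendsto_eventually eventually_at_rightI[of 0 1]) (use c in auto)
  ultimately have "c = 0" using tendsto_unique trivial_limit_at_right_real by fastforce
  with c[OF t] show ?thesis by simp
qed

text \<open>
  Let \<open>W\<close> be the primitive of \<open>w\<close>, and suppose it has a positive maximum on \<open>[0,\<tau>]\<close>, attained at \<open>t\<^sub>0\<close>.
  Integrating \<open>\<integral> (t\<^sub>0 - s)\<^sup>-\<^sup>\<alpha> W'(s) ds\<close> by parts gives the boundary term \<open>W(t\<^sub>0) t\<^sub>0\<^sup>-\<^sup>\<alpha> > 0\<close> and an
  integral of \<open>\<alpha> (W(t\<^sub>0) - W(s)) (t\<^sub>0 - s)\<^sup>-\<^sup>\<alpha>\<^sup>-\<^sup>1 \<ge> 0\<close>, so the fractional integral of \<open>w\<close> is positive at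
  \<open>t\<^sub>0\<close>; but the equation makes it \<open>-\<mu> W(t\<^sub>0) \<le> 0\<close>. The integration by parts is carried out as the
  monotonicity of \<open>H - G\<close>, which avoids integrating the more singular kernel.
\<close>
lemma rl_maximum_principle:
  fixes w :: "real \<Rightarrow> real"
  assumes a: "0 < \<alpha>" "\<alpha> < 1" and w: "continuous_on {0..} w" and \<mu>: "0 \<le> \<mu>"
    and eq: "\<And>t. 0 < t \<Longrightarrow> rl_integral (1 - \<alpha>) w t = - \<mu> * integral {0..t} w" and \<tau>: "0 \<le> \<tau>"
  shows "integral {0..\<tau>} w \<le> 0"
proof (rule ccontr)
  let ?W = "\<lambda>t. integral {0..t} w"
  assume "\<not> ?W \<tau> \<le> 0"
  hence pos: "?W \<tau> > 0" by simp
  have Wc: "continuous_on {0..b} ?W" for b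
    by (intro indefinite_integral_continuous_1 integrable_continuous_real continuous_on_subset[OF w]) auto
  obtain t0 where t0: "t0 \<in> {0..\<tau>}" "\<And>s. s \<in> {0..\<tau>} \<Longrightarrow> ?W s \<le> ?W t0"
    using continuous_attains_sup[OF compact_Icc _ Wc, of \<tau>] \<tau> by auto
  have Wt0: "?W t0 > 0" using t0(2)[of \<tau>] pos \<tau> by auto
  hence t0p: "t0 > 0" using t0(1) by (cases "t0 = 0") auto
  define g where "g s = (t0 - s) powr (- \<alpha>)" for s
  have si: "set_integrable lborel {0<..<t0} (\<lambda>s. g s *\<^sub>R w s)"
    using rl_kernel_set_integrable[OF _ _ w, of "1 - \<alpha>" t0] a t0p by (simp add: g_def)
  have gi: "(\<lambda>s. g s * w s) integrable_on {0..t0}"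
    using set_borel_integral_eq_integral(1)[OF si] by (simp add: integrable_on_Icc_iff_Ioo)
  have rl: "rl_integral (1 - \<alpha>) w t0 = 1 / Gamma (1 - \<alpha>) * integral {0..t0} (\<lambda>s. g s * w s)"
    using set_borel_integral_eq_integral(2)[OF si]
    unfolding rl_integral_def by (simp add: g_def integral_open_interval_real)
  define H where "H s = integral {0..s} (\<lambda>s. g s * w s)" for s
  define G where "G s = - (?W t0 - ?W s) * g s" for s
  have Hc: "continuous_on {0..t0} H"
    unfolding H_def by (intro indefinite_integral_continuous_1 gi)
  have gc: "continuous_on {0..<t0} g"
    unfolding g_def by (intro continuous_intros) auto
  have Gc: "continuous_on {0..t0} G"
    unfolding continuous_on_eq_continuous_within
  proof
    fix s assume s: "s \<in> {0..t0}"
    show "continuous (at s within {0..t0}) G"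
    proof (cases "s = t0")
      case False
      hence s': "s \<in> {0..<t0}" using s by auto
      have "continuous_on {0..<t0} G"
        unfolding G_def by (intro continuous_intros gc continuous_on_subset[OF Wc[of t0]]) auto
      hence "continuous (at s within {0..<t0}) G" using s' by (auto simp: continuous_on_eq_continuous_within)
      moreover have "at s within {0..<t0} = at s within {0..t0}"
        by (rule at_within_nhd[of s "{..<t0}"]) (use s' in auto)
      ultimately show ?thesis by simp
    next
      case True
      have "bounded (w ` {0..t0})"
        by (intro compact_imp_bounded compact_continuous_image continuous_on_subset[OF w]) auto
      then obtain B where B: "\<And>s. s \<in> {0..t0} \<Longrightarrow> norm (w s) \<le> B" unfolding bounded_iff by blast
      \<comment> \<open>\<open>W\<close> is Lipschitz, which beats the singularity because \<open>\<alpha> < 1\<close>.\<close>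
      have bd: "norm (G s) \<le> B * (t0 - s) powr (1 - \<alpha>)" if "s \<in> {0..<t0}" for s
      proof -
        have int: "w integrable_on {0..t0}" "w integrable_on {s..t0}"
          using that by (auto intro!: integrable_continuous_real continuous_on_subset[OF w])
        have "?W t0 - ?W s = integral {s..t0} w"
          using Henstock_Kurzweil_Integration.integral_combine[OF _ _ int(1), of s] that by auto
        also have "norm \<dots> \<le> B * (t0 - s)"
          using that B int by (intro integral_bound continuous_on_subset[OF w]) auto
        finally have "norm (?W t0 - ?W s) \<le> B * (t0 - s)" .
        hence "norm (?W t0 - ?W s) * (t0 - s) powr (-\<alpha>) \<le> B * (t0 - s) * (t0 - s) powr (-\<alpha>)"
          by (intro mult_right_mono) auto
        also have "\<dots> = B * (t0 - s) powr (1 - \<alpha>)"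
          using that powr_add[of "t0 - s" 1 "-\<alpha>"] by simp
        finally show ?thesis unfolding G_def g_def by (simp add: abs_mult abs_minus_commute)
      qed
      have "((\<lambda>s. (t0 - s) powr (1 - \<alpha>)) \<longlongrightarrow> (t0 - t0) powr (1 - \<alpha>)) (at t0 within {0..t0})"
        using a by (intro tendsto_powr2 tendsto_diff tendsto_const tendsto_ident_at) (auto simp: eventually_at intro: exI[of _ 1])
      hence "((\<lambda>s. B * (t0 - s) powr (1 - \<alpha>)) \<longlongrightarrow> B * 0) (at t0 within {0..t0})"
        by (intro tendsto_mult tendsto_const) simp
      hence lim: "((\<lambda>s. B * (t0 - s) powr (1 - \<alpha>)) \<longlongrightarrow> 0) (at t0 within {0..t0})" by simp
      have "(G \<longlongrightarrow> 0) (at t0 within {0..t0})"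
        by (rule Lim_null_comparison[OF _ lim]) (use bd in \<open>auto simp: eventually_at intro!: exI[of _ 1]\<close>)
      thus ?thesis unfolding True by (simp add: continuous_within G_def)
    qed
  qed
  have "H 0 - G 0 \<le> H t0 - G t0"
  proof (rule DERIV_nonneg_imp_increasing_open[where f="\<lambda>s. H s - G s"])
    fix s assume s: "0 < s" "s < t0"
    have dH: "(H has_real_derivative g s * w s) (at s)"
    proof -
      define b where "b = (s + t0) / 2"
      have b: "s < b" "b < t0" using s by (auto simp: b_def)
      have "(H has_real_derivative g s * w s) (at s within {0..b})"
        unfolding H_def using s b
        by (intro integral_has_real_derivative continuous_on_mult continuous_on_subset[OF w] continuous_on_subset[OF gc]) auto
      thus ?thesis using s b by (simp add: at_within_Icc_at)
    qed
    have dg: "(g has_real_derivative \<alpha> * (t0 - s) powr (- \<alpha> - 1)) (at s)"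
      unfolding g_def using s by (auto intro!: derivative_eq_intros)
    have dG: "(G has_real_derivative (w s * g s - (?W t0 - ?W s) * (\<alpha> * (t0 - s) powr (- \<alpha> - 1)))) (at s)"
      unfolding G_def using s
      by (auto intro!: derivative_eq_intros primitive_deriv w dg simp: algebra_simps)
    have "((\<lambda>s. H s - G s) has_real_derivative (g s * w s - (w s * g s - (?W t0 - ?W s) * (\<alpha> * (t0 - s) powr (- \<alpha> - 1))))) (at s)"
      by (intro DERIV_diff dH dG)
    moreover have "(?W t0 - ?W s) * (\<alpha> * (t0 - s) powr (- \<alpha> - 1)) \<ge> 0"
      using t0 s a by (intro mult_nonneg_nonneg) auto
    moreover have "g s * w s - (w s * g s - (?W t0 - ?W s) * (\<alpha> * (t0 - s) powr (- \<alpha> - 1))) = (?W t0 - ?W s) * (\<alpha> * (t0 - s) powr (- \<alpha> - 1))"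
      by simp
    ultimately show "\<exists>y. ((\<lambda>s. H s - G s) has_real_derivative y) (at s) \<and> 0 \<le> y"
      by metis
  qed (use t0p Hc Gc in \<open>auto intro!: continuous_intros\<close>)
  hence "H t0 \<ge> ?W t0 * t0 powr (- \<alpha>)" by (simp add: H_def G_def g_def)
  moreover have "?W t0 * t0 powr (- \<alpha>) > 0" using Wt0 t0p by simp
  ultimately have "H t0 > 0" by linarith
  moreover have "Gamma (1 - \<alpha>) > 0" using a by (intro Gamma_real_pos) auto
  ultimately have "rl_integral (1 - \<alpha>) w t0 > 0" unfolding rl H_def by simp
  moreover have "rl_integral (1 - \<alpha>) w t0 \<le> 0" using eq[OF t0p] Wt0 \<mu> by simp
  ultimately show False by simp
qed

lemma rl_uminus: "rl_integral \<gamma> (\<lambda>t. - w t) t = - rl_integral \<gamma> w t"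
  unfolding rl_integral_def set_lebesgue_integral_def by simp

text \<open>
  The maximum principle for \<open>w\<close> and for \<open>-w\<close> makes the primitive of \<open>w\<close> vanish.
\<close>
lemma rl_uniqueness_real:
  fixes w :: "real \<Rightarrow> real"
  assumes a: "0 < \<alpha>" "\<alpha> < 1" and w: "continuous_on {0..} w" and \<mu>: "0 \<le> \<mu>"
    and d: "\<And>t. 0 < t \<Longrightarrow> (rl_integral (1 - \<alpha>) w has_real_derivative - \<mu> * w t) (at t)" and t: "0 < t"
  shows "w t = 0"
proof -
  have eq: "rl_integral (1 - \<alpha>) w t = - \<mu> * integral {0..t} w" if "0 < t" for t
    using a that by (intro rl_equation_integrated w d) auto
  have eq': "rl_integral (1 - \<alpha>) (\<lambda>t. - w t) t = - \<mu> * integral {0..t} (\<lambda>t. - w t)" if "0 < t" for t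
    using eq[OF that] unfolding rl_uminus by simp
  have W0: "integral {0..t} w = 0" if "0 \<le> t" for t
    using rl_maximum_principle[OF a w \<mu> eq that] rl_maximum_principle[OF a continuous_on_minus[OF w] \<mu> eq' that] by simp
  have "((\<lambda>t. integral {0..t} w) has_real_derivative w t) (at t)" by (rule primitive_deriv[OF w t])
  moreover have "((\<lambda>t. integral {0..t} w) has_real_derivative 0) (at t)"
  proof (rule has_field_derivative_transform_within_open[of "\<lambda>_. 0" _ _ "{0<..}"])
    fix x :: real assume "x \<in> {0<..}"
    thus "0 = integral {0..x} w" using W0[of x] by simp
  qed (use t in auto)
  ultimately show "w t = 0" by (rule DERIV_unique)
qed

lemma rl_integral_bounded_linear:
  fixes f :: "real \<Rightarrow> 'b::euclidean_space" and T :: "'b \<Rightarrow> 'c::euclidean_space"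
  assumes T: "bounded_linear T" and g: "0 < \<gamma>" and t: "0 \<le> t" and f: "continuous_on {0..} f"
  shows "rl_integral \<gamma> (\<lambda>s. T (f s)) t = T (rl_integral \<gamma> f t)"
proof -
  interpret bounded_linear T by fact
  have "T (LINT s:{0<..<t}|lborel. (t - s) powr (\<gamma> - 1) *\<^sub>R f s) = (LINT s:{0<..<t}|lborel. (t - s) powr (\<gamma> - 1) *\<^sub>R T (f s))"
    using integral_bounded_linear[OF T rl_kernel_set_integrable[OF g t f, unfolded set_integrable_def]]
    unfolding set_lebesgue_integral_def by (simp add: scaleR)
  thus ?thesis unfolding rl_integral_def by (simp add: scaleR)
qed

lemma caputo_uniqueness:
  fixes z1 z2 :: "real \<Rightarrow> complex"
  assumes a: "0 < \<alpha>" "\<alpha> < 1" and \<mu>: "0 \<le> \<mu>"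
    and c: "continuous_on {0..} z1" "continuous_on {0..} z2" and "z1 0 = z2 0"
    and d1: "\<And>t. 0 < t \<Longrightarrow> has_caputo_derivative \<alpha> z1 (- complex_of_real \<mu> * z1 t) t"
    and d2: "\<And>t. 0 < t \<Longrightarrow> has_caputo_derivative \<alpha> z2 (- complex_of_real \<mu> * z2 t) t"
    and t: "0 < t"
  shows "z1 t = z2 t"
proof -
  define w where "w s = z1 s - z2 s" for s
  have wc: "continuous_on {0..} w" unfolding w_def by (intro continuous_intros c)
  have rlw: "rl_integral (1 - \<alpha>) w t = rl_integral (1 - \<alpha>) (\<lambda>s. z1 s - z1 0) t - rl_integral (1 - \<alpha>) (\<lambda>s. z2 s - z2 0) t"
    if "0 < t" for t
  proof -
    have "set_integrable lborel {0<..<t} (\<lambda>s. (t - s) powr (1 - \<alpha> - 1) *\<^sub>R (z s - z 0))" if "continuous_on {0..} z" for z :: "real \<Rightarrow> complex"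
      using \<open>0 < t\<close> a that by (intro rl_kernel_set_integrable continuous_intros) auto
    from set_integral_diff(2)[OF this[OF c(1)] this[OF c(2)]] show ?thesis
      unfolding rl_integral_def w_def using \<open>z1 0 = z2 0\<close> by (simp add: scaleR_diff_right flip: scaleR_diff_right)
  qed
  have dw: "(rl_integral (1 - \<alpha>) w has_vector_derivative (- complex_of_real \<mu> * w t)) (at t)" if "0 < t" for t
  proof -
    have "((\<lambda>t. rl_integral (1 - \<alpha>) (\<lambda>s. z1 s - z1 0) t - rl_integral (1 - \<alpha>) (\<lambda>s. z2 s - z2 0) t) has_vector_derivative
       (- complex_of_real \<mu> * z1 t) - (- complex_of_real \<mu> * z2 t)) (at t)"
      using d1[OF that] d2[OF that] unfolding has_caputo_derivative_def has_rl_derivative_def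
      by (rule has_vector_derivative_diff)
    hence "((\<lambda>t. rl_integral (1 - \<alpha>) (\<lambda>s. z1 s - z1 0) t - rl_integral (1 - \<alpha>) (\<lambda>s. z2 s - z2 0) t) has_vector_derivative
       (- complex_of_real \<mu> * w t)) (at t)" by (simp add: w_def algebra_simps)
    thus ?thesis
      by (rule has_vector_derivative_transform_within_open[of _ _ _ "{0<..}"]) (use that rlw in auto)
  qed
  have comp: "T (w t) = 0" if T: "bounded_linear T" and Tm: "\<And>x. T (complex_of_real \<mu> * x) = \<mu> * T x" for T :: "complex \<Rightarrow> real"
  proof (rule rl_uniqueness_real[OF a _ \<mu> _ t])
    interpret bounded_linear T by fact
    show "continuous_on {0..} (\<lambda>t. T (w t))" by (intro continuous_on wc)
    fix t :: real assume t: "0 < t"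
    have "((\<lambda>t. T (rl_integral (1 - \<alpha>) w t)) has_vector_derivative T (- complex_of_real \<mu> * w t)) (at t)"
      by (rule has_vector_derivative[OF dw[OF t]])
    hence "(rl_integral (1 - \<alpha>) (\<lambda>t. T (w t)) has_vector_derivative T (- complex_of_real \<mu> * w t)) (at t)"
      by (rule has_vector_derivative_transform_within_open[of _ _ _ "{0<..}"])
         (use t a wc in \<open>auto simp: rl_integral_bounded_linear[OF T]\<close>)
    thus "(rl_integral (1 - \<alpha>) (\<lambda>t. T (w t)) has_real_derivative - \<mu> * T (w t)) (at t)"
      by (simp add: has_real_derivative_iff_has_vector_derivative neg Tm)
  qed
  have "Re (w t) = 0" "Im (w t) = 0"
    by (rule comp[OF bounded_linear_Re]; simp) (rule comp[OF bounded_linear_Im]; simp)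
  thus ?thesis by (simp add: w_def complex_eq_iff)
qed

section \<open>Self-similarity of the two kernels\<close>

text \<open>
  Substitution \<open>s \<mapsto> c s\<close>; it holds for every \<open>f\<close>, since neither side is integrable unless both are.
\<close>
lemma rl_integral_rescale:
  assumes c: "0 < c"
  shows "rl_integral \<gamma> f (c * t) = c powr \<gamma> *\<^sub>R rl_integral \<gamma> (\<lambda>s. f (c * s)) t"
proof -
  have "(LINT s:{0<..<c * t}|lborel. (c * t - s) powr (\<gamma> - 1) *\<^sub>R f s) =
     \<bar>c\<bar> *\<^sub>R (\<integral>s. indicator {0<..<c * t} (0 + c * s) *\<^sub>R ((c * t - (0 + c * s)) powr (\<gamma> - 1) *\<^sub>R f (0 + c * s)) \<partial>lborel)"
    unfolding set_lebesgue_integral_def using c by (intro lborel_integral_real_affine) auto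
  also have "(\<lambda>s. indicator {0<..<c * t} (0 + c * s) *\<^sub>R ((c * t - (0 + c * s)) powr (\<gamma> - 1) *\<^sub>R f (0 + c * s)))
     = (\<lambda>s. c powr (\<gamma> - 1) *\<^sub>R (indicator {0<..<t} s *\<^sub>R ((t - s) powr (\<gamma> - 1) *\<^sub>R f (c * s))))"
  proof
    fix s
    show "indicator {0<..<c * t} (0 + c * s) *\<^sub>R ((c * t - (0 + c * s)) powr (\<gamma> - 1) *\<^sub>R f (0 + c * s))
     = c powr (\<gamma> - 1) *\<^sub>R (indicator {0<..<t} s *\<^sub>R ((t - s) powr (\<gamma> - 1) *\<^sub>R f (c * s)))"
    proof (cases "s \<in> {0<..<t}")
      case True
      have "(c * t - c * s) powr (\<gamma> - 1) = c powr (\<gamma> - 1) * (t - s) powr (\<gamma> - 1)"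
        using c True by (simp add: powr_mult flip: right_diff_distrib)
      thus ?thesis using c True by simp
    next
      case False
      hence "c * s \<notin> {0<..<c * t}" using c by (auto simp: zero_less_mult_iff)
      thus ?thesis using False by simp
    qed
  qed
  also have "\<bar>c\<bar> *\<^sub>R (\<integral>s. c powr (\<gamma> - 1) *\<^sub>R (indicator {0<..<t} s *\<^sub>R ((t - s) powr (\<gamma> - 1) *\<^sub>R f (c * s))) \<partial>lborel)
    = c powr \<gamma> *\<^sub>R (LINT s:{0<..<t}|lborel. (t - s) powr (\<gamma> - 1) *\<^sub>R f (c * s))"
    unfolding set_lebesgue_integral_def integral_scaleR_right using c
    by (simp add: powr_diff)
  finally show ?thesis unfolding rl_integral_def by (simp add: mult.commute)
qed

text \<open>
  Both sides, as functions of \<open>t\<close>, solve the scalar Caputo equation with the parameter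
  \<open>c powr \<alpha> * norm \<xi> powr (2 * \<beta>)\<close> and the initial value \<open>1\<close>.
\<close>
lemma fundamental_solution_fourier_rescale:
  fixes Z :: "'a::euclidean_space \<Rightarrow> real \<Rightarrow> real"
  assumes a: "0 < \<alpha>" "\<alpha> < 1" and b: "0 < \<beta>" and fs: "fundamental_solution \<alpha> \<beta> Z"
    and c: "0 < c" and t: "0 < t"
  shows "fourier (\<lambda>x. Z x (c * t)) \<xi> = fourier (\<lambda>x. Z x t) (c powr (\<alpha> / (2 * \<beta>)) *\<^sub>R \<xi>)"
proof -
  define \<xi>' where "\<xi>' = c powr (\<alpha> / (2 * \<beta>)) *\<^sub>R \<xi>"
  define lam where "lam = norm \<xi> powr (2 * \<beta>)"
  have lam': "norm \<xi>' powr (2 * \<beta>) = c powr \<alpha> * lam"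
    using b by (simp add: \<xi>'_def lam_def powr_mult powr_powr)
  obtain z where z: "z 0 = 1" "\<And>t. t > 0 \<Longrightarrow> z t = fourier (\<lambda>x. Z x t) \<xi>" "continuous_on {0..} z"
    "\<And>t. t > 0 \<Longrightarrow> has_caputo_derivative \<alpha> z (- complex_of_real lam * z t) t"
    using fs unfolding fundamental_solution_def lam_def by metis
  obtain z' where z': "z' 0 = 1" "\<And>t. t > 0 \<Longrightarrow> z' t = fourier (\<lambda>x. Z x t) \<xi>'" "continuous_on {0..} z'"
    "\<And>t. t > 0 \<Longrightarrow> has_caputo_derivative \<alpha> z' (- complex_of_real (c powr \<alpha> * lam) * z' t) t"
    using fs unfolding fundamental_solution_def lam'[symmetric] by metis
  define z1 where "z1 s = z (c * s)" for s
  have "z1 t = z' t"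
  proof (rule caputo_uniqueness[OF a, where \<mu>="c powr \<alpha> * lam"])
    show "continuous_on {0..} z1"
      unfolding z1_def by (rule continuous_on_compose2[OF z(3)]) (use c in \<open>auto intro!: continuous_intros\<close>)
    fix t :: real assume t: "0 < t"
    have lin: "((*) c has_vector_derivative c) (at t)"
      unfolding has_real_derivative_iff_has_vector_derivative[symmetric]
      by (auto intro!: derivative_eq_intros)
    have "(rl_integral (1 - \<alpha>) (\<lambda>s. z s - z 0) has_vector_derivative - complex_of_real lam * z (c * t)) (at (c * t))"
      using z(4)[of "c * t"] c t unfolding has_caputo_derivative_def has_rl_derivative_def by simp
    from vector_diff_chain_at[OF lin this]
    have "((\<lambda>t. rl_integral (1 - \<alpha>) (\<lambda>s. z s - z 0) (c * t)) has_vector_derivative (c *\<^sub>R (- complex_of_real lam * z (c * t)))) (at t)"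
      by (simp add: o_def)
    hence "((\<lambda>t. c powr (\<alpha> - 1) *\<^sub>R rl_integral (1 - \<alpha>) (\<lambda>s. z s - z 0) (c * t)) has_vector_derivative (c powr (\<alpha> - 1) *\<^sub>R (c *\<^sub>R (- complex_of_real lam * z (c * t))))) (at t)"
      by (rule bounded_linear.has_vector_derivative[OF bounded_linear_scaleR_right])
    moreover have "c powr (\<alpha> - 1) *\<^sub>R rl_integral (1 - \<alpha>) (\<lambda>s. z s - z 0) (c * t) = rl_integral (1 - \<alpha>) (\<lambda>s. z1 s - z1 0) t" for t
      unfolding rl_integral_rescale[OF c] z1_def using c by (simp flip: powr_add)
    moreover have "c powr (\<alpha> - 1) *\<^sub>R (c *\<^sub>R (- complex_of_real lam * z (c * t))) = - complex_of_real (c powr \<alpha> * lam) * z1 t"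
      using c by (simp add: z1_def scaleR_conv_of_real powr_diff)
    ultimately show "has_caputo_derivative \<alpha> z1 (- complex_of_real (c powr \<alpha> * lam) * z1 t) t"
      unfolding has_caputo_derivative_def has_rl_derivative_def by simp
  qed (use z z' t in \<open>auto simp: z1_def lam_def\<close>)
  thus ?thesis using z(2)[of "c * t"] z'(2)[OF t] c t by (simp add: z1_def \<xi>'_def)
qed

text \<open>
  At \<open>\<xi> = 0\<close> the Caputo equation has parameter \<open>0\<close>, and its solution is constant.
\<close>
lemma fundamental_solution_mass_1:
  fixes Z :: "'a::euclidean_space \<Rightarrow> real \<Rightarrow> real"
  assumes a: "0 < \<alpha>" "\<alpha> < 1" and b: "0 < \<beta>" and fs: "fundamental_solution \<alpha> \<beta> Z" and t: "0 < t"
  shows "(\<integral>x. Z x t \<partial>lborel) = 1"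
proof -
  obtain z where z: "z 0 = 1" "\<And>t. t > 0 \<Longrightarrow> z t = fourier (\<lambda>x. Z x t) 0" "continuous_on {0..} z"
    "\<And>t. t > 0 \<Longrightarrow> has_caputo_derivative \<alpha> z (- complex_of_real 0 * z t) t"
    using fs b unfolding fundamental_solution_def by (metis norm_zero powr_0)
  have "z t = (\<lambda>_. 1) t"
  proof (rule caputo_uniqueness[OF a, where \<mu>=0])
    fix t :: real
    show "has_caputo_derivative \<alpha> (\<lambda>_. 1) (- complex_of_real 0 * 1) t"
      unfolding has_caputo_derivative_def has_rl_derivative_def rl_integral_def[abs_def] by simp
  qed (use z t in auto)
  hence "fourier (\<lambda>x. Z x t) 0 = 1" using z(2)[OF t] by simp
  thus ?thesis unfolding fourier_def by simp
qed

text \<open>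
  Self-similarity of \<open>Z\<close>. It reduces every time to \<open>t = 1\<close>, where integrability is known, and so
  makes the \<open>L\<^sup>1\<close> norm of \<open>Z(\<cdot>,t)\<close> constant in time.
\<close>
lemma fundamental_solution_rescale:
  fixes Z :: "'a::euclidean_space \<Rightarrow> real \<Rightarrow> real"
  assumes a: "0 < \<alpha>" "\<alpha> < 1" and b: "0 < \<beta>" and fs: "fundamental_solution \<alpha> \<beta> Z"
    and c: "0 < c" and t: "0 < t"
  defines "\<delta> \<equiv> c powr (\<alpha> / (2 * \<beta>))"
  shows "AE x in lborel. Z x (c * t) = (1 / \<delta>) ^ DIM('a) * Z ((1 / \<delta>) *\<^sub>R x) t"
proof (rule fourier_inject)
  have d: "\<delta> > 0" using c by (simp add: \<delta>_def)
  have int: "integrable lborel (\<lambda>x. Z x t)" if "t > 0" for t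
    using fs that by (simp add: fundamental_solution_def)
  show "integrable lborel (\<lambda>x. Z x (c * t))" using c t by (intro int) auto
  show "integrable lborel (\<lambda>x. (1 / \<delta>) ^ DIM('a) * Z ((1 / \<delta>) *\<^sub>R x) t)"
    using integrable_lborel_affine[OF int[OF t], of "1 / \<delta>" 0] d by auto
  show "fourier (\<lambda>x. Z x (c * t)) \<xi> = fourier (\<lambda>x. (1 / \<delta>) ^ DIM('a) * Z ((1 / \<delta>) *\<^sub>R x) t) \<xi>" for \<xi>
    using fourier_scale[OF int[OF t] d, of \<xi>] fundamental_solution_fourier_rescale[OF a b fs c t, of \<xi>]
    by (simp add: \<delta>_def)
qed

text \<open>
  The scaling law of \<open>Z\<close> holds at each time for almost every \<open>x\<close>. Exchanging the two null sets gives,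
  for almost every \<open>x\<close>, the law at almost every time, which is what the integral in time sees.
\<close>
lemma rl_integral_fundamental_solution_rescale:
  fixes Z :: "'a::euclidean_space \<Rightarrow> real \<Rightarrow> real"
  assumes a: "0 < \<alpha>" "\<alpha> < 1" and b: "0 < \<beta>" and fs: "fundamental_solution \<alpha> \<beta> Z"
    and c: "0 < c"
  defines "\<delta> \<equiv> c powr (\<alpha> / (2 * \<beta>))"
  shows "AE x in lborel. rl_integral \<gamma> (Z x) (c * t) = c powr \<gamma> * (1 / \<delta>) ^ DIM('a) * rl_integral \<gamma> (Z ((1 / \<delta>) *\<^sub>R x)) t"
proof -
  have d: "\<delta> > 0" using c by (simp add: \<delta>_def)
  define Z' where "Z' x s = indicator {0<..} s * Z x s" for x s
  have "(\<lambda>p. indicator (UNIV \<times> {0<..}) p *\<^sub>R (case p of (x, t) \<Rightarrow> Z x t)) \<in> borel_measurable borel"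
    using fs unfolding fundamental_solution_def set_borel_measurable_def by auto
  also have "(\<lambda>p. indicator (UNIV \<times> {0<..}) p *\<^sub>R (case p of (x, t) \<Rightarrow> Z x t)) = (\<lambda>(x, s). Z' x s)"
    by (auto simp: Z'_def fun_eq_iff indicator_def)
  finally have [measurable]: "(\<lambda>(x, s). Z' x s) \<in> borel_measurable (borel \<Otimes>\<^sub>M borel)"
    by (simp add: borel_prod)
  have Zs: "Z' x s = Z x s" if "s > 0" for x s using that by (simp add: Z'_def)
  let ?P = "\<lambda>x s. Z' x (c * s) = (1 / \<delta>) ^ DIM('a) * Z' ((1 / \<delta>) *\<^sub>R x) s"
  have "AE s in lborel. AE x in lborel. ?P x s"
  proof (rule AE_I2)
    fix s :: real
    show "AE x in lborel. ?P x s"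
    proof (cases "s > 0")
      case True
      thus ?thesis using fundamental_solution_rescale[OF a b fs c True] c by (simp add: Zs \<delta>_def)
    next
      case False
      hence "\<not> c * s > 0" using c by (simp add: zero_less_mult_iff)
      thus ?thesis using False by (simp add: Z'_def)
    qed
  qed
  hence "AE x in lborel. AE s in lborel. ?P x s"
    by (subst lborel_pair.AE_commute) measurable
  thus ?thesis
  proof eventually_elim
    case (elim x)
    have "(\<integral>s. indicator {0<..<t} s *\<^sub>R ((t - s) powr (\<gamma> - 1) *\<^sub>R Z x (c * s)) \<partial>lborel) =
       (\<integral>s. indicator {0<..<t} s *\<^sub>R ((t - s) powr (\<gamma> - 1) *\<^sub>R Z' x (c * s)) \<partial>lborel)"
      using c by (intro Bochner_Integration.integral_cong refl) (auto simp: indicator_def Z'_def)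
    also have "\<dots> = (\<integral>s. indicator {0<..<t} s *\<^sub>R ((t - s) powr (\<gamma> - 1) *\<^sub>R ((1 / \<delta>) ^ DIM('a) * Z' ((1 / \<delta>) *\<^sub>R x) s)) \<partial>lborel)"
    proof (rule integral_cong_AE)
      show "AE s in lborel. indicator {0<..<t} s *\<^sub>R ((t - s) powr (\<gamma> - 1) *\<^sub>R Z' x (c * s)) = 
        indicator {0<..<t} s *\<^sub>R ((t - s) powr (\<gamma> - 1) *\<^sub>R ((1 / \<delta>) ^ DIM('a) * Z' ((1 / \<delta>) *\<^sub>R x) s))"
        using elim by eventually_elim simp
    qed measurable
    also have "\<dots> = (\<integral>s. (1 / \<delta>) ^ DIM('a) * (indicator {0<..<t} s *\<^sub>R ((t - s) powr (\<gamma> - 1) *\<^sub>R Z ((1 / \<delta>) *\<^sub>R x) s)) \<partial>lborel)"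
      by (intro Bochner_Integration.integral_cong refl) (auto simp: indicator_def Z'_def)
    finally have "rl_integral \<gamma> (\<lambda>s. Z x (c * s)) t = (1 / \<delta>) ^ DIM('a) * rl_integral \<gamma> (Z ((1 / \<delta>) *\<^sub>R x)) t"
      unfolding rl_integral_def set_lebesgue_integral_def by simp
    thus ?case unfolding rl_integral_rescale[OF c] by simp
  qed
qed

text \<open>
  The fractional integral of \<open>Z\<close> scales for almost every \<open>x\<close> at each single time, hence
  simultaneously at the countably many times \<open>c (1 + 1/(n+1))\<close> and at \<open>c\<close>. Since the derivative in time is known to
  exist, it can be computed along this sequence.
\<close>
lemma source_kernel_rescale:
  fixes Z :: "'a::euclidean_space \<Rightarrow> real \<Rightarrow> real"
  assumes a: "0 < \<alpha>" "\<alpha> < 1" and b: "0 < \<beta>" and fs: "fundamental_solution \<alpha> \<beta> Z"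
    and sk: "source_kernel \<alpha> Z Y" and c: "0 < c"
  defines "\<delta> \<equiv> c powr (\<alpha> / (2 * \<beta>))"
  shows "AE x in lborel. Y x c = c powr (\<alpha> - 1) * (1 / \<delta>) ^ DIM('a) * Y ((1 / \<delta>) *\<^sub>R x) 1"
proof -
  have d: "\<delta> > 0" using c by (simp add: \<delta>_def)
  let ?V = "\<lambda>x t. rl_integral \<alpha> (Z x) t"
  let ?h = "\<lambda>n. 1 / real (Suc n)"
  have der: "AE x in lborel. \<forall>t>0. (?V x has_real_derivative Y x t) (at t)"
    using sk unfolding source_kernel_def has_rl_derivative_def by (simp add: has_real_derivative_iff_has_vector_derivative)
  have der': "AE x in lborel. \<forall>t>0. (?V ((1 / \<delta>) *\<^sub>R x) has_real_derivative Y ((1 / \<delta>) *\<^sub>R x) t) (at t)"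
    using d by (intro AE_lborel_scale[OF der]) auto
  have sc: "AE x in lborel. ?V x (c * t) = c powr \<alpha> * (1 / \<delta>) ^ DIM('a) * ?V ((1 / \<delta>) *\<^sub>R x) t" for t
    using rl_integral_fundamental_solution_rescale[OF a b fs c] by (simp add: \<delta>_def)
  have "AE x in lborel. \<forall>n. ?V x (c * (1 + ?h n)) = c powr \<alpha> * (1 / \<delta>) ^ DIM('a) * ?V ((1 / \<delta>) *\<^sub>R x) (1 + ?h n)"
    using sc by (simp add: AE_all_countable)
  with der der' sc[of 1] show ?thesis
  proof eventually_elim
    case (elim x)
    let ?x = "(1 / \<delta>) *\<^sub>R x" and ?C = "c powr \<alpha> * (1 / \<delta>) ^ DIM('a)"
    have h0: "?h \<longlonglongrightarrow> 0" by (rule LIMSEQ_Suc[OF lim_1_over_n])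
    have quot: "(\<lambda>n. (f (t + s * ?h n) - f t) / (s * ?h n)) \<longlonglongrightarrow> D" if "(f has_real_derivative D) (at t)" "s > 0" for f D and t s :: real
    proof -
      have "(\<lambda>n. s * ?h n) \<longlonglongrightarrow> 0" using tendsto_mult[OF tendsto_const h0, of s] by simp
      hence "filterlim (\<lambda>n. s * ?h n) (at 0) sequentially"
        using that(2) by (intro filterlim_atI) auto
      with that(1) show ?thesis unfolding DERIV_def by (rule filterlim_compose)
    qed
    have 1: "(\<lambda>n. (?V x (c + c * ?h n) - ?V x c) / (c * ?h n)) \<longlonglongrightarrow> Y x c"
      using elim(1) c by (intro quot) auto
    have 2: "(\<lambda>n. (?V ?x (1 + 1 * ?h n) - ?V ?x 1) / (1 * ?h n)) \<longlonglongrightarrow> Y ?x 1"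
      using elim(2) by (intro quot) auto
    have "(?V x (c + c * ?h n) - ?V x c) / (c * ?h n) = (?C / c) * ((?V ?x (1 + 1 * ?h n) - ?V ?x 1) / (1 * ?h n))" for n
    proof -
      have "?V x (c + c * ?h n) = ?C * ?V ?x (1 + ?h n)" using elim(4) by (simp add: distrib_left)
      moreover have "?V x c = ?C * ?V ?x 1" using elim(3) by simp
      ultimately show ?thesis by (simp add: right_diff_distrib diff_divide_distrib)
    qed
    with 1 have "(\<lambda>n. (?C / c) * ((?V ?x (1 + 1 * ?h n) - ?V ?x 1) / (1 * ?h n))) \<longlonglongrightarrow> Y x c" by (simp only:)
    moreover have "(\<lambda>n. (?C / c) * ((?V ?x (1 + 1 * ?h n) - ?V ?x 1) / (1 * ?h n))) \<longlonglongrightarrow> (?C / c) * Y ?x 1"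
      by (intro tendsto_mult 2 tendsto_const)
    ultimately have "Y x c = (?C / c) * Y ?x 1" by (rule LIMSEQ_unique)
    thus ?case using c by (simp add: powr_diff)
  qed
qed

lemma source_kernel_nn_integral:
  fixes Z :: "'a::euclidean_space \<Rightarrow> real \<Rightarrow> real"
  assumes a: "0 < \<alpha>" "\<alpha> < 1" and b: "0 < \<beta>" and fs: "fundamental_solution \<alpha> \<beta> Z"
    and sk: "source_kernel \<alpha> Z Y" and t: "0 < t"
  shows "(\<integral>\<^sup>+x. ennreal \<bar>Y x t\<bar> \<partial>lborel) = ennreal (t powr (\<alpha> - 1)) * (\<integral>\<^sup>+x. ennreal \<bar>Y x 1\<bar> \<partial>lborel)"
proof -
  define \<delta> where "\<delta> = t powr (\<alpha> / (2 * \<beta>))"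
  have d: "\<delta> > 0" using t by (simp add: \<delta>_def)
  have [measurable]: "(\<lambda>x. Y x 1) \<in> borel_measurable borel"
    using sk unfolding source_kernel_def by (metis borel_measurable_integrable zero_less_one measurable_lborel2)
  have "(\<integral>\<^sup>+x. ennreal \<bar>Y x t\<bar> \<partial>lborel) = (\<integral>\<^sup>+x. ennreal (t powr (\<alpha> - 1)) * (ennreal ((1 / \<delta>) ^ DIM('a)) * ennreal \<bar>Y ((1 / \<delta>) *\<^sub>R x) 1\<bar>) \<partial>lborel)"
    using source_kernel_rescale[OF a b fs sk t] d
    by (intro nn_integral_cong_AE) (auto elim!: eventually_mono simp: abs_mult \<delta>_def mult.assoc simp flip: ennreal_mult)
  also have "\<dots> = ennreal (t powr (\<alpha> - 1)) * (ennreal ((1 / \<delta>) ^ DIM('a)) * (\<integral>\<^sup>+x. ennreal \<bar>Y ((1 / \<delta>) *\<^sub>R x) 1\<bar> \<partial>lborel))"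
    by (simp add: nn_integral_cmult)
  also have "ennreal ((1 / \<delta>) ^ DIM('a)) * (\<integral>\<^sup>+x. ennreal \<bar>Y ((1 / \<delta>) *\<^sub>R x) 1\<bar> \<partial>lborel) = (\<integral>\<^sup>+x. ennreal \<bar>Y x 1\<bar> \<partial>lborel)"
    using nn_integral_lborel_affine[of "\<lambda>x. ennreal \<bar>Y x 1\<bar>" "1 / \<delta>" 0] d by simp
  finally show ?thesis .
qed

text \<open>
  The substitution \<open>y \<mapsto> x - \<delta> y\<close> moves the time dependence from the kernel to the point where \<open>u0\<close> is
  evaluated. The right-hand side makes sense at \<open>\<delta> = 0\<close> as well, where it is \<open>u0 x\<close>.
\<close>
lemma initial_datum_convolution:
  fixes Z :: "'a::euclidean_space \<Rightarrow> real \<Rightarrow> real"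
  assumes a: "0 < \<alpha>" "\<alpha> < 1" and b: "0 < \<beta>" and fs: "fundamental_solution \<alpha> \<beta> Z" and t: "0 < t"
    and [measurable]: "u0 \<in> borel_measurable borel"
  defines "\<delta> \<equiv> t powr (\<alpha> / (2 * \<beta>))"
  shows "(\<integral>y. u0 y * Z (x - y) t \<partial>lborel) = (\<integral>y. u0 (x - \<delta> *\<^sub>R y) * Z y 1 \<partial>lborel)"
    and "integrable lborel (\<lambda>y. u0 (x - \<delta> *\<^sub>R y) * Z y 1) \<Longrightarrow> integrable lborel (\<lambda>y. u0 y * Z (x - y) t)"
proof -
  have d: "\<delta> > 0" using t by (simp add: \<delta>_def)
  have [measurable]: "(\<lambda>x. Z x t) \<in> borel_measurable borel" if "t > 0" for t
    using fs that unfolding fundamental_solution_def by (metis borel_measurable_integrable measurable_lborel2)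
  have Zm [measurable]: "(\<lambda>x. Z x 1) \<in> borel_measurable borel" "(\<lambda>x. Z x t) \<in> borel_measurable borel"
    using t by auto
  define g where "g y = u0 (x - \<delta> *\<^sub>R y) * Z y 1" for y
  have gm [measurable]: "g \<in> borel_measurable borel" unfolding g_def by measurable
  let ?G = "\<lambda>y. g ((1 / \<delta>) *\<^sub>R x + (- (1 / \<delta>)) *\<^sub>R y)"
  have "AE y in lborel. Z (x - y) t = (1 / \<delta>) ^ DIM('a) * Z ((1 / \<delta>) *\<^sub>R (x - y)) 1"
    using fundamental_solution_rescale[OF a b fs t, of 1] by (intro AE_lborel_reflect) (simp add: \<delta>_def)
  hence ae: "AE y in lborel. u0 y * Z (x - y) t = (1 / \<delta>) ^ DIM('a) * ?G y"
  proof eventually_elim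
    case (elim y)
    have "(1 / \<delta>) *\<^sub>R x + (- (1 / \<delta>)) *\<^sub>R y = (1 / \<delta>) *\<^sub>R (x - y)" by (simp add: algebra_simps)
    moreover have "g ((1 / \<delta>) *\<^sub>R (x - y)) = u0 y * Z ((1 / \<delta>) *\<^sub>R (x - y)) 1" using d by (simp add: g_def)
    ultimately show ?case using elim by simp
  qed
  have "(\<integral>y. u0 y * Z (x - y) t \<partial>lborel) = (\<integral>y. (1 / \<delta>) ^ DIM('a) * ?G y \<partial>lborel)"
    by (rule integral_cong_AE) (use ae in auto)
  also have "\<dots> = \<bar>- (1 / \<delta>)\<bar> ^ DIM('a) *\<^sub>R (\<integral>y. ?G y \<partial>lborel)" using d by simp
  also have "\<dots> = (\<integral>y. g y \<partial>lborel)"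
    by (rule integral_lborel_affine[symmetric]) (use d in auto)
  finally show "(\<integral>y. u0 y * Z (x - y) t \<partial>lborel) = (\<integral>y. u0 (x - \<delta> *\<^sub>R y) * Z y 1 \<partial>lborel)"
    by (simp add: g_def)
  assume "integrable lborel (\<lambda>y. u0 (x - \<delta> *\<^sub>R y) * Z y 1)"
  hence "integrable lborel g" by (simp add: g_def[abs_def])
  from integrable_lborel_affine[OF this, of "- (1 / \<delta>)"] d
  have "integrable lborel (\<lambda>y. (1 / \<delta>) ^ DIM('a) * ?G y)" by auto
  thus "integrable lborel (\<lambda>y. u0 y * Z (x - y) t)"
    by (subst integrable_cong_AE[OF _ _ ae]) auto
qed

section \<open>Space-time convolution\<close>

lemma nn_integral_time_reflect:
  fixes g :: "'a::euclidean_space \<times> real \<Rightarrow> ennreal"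
  assumes "g \<in> borel_measurable borel"
  shows "(\<integral>\<^sup>+w. g (fst w, t - snd w) \<partial>lborel) = (\<integral>\<^sup>+w. g w \<partial>lborel)"
proof -
  have [measurable]: "g \<in> borel_measurable (borel \<Otimes>\<^sub>M borel)" using assms by (simp add: borel_prod)
  have "(\<integral>\<^sup>+w. g (fst w, t - snd w) \<partial>(lborel \<Otimes>\<^sub>M lborel)) = (\<integral>\<^sup>+y. \<integral>\<^sup>+s. g (y, t - s) \<partial>lborel \<partial>lborel)"
    by (subst lborel.nn_integral_fst[symmetric]) auto
  also have "\<dots> = (\<integral>\<^sup>+y. \<integral>\<^sup>+s. g (y, s) \<partial>lborel \<partial>lborel)"
    by (intro nn_integral_cong nn_integral_lborel_reflect[where f="\<lambda>s. g (_, s)"]) measurable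
  also have "\<dots> = (\<integral>\<^sup>+w. g w \<partial>(lborel \<Otimes>\<^sub>M lborel))"
    by (rule lborel.nn_integral_fst) auto
  finally show ?thesis by (simp add: lborel_prod)
qed

lemma nn_integral_space_reflect:
  fixes g :: "'a::euclidean_space \<times> real \<Rightarrow> ennreal"
  assumes "g \<in> borel_measurable borel"
  shows "(\<integral>\<^sup>+w. g (x - fst w, snd w) \<partial>lborel) = (\<integral>\<^sup>+w. g w \<partial>lborel)"
proof -
  have [measurable]: "g \<in> borel_measurable (borel \<Otimes>\<^sub>M borel)" using assms by (simp add: borel_prod)
  have "(\<integral>\<^sup>+w. g (x - fst w, snd w) \<partial>(lborel \<Otimes>\<^sub>M lborel)) = (\<integral>\<^sup>+s. \<integral>\<^sup>+y. g (x - y, s) \<partial>lborel \<partial>lborel)"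
    by (subst lborel_pair.nn_integral_snd[symmetric]) auto
  also have "\<dots> = (\<integral>\<^sup>+s. \<integral>\<^sup>+y. g (y, s) \<partial>lborel \<partial>lborel)"
    by (intro nn_integral_cong nn_integral_lborel_reflect[where f="\<lambda>y. g (y, _)"]) measurable
  also have "\<dots> = (\<integral>\<^sup>+w. g w \<partial>(lborel \<Otimes>\<^sub>M lborel))"
    by (rule lborel_pair.nn_integral_snd) auto
  finally show ?thesis by (simp add: lborel_prod)
qed

text \<open>
  For functions that vanish at negative times, the restriction \<open>0 < s < t\<close> of the Duhamel integral is
  automatic, and the integral becomes a convolution over the whole of space-time. The reflection is
  placed on \<open>f\<close> in space and on \<open>k\<close> in time, so that the bound on \<open>f\<close> in \<open>x\<close> at a fixed \<open>s\<close> can be used and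
  the dependence on \<open>t\<close> sits in \<open>k\<close> alone.
\<close>
definition st_conv :: "('a::euclidean_space \<Rightarrow> real \<Rightarrow> real) \<Rightarrow> ('a \<Rightarrow> real \<Rightarrow> real) \<Rightarrow> 'a \<Rightarrow> real \<Rightarrow> real" where
  "st_conv f k x t = (\<integral>w. f (x - fst w) (snd w) * k (fst w) (t - snd w) \<partial>lborel)"

text \<open>
  Minkowski's inequality with space-time as the parameter space: the mass of a spatial translate of
  \<open>f(\<cdot>,s)\<close> does not depend on the translation, so the weight contributes only its \<open>L\<^sup>1\<close> norm.
\<close>
lemma st_conv_weighted_bound:
  fixes f :: "'a::euclidean_space \<Rightarrow> real \<Rightarrow> real" and K :: "'a \<times> real \<Rightarrow> real"
  assumes f: "(\<lambda>(x, s). f x s) \<in> borel_measurable (borel \<Otimes>\<^sub>M borel)" and r: "1 \<le> r"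
    and C: "C < \<infinity>" "AE s in lborel. Lp_mass r (\<lambda>x. f x s) \<le> C"
    and K: "integrable lborel K"
  shows "AE x in lborel. integrable lborel (\<lambda>w. f (x - fst w) (snd w) * K w)"
    and "Lp_mass r (\<lambda>x. \<integral>w. f (x - fst w) (snd w) * K w \<partial>lborel) \<le> ennreal ((\<integral>w. \<bar>K w\<bar> \<partial>lborel) powr r) * C"
proof -
  note [measurable] = f
  define m where "m = (\<integral>w. \<bar>K w\<bar> \<partial>lborel)"
  have m0: "0 \<le> m" by (simp add: m_def)
  have Km: "(\<integral>\<^sup>+w. ennreal \<bar>K w\<bar> \<partial>lborel) = ennreal m"
    unfolding m_def by (rule nn_integral_eq_integral) (use K in auto)
  have Hm: "(\<lambda>(x, w). f (x - fst w) (snd w)) \<in> borel_measurable (lborel \<Otimes>\<^sub>M (lborel :: ('a \<times> real) measure))"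
    unfolding lborel_prod[symmetric] by measurable
  have tr: "Lp_mass r (\<lambda>x. f (x - y) s) = Lp_mass r (\<lambda>x. f x s)" for y s
    by (rule Lp_mass_translate[of "\<lambda>x. f x s"]) measurable
  have "AE w in (lborel :: 'a measure) \<Otimes>\<^sub>M lborel. Lp_mass r (\<lambda>x. f x (snd w)) \<le> C"
  proof (rule lborel_pair.AE_pair_measure[where P="\<lambda>w. Lp_mass r (\<lambda>x. f x (snd w)) \<le> C"])
    show "{w \<in> space (lborel \<Otimes>\<^sub>M lborel). Lp_mass r (\<lambda>x. f x (snd w)) \<le> C} \<in> sets ((lborel :: 'a measure) \<Otimes>\<^sub>M lborel)"
      unfolding Lp_mass_def by measurable
  qed (use C(2) in simp)
  hence ae: "AE w in (lborel :: ('a \<times> real) measure). Lp_mass r (\<lambda>x. f (x - fst w) (snd w)) \<le> C"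
    unfolding tr lborel_prod .
  have B: "(\<integral>\<^sup>+w. ennreal \<bar>K w\<bar> * Lp_mass r (\<lambda>x. f (x - fst w) (snd w)) \<partial>lborel) \<le> ennreal m * C"
  proof -
    have "(\<integral>\<^sup>+w. ennreal \<bar>K w\<bar> * Lp_mass r (\<lambda>x. f (x - fst w) (snd w)) \<partial>lborel) \<le> (\<integral>\<^sup>+w. ennreal \<bar>K w\<bar> * C \<partial>lborel)"
      by (rule nn_integral_mono_AE) (use ae in \<open>auto elim!: eventually_mono intro!: mult_left_mono\<close>)
    also have "\<dots> = ennreal m * C" using K by (subst nn_integral_multc) (auto simp: Km)
    finally show ?thesis .
  qed
  have fin: "(\<integral>\<^sup>+w. ennreal \<bar>K w\<bar> * Lp_mass r (\<lambda>x. f (x - fst w) (snd w)) \<partial>lborel) < \<infinity>"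
    by (rule order.strict_trans1[OF B]) (use C(1) in \<open>auto simp: ennreal_mult_less_top\<close>)
  show "AE x in lborel. integrable lborel (\<lambda>w. f (x - fst w) (snd w) * K w)"
    by (rule minkowski_weighted(1)[OF sigma_finite_lborel Hm K r fin])
  have "Lp_mass r (\<lambda>x. \<integral>w. f (x - fst w) (snd w) * K w \<partial>lborel) \<le> ennreal (m powr (r - 1)) * (ennreal m * C)"
    using order_trans[OF minkowski_weighted(2)[OF sigma_finite_lborel Hm K r fin] mult_left_mono[OF B]] by (simp add: m_def)
  also have "\<dots> = ennreal (m powr r) * C"
    using m0 by (cases "m = 0") (auto simp: mult.assoc[symmetric] powr_diff simp flip: ennreal_mult)
  finally show "Lp_mass r (\<lambda>x. \<integral>w. f (x - fst w) (snd w) * K w \<partial>lborel) \<le> ennreal ((\<integral>w. \<bar>K w\<bar> \<partial>lborel) powr r) * C"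
    by (simp add: m_def)
qed

lemma integrable_time_reflect:
  fixes k :: "'a::euclidean_space \<Rightarrow> real \<Rightarrow> real"
  assumes k: "integrable lborel (\<lambda>w. k (fst w) (snd w))"
  shows "integrable lborel (\<lambda>w. k (fst w) (t - snd w))"
    and "(\<integral>w. \<bar>k (fst w) (t - snd w)\<bar> \<partial>lborel) = (\<integral>w. \<bar>k (fst w) (snd w)\<bar> \<partial>lborel)"
proof -
  have m: "(\<lambda>w. k (fst w) (snd w)) \<in> borel_measurable borel" using k by auto
  hence km [measurable]: "(\<lambda>(x, s). k x s) \<in> borel_measurable (borel \<Otimes>\<^sub>M borel)" by (simp add: borel_prod case_prod_unfold)
  have m': "(\<lambda>w. k (fst w) (t - snd w)) \<in> borel_measurable borel"
    unfolding borel_prod[symmetric] by measurable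
  have eq: "(\<integral>\<^sup>+w. ennreal \<bar>k (fst w) (t - snd w)\<bar> \<partial>lborel) = (\<integral>\<^sup>+w. ennreal \<bar>k (fst w) (snd w)\<bar> \<partial>lborel)"
    using nn_integral_time_reflect[of "\<lambda>w. ennreal \<bar>k (fst w) (snd w)\<bar>" t] m by simp
  show "integrable lborel (\<lambda>w. k (fst w) (t - snd w))"
    using k m' eq by (simp add: integrable_iff_bounded)
  show "(\<integral>w. \<bar>k (fst w) (t - snd w)\<bar> \<partial>lborel) = (\<integral>w. \<bar>k (fst w) (snd w)\<bar> \<partial>lborel)"
    using m m' eq by (simp add: integral_eq_nn_integral)
qed

lemma st_conv_bound:
  fixes f k :: "'a::euclidean_space \<Rightarrow> real \<Rightarrow> real"
  assumes f: "(\<lambda>(x, s). f x s) \<in> borel_measurable (borel \<Otimes>\<^sub>M borel)" and r: "1 \<le> r"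
    and C: "C < \<infinity>" "AE s in lborel. Lp_mass r (\<lambda>x. f x s) \<le> C"
    and k: "integrable lborel (\<lambda>w. k (fst w) (snd w))"
  shows "AE x in lborel. integrable lborel (\<lambda>w. f (x - fst w) (snd w) * k (fst w) (t - snd w))"
    and "Lp_mass r (\<lambda>x. st_conv f k x t) \<le> ennreal ((\<integral>w. \<bar>k (fst w) (snd w)\<bar> \<partial>lborel) powr r) * C"
  using st_conv_weighted_bound[OF f r C integrable_time_reflect(1)[OF k, of t]]
  unfolding st_conv_def[abs_def] integrable_time_reflect(2)[OF k] by auto

text \<open>
  Two values of the convolution differ by the convolution with a difference of time translates of \<open>k\<close>,
  and translation is continuous in \<open>L\<^sup>1\<close> of space-time.
\<close>
lemma st_conv_continuous:
  fixes f k :: "'a::euclidean_space \<Rightarrow> real \<Rightarrow> real"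
  assumes f: "(\<lambda>(x, s). f x s) \<in> borel_measurable (borel \<Otimes>\<^sub>M borel)" and r: "1 \<le> r"
    and C: "C < \<infinity>" "AE s in lborel. Lp_mass r (\<lambda>x. f x s) \<le> C"
    and k: "integrable lborel (\<lambda>w. k (fst w) (snd w))" and t: "tn \<longlonglongrightarrow> t"
  shows "(\<lambda>n. Lp_mass r (\<lambda>x. st_conv f k x (tn n) - st_conv f k x t)) \<longlonglongrightarrow> 0"
proof -
  let ?K = "\<lambda>n w. k (fst w) (tn n - snd w) - k (fst w) (t - snd w)"
  let ?k = "\<lambda>w. k (fst w) (snd w)"
  have m: "?k \<in> borel_measurable borel" using k by auto
  hence km [measurable]: "(\<lambda>(x, s). k x s) \<in> borel_measurable (borel \<Otimes>\<^sub>M borel)" by (simp add: borel_prod case_prod_unfold)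
  have K: "integrable lborel (?K n)" for n
    by (intro Bochner_Integration.integrable_diff integrable_time_reflect k)
  define d where "d n = (\<integral>w. \<bar>?K n w\<bar> \<partial>lborel)" for n
  have d0: "0 \<le> d n" for n by (simp add: d_def)
  have deq: "ennreal (d n) = Lp_mass 1 (\<lambda>w. ?k (w - (0, t - tn n)) - ?k w)" for n
  proof -
    have m2: "(\<lambda>w. ennreal \<bar>?k (w - (0, t - tn n)) - ?k w\<bar>) \<in> borel_measurable (borel :: ('a \<times> real) measure)"
      unfolding borel_prod[symmetric] fst_diff snd_diff fst_conv snd_conv by measurable
    have "ennreal (d n) = (\<integral>\<^sup>+w. ennreal \<bar>?K n w\<bar> \<partial>lborel)"
      unfolding d_def by (rule nn_integral_eq_integral[symmetric]) (use K in auto)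
    also have "\<dots> = (\<integral>\<^sup>+w. (\<lambda>w. ennreal \<bar>?k (w - (0, t - tn n)) - ?k w\<bar>) (fst w, t - snd w) \<partial>lborel)"
      by (intro nn_integral_cong) (simp add: algebra_simps)
    also have "\<dots> = (\<integral>\<^sup>+w. ennreal \<bar>?k (w - (0, t - tn n)) - ?k w\<bar> \<partial>lborel)"
      by (rule nn_integral_time_reflect[OF m2])
    also have "\<dots> = Lp_mass 1 (\<lambda>w. ?k (w - (0, t - tn n)) - ?k w)"
      unfolding Lp_mass_def by simp
    finally show ?thesis .
  qed
  have "(\<lambda>n. Lp_mass 1 (\<lambda>w. ?k (w - (0, t - tn n)) - ?k w)) \<longlonglongrightarrow> 0"
  proof (rule Lp_mass_translation_continuous[OF m])
    show "Lp_mass 1 ?k < \<infinity>" using k unfolding Lp_mass_def by (simp add: integrable_iff_bounded)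
    have "(\<lambda>n. (0 :: 'a, t - tn n)) \<longlonglongrightarrow> (0, t - t)" by (intro tendsto_intros t)
    thus "(\<lambda>n. (0 :: 'a, t - tn n)) \<longlonglongrightarrow> 0" by (simp add: zero_prod_def)
  qed auto
  hence "(\<lambda>n. ennreal (d n)) \<longlonglongrightarrow> ennreal 0" by (simp add: deq)
  hence "d \<longlonglongrightarrow> 0" using d0 by (subst (asm) tendsto_ennreal_iff) auto
  hence "(\<lambda>n. d n powr r) \<longlonglongrightarrow> 0 powr r" using r d0 by (intro tendsto_powr2) auto
  hence "(\<lambda>n. ennreal (d n powr r)) \<longlonglongrightarrow> ennreal 0" using r by (intro tendsto_ennrealI) simp
  hence "(\<lambda>n. C * ennreal (d n powr r)) \<longlonglongrightarrow> C * ennreal 0"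
    using C(1) by (intro ennreal_tendsto_cmult) auto
  hence lim: "(\<lambda>n. ennreal (d n powr r) * C) \<longlonglongrightarrow> 0" by (simp add: mult.commute)
  have bd: "Lp_mass r (\<lambda>x. st_conv f k x (tn n) - st_conv f k x t) \<le> ennreal (d n powr r) * C" for n
  proof -
    have "Lp_mass r (\<lambda>x. st_conv f k x (tn n) - st_conv f k x t) = Lp_mass r (\<lambda>x. \<integral>w. f (x - fst w) (snd w) * ?K n w \<partial>lborel)"
    proof (rule Lp_mass_cong_AE)
      show "AE x in lborel. st_conv f k x (tn n) - st_conv f k x t = (\<integral>w. f (x - fst w) (snd w) * ?K n w \<partial>lborel)"
        using st_conv_bound(1)[OF f r C k, of "tn n"] st_conv_bound(1)[OF f r C k, of t]
        by eventually_elim (simp add: st_conv_def right_diff_distrib)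
    qed
    also have "\<dots> \<le> ennreal (d n powr r) * C"
      unfolding d_def by (rule st_conv_weighted_bound(2)[OF f r C K])
    finally show ?thesis .
  qed
  show ?thesis
    by (rule tendsto_sandwich[OF _ _ tendsto_const lim]) (use bd in auto)
qed

text \<open>
  A sequence converging in \<open>L\<^sup>r\<close> has an almost everywhere convergent subsequence, to which Fatou's
  lemma applies with the other exponent \<open>s\<close>.
\<close>
lemma Lp_mass_lower_semicontinuous:
  fixes g :: "'a::euclidean_space \<Rightarrow> real"
  assumes [measurable]: "\<And>n. gn n \<in> borel_measurable borel" "g \<in> borel_measurable borel"
    and r: "0 < r" and s: "0 < s" and fin: "\<And>n. Lp_mass r (\<lambda>x. gn n x - g x) < \<infinity>"
    and lim: "(\<lambda>n. Lp_mass r (\<lambda>x. gn n x - g x)) \<longlonglongrightarrow> 0"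
    and C: "\<And>n. Lp_mass s (gn n) \<le> C"
  shows "Lp_mass s g \<le> C"
proof -
  let ?v = "\<lambda>n x. \<bar>gn n x - g x\<bar> powr r"
  have I: "integrable lborel (?v n)" for n
    using fin[of n] by (auto simp: integrable_iff_bounded Lp_mass_def)
  have "ennreal (\<integral>x. norm (?v n x) \<partial>lborel) = Lp_mass r (\<lambda>x. gn n x - g x)" for n
    unfolding Lp_mass_def using I[of n] by (subst nn_integral_eq_integral) auto
  hence "(\<lambda>n. ennreal (\<integral>x. norm (?v n x) \<partial>lborel)) \<longlonglongrightarrow> ennreal 0" using lim by simp
  hence "(\<lambda>n. (\<integral>x. norm (?v n x) \<partial>lborel)) \<longlonglongrightarrow> 0"
    by (subst (asm) tendsto_ennreal_iff) auto
  from tendsto_L1_AE_subseq[OF I this] obtain \<sigma> where "AE x in lborel. (\<lambda>n. ?v (\<sigma> n) x) \<longlonglongrightarrow> 0" by blast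
  hence ae: "AE x in lborel. (\<lambda>n. ennreal (\<bar>gn (\<sigma> n) x\<bar> powr s)) \<longlonglongrightarrow> ennreal (\<bar>g x\<bar> powr s)"
  proof eventually_elim
    case (elim x)
    hence "(\<lambda>n. ?v (\<sigma> n) x powr (1 / r)) \<longlonglongrightarrow> 0 powr (1 / r)"
      using r by (intro tendsto_powr2) auto
    hence "(\<lambda>n. \<bar>gn (\<sigma> n) x - g x\<bar>) \<longlonglongrightarrow> 0" using r by (simp add: powr_powr)
    hence "(\<lambda>n. gn (\<sigma> n) x) \<longlonglongrightarrow> g x" by (simp add: tendsto_rabs_zero_iff LIM_zero_iff)
    thus ?case using s by (intro tendsto_ennrealI tendsto_powr2 tendsto_rabs tendsto_const) auto
  qed
  have "Lp_mass s g = (\<integral>\<^sup>+x. liminf (\<lambda>n. ennreal (\<bar>gn (\<sigma> n) x\<bar> powr s)) \<partial>lborel)"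
    unfolding Lp_mass_def
  proof (rule nn_integral_cong_AE)
    show "AE x in lborel. ennreal (\<bar>g x\<bar> powr s) = liminf (\<lambda>n. ennreal (\<bar>gn (\<sigma> n) x\<bar> powr s))"
      using ae by eventually_elim (rule lim_imp_Liminf[symmetric], auto)
  qed
  also have "\<dots> \<le> liminf (\<lambda>n. Lp_mass s (gn (\<sigma> n)))"
    unfolding Lp_mass_def by (rule nn_integral_liminf) auto
  also have "\<dots> \<le> C"
    by (rule Liminf_le) (auto simp: C)
  finally show ?thesis .
qed

lemma AE_lborel_Ioo_ex:
  assumes "AE x in lborel. P x" "a < (b::real)"
  obtains x where "a < x" "x < b" "P x"
proof -
  have "\<exists>x\<in>{a<..<b}. P x"
  proof (rule ccontr)
    assume "\<not> (\<exists>x\<in>{a<..<b}. P x)"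
    hence "AE x in lborel. x \<notin> {a<..<b}" using assms(1) by (auto elim!: eventually_mono)
    hence "emeasure lborel {a<..<b} = 0"
      by (subst (asm) AE_iff_measurable[where N="{a<..<b}"]) auto
    thus False using assms(2) by simp
  qed
  thus ?thesis using that by auto
qed

lemma Lp_norm_tendsto_0:
  fixes g :: "nat \<Rightarrow> 'a::euclidean_space \<Rightarrow> real"
  assumes "\<And>n. g n \<in> borel_measurable borel" "0 < q" "(\<lambda>n. Lp_mass q (g n)) \<longlonglongrightarrow> 0"
  shows "(\<lambda>n. Lp_norm q (g n)) \<longlonglongrightarrow> 0"
proof -
  have "(\<lambda>n. enn2real (Lp_mass q (g n))) \<longlonglongrightarrow> 0"
    by (rule tendsto_enn2real) (use assms in auto)
  hence "(\<lambda>n. enn2real (Lp_mass q (g n)) powr (1 / q)) \<longlonglongrightarrow> 0 powr (1 / q)"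
    using assms(2) by (intro tendsto_powr2) auto
  thus ?thesis by (simp add: Lp_norm_eq_Lp_mass assms(1))
qed

section \<open>The mild formulation on a time slab\<close>

lemma integrable_space_reflect:
  fixes g :: "'a::euclidean_space \<times> real \<Rightarrow> real"
  assumes g: "integrable lborel g"
  shows "integrable lborel (\<lambda>w. g (x - fst w, snd w))"
proof -
  have m: "g \<in> borel_measurable borel" using g by auto
  hence [measurable]: "g \<in> borel_measurable (borel \<Otimes>\<^sub>M borel)" by (simp add: borel_prod)
  have m': "(\<lambda>w. g (x - fst w, snd w)) \<in> borel_measurable borel"
    unfolding borel_prod[symmetric] by measurable
  show ?thesis
    using g m' nn_integral_space_reflect[of "\<lambda>w. ennreal (norm (g w))" x] m by (simp add: integrable_iff_bounded)
qed

text \<open>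
  A bounded time interval \<open>(0,\<tau>)\<close> on which the kernels, the datum and the function \<open>u\<close> are studied. As
  \<open>\<tau> < T\<close>, bounds that are local in \<open>[0,T)\<close> become uniform there.
\<close>
locale mild_slab =
  fixes \<alpha> \<beta> p :: real and Z Y u :: "'a::euclidean_space \<Rightarrow> real \<Rightarrow> real" and u0 :: "'a \<Rightarrow> real" and T :: ereal and \<tau> :: real
  assumes a: "0 < \<alpha>" "\<alpha> < 1" and b: "0 < \<beta>" and fs: "fundamental_solution \<alpha> \<beta> Z" and sk: "source_kernel \<alpha> Z Y"
    and p: "1 < p" and u0m [measurable]: "u0 \<in> borel_measurable borel"
    and um: "set_borel_measurable borel (UNIV \<times> {t. 0 < t \<and> ereal t < T}) (\<lambda>(x, t). u x t)"
    and \<tau>: "0 < \<tau>" "ereal \<tau> < T"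
begin

definition kern :: "'a \<Rightarrow> real \<Rightarrow> real" where
  "kern y s = indicator {0<..<\<tau>} s * Y y s"

definition src :: "'a \<Rightarrow> real \<Rightarrow> real" where
  "src y s = indicator {0<..<\<tau>} s * (\<bar>u y s\<bar> powr (p - 1) * u y s)"

definition free_part :: "'a \<Rightarrow> real \<Rightarrow> real" where
  "free_part x t = (\<integral>y. u0 (x - t powr (\<alpha> / (2 * \<beta>)) *\<^sub>R y) * Z y 1 \<partial>lborel)"

definition duhamel :: "'a \<Rightarrow> real \<Rightarrow> real" where
  "duhamel = st_conv src kern"

text \<open>
  The same integral in the iterated order of \<^const>\<open>mild_rhs\<close>. It agrees with \<open>duhamel\<close> only where Fubini's
  theorem applies, that is, for almost every \<open>x\<close>, whereas its relation to \<^const>\<open>mild_rhs\<close> holds at every \<open>x\<close>.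
\<close>
definition duhamel_iterated :: "'a \<Rightarrow> real \<Rightarrow> real" where
  "duhamel_iterated x t = (\<integral>s. (\<integral>y. src y s * kern (x - y) (t - s) \<partial>lborel) \<partial>lborel)"

lemma Z1: "integrable lborel (\<lambda>x. Z x 1)"
  using fs unfolding fundamental_solution_def by auto

lemma u_measurable': "(\<lambda>(y, s). indicator {0<..<\<tau>} s * u y s) \<in> borel_measurable (borel \<Otimes>\<^sub>M borel)"
proof -
  have [measurable]: "(\<lambda>w. indicator (UNIV \<times> {t. 0 < t \<and> ereal t < T}) w *\<^sub>R (case w of (x, t) \<Rightarrow> u x t)) \<in> borel_measurable (borel \<Otimes>\<^sub>M borel)"
    using um unfolding set_borel_measurable_def borel_prod by simp
  have lt: "ereal s < T" if "s < \<tau>" for s using that \<tau>(2) by (meson ereal_less_eq(3) less_imp_le order.strict_trans1)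
  have "(\<lambda>w. indicator {0<..<\<tau>} (snd w) * (indicator (UNIV \<times> {t. 0 < t \<and> ereal t < T}) w *\<^sub>R (case w of (x, t) \<Rightarrow> u x t))) \<in> borel_measurable (borel \<Otimes>\<^sub>M borel)"
    by measurable
  also have "(\<lambda>w. indicator {0<..<\<tau>} (snd w) * (indicator (UNIV \<times> {t. 0 < t \<and> ereal t < T}) w *\<^sub>R (case w of (x, t) \<Rightarrow> u x t))) = (\<lambda>(y, s). indicator {0<..<\<tau>} s * u y s)"
    using lt by (auto simp: fun_eq_iff indicator_def)
  finally show ?thesis .
qed

lemma u_measurable: "0 < s \<Longrightarrow> s < \<tau> \<Longrightarrow> (\<lambda>x. u x s) \<in> borel_measurable borel"
proof -
  assume s: "0 < s" "s < \<tau>"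
  note [measurable] = u_measurable'
  have "(\<lambda>x. indicator {0<..<\<tau>} s * u x s) \<in> borel_measurable borel" by measurable
  thus ?thesis using s by simp
qed

lemma src_measurable [measurable]: "(\<lambda>(y, s). src y s) \<in> borel_measurable (borel \<Otimes>\<^sub>M borel)"
proof -
  note [measurable] = u_measurable'
  have "(\<lambda>(y, s). \<bar>indicator {0<..<\<tau>} s * u y s\<bar> powr (p - 1) * (indicator {0<..<\<tau>} s * u y s)) \<in> borel_measurable (borel \<Otimes>\<^sub>M borel)"
    by measurable
  also have "(\<lambda>(y, s). \<bar>indicator {0<..<\<tau>} s * u y s\<bar> powr (p - 1) * (indicator {0<..<\<tau>} s * u y s)) = (\<lambda>(y, s). src y s)"
    by (auto simp: fun_eq_iff src_def indicator_def)
  finally show ?thesis .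
qed

lemma kern_measurable [measurable]: "(\<lambda>(y, s). kern y s) \<in> borel_measurable (borel \<Otimes>\<^sub>M borel)"
proof -
  have [measurable]: "(\<lambda>w. indicator (UNIV \<times> {0<..}) w *\<^sub>R (case w of (x, t) \<Rightarrow> Y x t)) \<in> borel_measurable (borel \<Otimes>\<^sub>M borel)"
    using sk unfolding source_kernel_def set_borel_measurable_def borel_prod by simp
  have "(\<lambda>w. indicator {0<..<\<tau>} (snd w) * (indicator (UNIV \<times> {0<..}) w *\<^sub>R (case w of (x, t) \<Rightarrow> Y x t))) \<in> borel_measurable (borel \<Otimes>\<^sub>M borel)"
    by measurable
  also have "(\<lambda>w. indicator {0<..<\<tau>} (snd w) * (indicator (UNIV \<times> {0<..}) w *\<^sub>R (case w of (x, t) \<Rightarrow> Y x t))) = (\<lambda>(y, s). kern y s)"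
    by (auto simp: fun_eq_iff indicator_def kern_def)
  finally show ?thesis .
qed

text \<open>
  By self-similarity the spatial norm at time \<open>s\<close> is a constant times \<open>s powr (\<alpha> - 1)\<close>.
\<close>
lemma kern_integrable: "integrable lborel (\<lambda>w. kern (fst w) (snd w))"
proof -
  define A where "A = (\<integral>\<^sup>+x. ennreal \<bar>Y x 1\<bar> \<partial>lborel)"
  have A: "A < \<infinity>"
    using sk unfolding source_kernel_def A_def by (auto simp: integrable_iff_bounded)
  have m: "(\<lambda>w. kern (fst w) (snd w)) \<in> borel_measurable ((lborel :: 'a measure) \<Otimes>\<^sub>M lborel)"
    by measurable
  have inner: "(\<integral>\<^sup>+y. ennreal (norm (kern y s)) \<partial>lborel) = ennreal (s powr (\<alpha> - 1)) * indicator {0<..<\<tau>} s * A" for s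
  proof (cases "s \<in> {0<..<\<tau>}")
    case True
    thus ?thesis using source_kernel_nn_integral[OF a b fs sk, of s] by (simp add: kern_def A_def)
  qed (simp add: kern_def)
  have "(\<integral>\<^sup>+w. ennreal (norm (kern (fst w) (snd w))) \<partial>((lborel :: 'a measure) \<Otimes>\<^sub>M lborel)) = (\<integral>\<^sup>+s. (\<integral>\<^sup>+y. ennreal (norm (kern y s)) \<partial>lborel) \<partial>lborel)"
    by (subst lborel_pair.nn_integral_snd[symmetric]) (use m in auto)
  also have "\<dots> = ennreal (\<tau> powr \<alpha> / \<alpha>) * A"
    unfolding inner using nn_integral_powr_Ioo[of \<alpha> \<tau>] a \<tau> by (subst nn_integral_multc) auto
  also have "\<dots> < \<infinity>" using A by (simp add: ennreal_mult_less_top)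
  finally show ?thesis using m by (simp add: integrable_iff_bounded lborel_prod)
qed

definition bounded_exponent :: "real \<Rightarrow> bool" where
  "bounded_exponent m \<longleftrightarrow> (\<exists>C<\<infinity>. AE s in lborel. 0 < s \<and> s < \<tau> \<longrightarrow> Lp_mass m (\<lambda>x. u x s) \<le> C)"

lemma src_bounded:
  assumes "bounded_exponent (r * p)"
  obtains C where "C < \<infinity>" "AE s in lborel. Lp_mass r (\<lambda>x. src x s) \<le> C"
proof -
  obtain C where C: "C < \<infinity>" "AE s in lborel. 0 < s \<and> s < \<tau> \<longrightarrow> Lp_mass (r * p) (\<lambda>x. u x s) \<le> C"
    using assms unfolding bounded_exponent_def by auto
  have e: "\<bar>\<bar>v\<bar> powr (p - 1) * v\<bar> powr r = \<bar>v\<bar> powr (r * p)" for v :: real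
  proof (cases "v = 0")
    case False
    have "\<bar>\<bar>v\<bar> powr (p - 1) * v\<bar> = \<bar>v\<bar> powr (p - 1) * \<bar>v\<bar> powr 1" using False by (simp add: abs_mult)
    also have "\<dots> = \<bar>v\<bar> powr p" by (simp only: powr_add[symmetric]) simp
    finally show ?thesis by (simp add: powr_powr mult.commute)
  qed auto
  have "AE s in lborel. Lp_mass r (\<lambda>x. src x s) \<le> C"
    using C(2)
  proof eventually_elim
    case (elim s)
    show ?case
    proof (cases "s \<in> {0<..<\<tau>}")
      case True
      thus ?thesis using elim by (simp add: src_def Lp_mass_def e)
    qed (simp add: src_def Lp_mass_def)
  qed
  thus ?thesis using C(1) that by blast
qed

lemma duhamel_measurable: "(\<lambda>x. duhamel x t) \<in> borel_measurable borel"
proof -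
  have "(\<lambda>x. \<integral>w. src (x - fst w) (snd w) * kern (fst w) (t - snd w) \<partial>((lborel :: 'a measure) \<Otimes>\<^sub>M lborel)) \<in> borel_measurable borel"
    by measurable
  thus ?thesis unfolding duhamel_def st_conv_def lborel_prod .
qed

lemma duhamel_iterated_measurable: "(\<lambda>x. duhamel_iterated x t) \<in> borel_measurable borel"
  unfolding duhamel_iterated_def by measurable

lemma free_part_measurable: "(\<lambda>x. free_part x t) \<in> borel_measurable borel"
proof -
  have [measurable]: "(\<lambda>x. Z x 1) \<in> borel_measurable borel" using Z1 by auto
  show ?thesis unfolding free_part_def by measurable
qed

text \<open>
  The cut-offs at \<open>\<tau>\<close> are invisible for \<open>t < \<tau>\<close>, and those at \<open>0\<close> enforce \<open>0 < s < t\<close>.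
\<close>
lemma integrand_eq:
  assumes "0 < t" "t < \<tau>"
  shows "indicator {0<..<t} s * (\<bar>u y s\<bar> powr (p - 1) * u y s * Y (x - y) (t - s)) = src y s * kern (x - y) (t - s)"
  using assms by (auto simp: src_def kern_def indicator_def)

text \<open>
  At \<open>t = 0\<close> the first term is \<open>u0 x\<close>, because \<open>0 powr (\<alpha> / (2 * \<beta>)) = 0\<close> and the kernel has mass \<open>1\<close>,
  and the second vanishes. Continuity at the initial time thereby becomes a case of continuity on \<open>[0,\<tau>)\<close>.
\<close>
lemma mild_rep_eq:
  assumes "0 \<le> t" "t < \<tau>"
  shows "mild_rep p Z Y u0 u x t = free_part x t + duhamel_iterated x t"
proof (cases "t = 0")
  case True
  have "src y s * kern (x - y) (0 - s) = 0" for y s by (auto simp: src_def kern_def indicator_def)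
  hence "duhamel_iterated x 0 = 0" unfolding duhamel_iterated_def by (simp only: integral_zero)
  moreover have "free_part x 0 = u0 x"
    unfolding free_part_def using fundamental_solution_mass_1[OF a b fs, of 1] by simp
  ultimately show ?thesis using True by (simp add: mild_rep_def)
next
  case False
  hence t: "0 < t" using assms by simp
  have "(LINT s:{0<..<t}|lborel. (\<integral>y. \<bar>u y s\<bar> powr (p - 1) * u y s * Y (x - y) (t - s) \<partial>lborel)) = duhamel_iterated x t"
    unfolding set_lebesgue_integral_def duhamel_iterated_def
    by (simp add: integrand_eq[OF t assms(2), symmetric])
  thus ?thesis using False initial_datum_convolution(1)[OF a b fs t u0m] by (simp add: mild_rep_def mild_rhs_def free_part_def)
qed

lemma mild_rep_measurable:
  assumes "0 \<le> t" "t < \<tau>"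
  shows "(\<lambda>x. mild_rep p Z Y u0 u x t) \<in> borel_measurable borel"
  unfolding mild_rep_eq[OF assms] by (intro borel_measurable_add free_part_measurable duhamel_iterated_measurable)

lemma duhamel_iterated_eq:
  assumes int: "integrable lborel (\<lambda>w. src (x - fst w) (snd w) * kern (fst w) (t - snd w))"
  shows "duhamel_iterated x t = duhamel x t"
proof -
  have "duhamel x t = (\<integral>w. (case w of (y, s) \<Rightarrow> src (x - y) s * kern y (t - s)) \<partial>(lborel \<Otimes>\<^sub>M lborel))"
    unfolding duhamel_def st_conv_def lborel_prod by (simp add: case_prod_unfold)
  also have "\<dots> = (\<integral>s. (\<integral>y. src (x - y) s * kern y (t - s) \<partial>lborel) \<partial>lborel)"
    by (rule lborel_pair.integral_snd[symmetric]) (use int in \<open>simp add: case_prod_unfold lborel_prod\<close>)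
  also have "\<dots> = duhamel_iterated x t"
    unfolding duhamel_iterated_def
  proof (rule Bochner_Integration.integral_cong[OF refl])
    fix s
    show "(\<integral>y. src (x - y) s * kern y (t - s) \<partial>lborel) = (\<integral>y. src y s * kern (x - y) (t - s) \<partial>lborel)"
      using integral_lborel_reflect[of "\<lambda>y. src y s * kern (x - y) (t - s)" x] by simp
  qed
  finally show ?thesis ..
qed

lemma mild_rep_AE:
  assumes "1 \<le> r" "bounded_exponent (r * p)" and t: "0 \<le> t" "t < \<tau>"
  shows "AE x in lborel. mild_rep p Z Y u0 u x t = free_part x t + duhamel x t"
proof -
  obtain C where C: "C < \<infinity>" "AE s in lborel. Lp_mass r (\<lambda>x. src x s) \<le> C"
    using src_bounded[OF assms(2)] by blast
  from st_conv_bound(1)[OF src_measurable assms(1) C kern_integrable, of t]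
  show ?thesis by eventually_elim (simp add: mild_rep_eq[OF t] duhamel_iterated_eq)
qed

lemma mild_converges:
  assumes r: "1 \<le> r" "bounded_exponent (r * p)" and q: "1 \<le> q" "Lp_mass q u0 < \<infinity>" and t: "0 < t" "t < \<tau>"
  shows "AE x in lborel. mild_rhs_converges p Z Y u0 u x t"
proof -
  obtain C where C: "C < \<infinity>" "AE s in lborel. Lp_mass r (\<lambda>x. src x s) \<le> C"
    using src_bounded[OF r(2)] by blast
  from st_conv_bound(1)[OF src_measurable r(1) C kern_integrable, of t]
    Lp_mass_kernel_average_continuous(2)[OF u0m q Z1 tendsto_const, of "t powr (\<alpha> / (2 * \<beta>))"]
  show ?thesis
  proof eventually_elim
    case (elim x)
    have "integrable lborel (\<lambda>w. src (fst w) (snd w) * kern (x - fst w) (t - snd w))"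
      using integrable_space_reflect[OF elim(1), of x] by simp
    also have "(\<lambda>w. src (fst w) (snd w) * kern (x - fst w) (t - snd w)) =
      (\<lambda>w. indicator (UNIV \<times> {0<..<t}) w *\<^sub>R (case w of (y, s) \<Rightarrow> \<bar>u y s\<bar> powr (p - 1) * u y s * Y (x - y) (t - s)))"
      using integrand_eq[OF t] by (auto simp: fun_eq_iff indicator_def split: if_splits)
    finally show ?case
      using initial_datum_convolution(2)[OF a b fs t(1) u0m elim(2)]
      unfolding mild_rhs_converges_def set_integrable_def by simp
  qed
qed

lemma free_part_bound:
  assumes "1 \<le> q" "Lp_mass q u0 < \<infinity>"
  shows "\<exists>C<\<infinity>. \<forall>t. Lp_mass q (\<lambda>x. free_part x t) \<le> C"
proof (intro exI conjI allI)
  let ?C = "ennreal ((\<integral>y. \<bar>Z y 1\<bar> \<partial>lborel) powr q) * Lp_mass q u0"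
  show "?C < \<infinity>" using assms by (simp add: ennreal_mult_less_top)
  show "Lp_mass q (\<lambda>x. free_part x t) \<le> ?C" for t
    unfolding free_part_def by (rule Lp_mass_kernel_average_continuous(3)[OF u0m assms Z1 tendsto_const])
qed

lemma free_part_continuous:
  assumes "1 \<le> q" "Lp_mass q u0 < \<infinity>" "tn \<longlonglongrightarrow> t" "\<And>n. 0 \<le> tn n"
  shows "(\<lambda>n. Lp_mass q (\<lambda>x. free_part x (tn n) - free_part x t)) \<longlonglongrightarrow> 0"
  unfolding free_part_def
proof (rule Lp_mass_kernel_average_continuous(1)[OF u0m assms(1,2) Z1])
  show "(\<lambda>n. tn n powr (\<alpha> / (2 * \<beta>))) \<longlonglongrightarrow> t powr (\<alpha> / (2 * \<beta>))"
    using assms a b by (intro tendsto_powr2 tendsto_const) auto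
qed

lemma duhamel_bound:
  assumes "1 \<le> r" "bounded_exponent (r * p)"
  shows "\<exists>C<\<infinity>. \<forall>t. Lp_mass r (\<lambda>x. duhamel x t) \<le> C"
proof -
  obtain C where C: "C < \<infinity>" "AE s in lborel. Lp_mass r (\<lambda>x. src x s) \<le> C"
    using src_bounded[OF assms(2)] by blast
  show ?thesis
    using st_conv_bound(2)[OF src_measurable assms(1) C kern_integrable] C(1) unfolding duhamel_def
    by (intro exI[of _ "ennreal ((\<integral>w. \<bar>kern (fst w) (snd w)\<bar> \<partial>lborel) powr r) * C"]) (auto simp: ennreal_mult_less_top)
qed

lemma duhamel_continuous:
  assumes "1 \<le> r" "bounded_exponent (r * p)" "tn \<longlonglongrightarrow> t"
  shows "(\<lambda>n. Lp_mass r (\<lambda>x. duhamel x (tn n) - duhamel x t)) \<longlonglongrightarrow> 0"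
proof -
  obtain C where C: "C < \<infinity>" "AE s in lborel. Lp_mass r (\<lambda>x. src x s) \<le> C"
    using src_bounded[OF assms(2)] by blast
  show ?thesis unfolding duhamel_def
    by (rule st_conv_continuous[OF src_measurable assms(1) C kern_integrable assms(3)])
qed

end

text \<open>
  The exponents \<open>q < q'\<close> together with a solution bounded in \<open>L\<^bsup>q'\<^esup>\<close> on the slab. As \<open>p \<le> q'\<close>, the
  nonlinearity lies in \<open>L\<^bsup>q'/p\<^esup>\<close> with \<open>q' / p \<ge> 1\<close>, which starts the argument.
\<close>
locale mild_solution_slab = mild_slab +
  fixes q q' :: real
  assumes q: "1 \<le> q" "q < q'" and pq': "p \<le> q'"
    and u0q: "Lp_mass q u0 < \<infinity>" and u0q': "Lp_mass q' u0 < \<infinity>"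
    and uq': "bounded_exponent q'"
    and sol: "AE t in lborel. 0 < t \<and> ereal t < T \<longrightarrow> (AE x in lborel. u x t = mild_rhs p Z Y u0 u x t)"
begin

lemma base_exponent: "1 \<le> q' / p" "bounded_exponent (q' / p * p)"
  using p pq' uq' by auto

lemma u_eq_AE: "AE t in lborel. 0 < t \<and> t < \<tau> \<longrightarrow> (AE x in lborel. u x t = free_part x t + duhamel x t)"
  using sol
proof eventually_elim
  case (elim t)
  show ?case
  proof
    assume t: "0 < t \<and> t < \<tau>"
    hence "ereal t < T" using \<tau>(2) by (meson ereal_less_eq(3) less_imp_le order.strict_trans1)
    hence "AE x in lborel. u x t = mild_rhs p Z Y u0 u x t" using elim t by auto
    moreover have "AE x in lborel. mild_rep p Z Y u0 u x t = free_part x t + duhamel x t"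
      using t by (intro mild_rep_AE[OF base_exponent]) auto
    ultimately show "AE x in lborel. u x t = free_part x t + duhamel x t"
      by eventually_elim (use t in \<open>simp add: mild_rep_def\<close>)
  qed
qed

lemma u0_between: "q \<le> r \<Longrightarrow> r \<le> q' \<Longrightarrow> Lp_mass r u0 < \<infinity>"
  using Lp_mass_between[OF u0m, of q r q'] u0q u0q' by (auto intro: order.strict_trans1)

text \<open>
  One use of the equation: \<open>u\<close> in \<open>L\<^sup>r\<^sup>p\<close> puts the nonlinearity, and with it the Duhamel term, into \<open>L\<^sup>r\<close>,
  where the free evolution of the datum also lies.
\<close>
lemma bounded_exponent_step:
  assumes r: "q \<le> r" "r \<le> q'" "bounded_exponent (r * p)"
  shows "bounded_exponent r"
proof -
  have r1: "1 \<le> r" using r q by linarith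
  obtain C1 where C1: "C1 < \<infinity>" "\<And>t. Lp_mass r (\<lambda>x. free_part x t) \<le> C1"
    using free_part_bound[OF r1 u0_between[OF r(1,2)]] by auto
  obtain C2 where C2: "C2 < \<infinity>" "\<And>t. Lp_mass r (\<lambda>x. duhamel x t) \<le> C2"
    using duhamel_bound[OF r1 r(3)] by auto
  let ?C = "ennreal (2 powr r) * (C1 + C2)"
  have "AE t in lborel. 0 < t \<and> t < \<tau> \<longrightarrow> Lp_mass r (\<lambda>x. u x t) \<le> ?C"
    using u_eq_AE
  proof eventually_elim
    case (elim t)
    show ?case
    proof
      assume "0 < t \<and> t < \<tau>"
      hence "Lp_mass r (\<lambda>x. u x t) = Lp_mass r (\<lambda>x. free_part x t + duhamel x t)"
        using elim by (intro Lp_mass_cong_AE) auto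
      also have "\<dots> \<le> ennreal (2 powr r) * (Lp_mass r (\<lambda>x. free_part x t) + Lp_mass r (\<lambda>x. duhamel x t))"
        using r1 by (intro Lp_mass_add free_part_measurable duhamel_measurable) auto
      also have "\<dots> \<le> ?C" by (intro mult_left_mono add_mono C1 C2) auto
      finally show "Lp_mass r (\<lambda>x. u x t) \<le> ?C" .
    qed
  qed
  moreover have "?C < \<infinity>" using C1(1) C2(1) by (simp add: ennreal_mult_less_top)
  ultimately show ?thesis unfolding bounded_exponent_def by blast
qed

lemma bounded_exponent_between:
  assumes "bounded_exponent r" "r \<le> s" "s \<le> q'"
  shows "bounded_exponent s"
proof -
  obtain C1 where C1: "C1 < \<infinity>" "AE t in lborel. 0 < t \<and> t < \<tau> \<longrightarrow> Lp_mass r (\<lambda>x. u x t) \<le> C1"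
    using assms(1) unfolding bounded_exponent_def by auto
  obtain C2 where C2: "C2 < \<infinity>" "AE t in lborel. 0 < t \<and> t < \<tau> \<longrightarrow> Lp_mass q' (\<lambda>x. u x t) \<le> C2"
    using uq' unfolding bounded_exponent_def by auto
  have "AE t in lborel. 0 < t \<and> t < \<tau> \<longrightarrow> Lp_mass s (\<lambda>x. u x t) \<le> C1 + C2"
    using C1(2) C2(2)
  proof eventually_elim
    case (elim t)
    show ?case
    proof
      assume t: "0 < t \<and> t < \<tau>"
      have "Lp_mass s (\<lambda>x. u x t) \<le> Lp_mass r (\<lambda>x. u x t) + Lp_mass q' (\<lambda>x. u x t)"
        using t assms by (intro Lp_mass_between u_measurable) auto
      also have "\<dots> \<le> C1 + C2" using elim t by (intro add_mono) auto
      finally show "Lp_mass s (\<lambda>x. u x t) \<le> C1 + C2" .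
    qed
  qed
  moreover have "C1 + C2 < \<infinity>" using C1(1) C2(1) by simp
  ultimately show ?thesis unfolding bounded_exponent_def by blast
qed

text \<open>
  Alternate \<open>bounded_exponent_step\<close> with interpolation against \<open>L\<^bsup>q'\<^esup>\<close>. After \<open>k\<close> rounds the exponent is
  \<open>max (q * p) (q' / p ^ k)\<close>; the maximum keeps the exponent produced by the step at least \<open>q\<close>, where the
  datum is still integrable.
\<close>
lemma bounded_exponent_bootstrap:
  assumes "q * p \<le> q'"
  shows "bounded_exponent (q * p)"
proof -
  have P: "bounded_exponent (max (q * p) (q' / p ^ k))" for k
  proof (induction k)
    case 0
    show ?case using assms uq' by (simp add: max_def)
  next
    case (Suc k)
    define r where "r = max q (q' / p ^ Suc k)"
    have rp: "r * p = max (q * p) (q' / p ^ k)"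
      using p unfolding r_def by (auto simp: max_def field_simps)
    have "q' / p ^ Suc k \<le> q' / 1"
      using p q by (intro divide_left_mono one_le_power) auto
    hence r: "q \<le> r" "r \<le> q'" unfolding r_def using q by auto
    have "bounded_exponent r" by (rule bounded_exponent_step) (use r rp Suc in auto)
    moreover have "r \<le> max (q * p) (q' / p ^ Suc k)"
    proof -
      have "q * 1 \<le> q * p" using p q by (intro mult_left_mono) auto
      thus ?thesis unfolding r_def by auto
    qed
    ultimately show ?case
      by (rule bounded_exponent_between) (use assms \<open>q' / p ^ Suc k \<le> q' / 1\<close> in auto)
  qed
  obtain k where "q' / (q * p) < p ^ k" using real_arch_pow[OF p] by blast
  hence "q' / p ^ k \<le> q * p" using p q by (simp add: field_simps)
  thus ?thesis using P[of k] by (simp add: max_def split: if_splits)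
qed

text \<open>
  For almost every \<open>t\<close> the Duhamel term equals \<open>u\<close> minus the free evolution, both bounded in \<open>L\<^bsup>q'\<^esup>\<close>. Any other time is
  a limit of such times, the Duhamel term being continuous in \<open>L\<^bsup>q'/p\<^esup>\<close>, and lower semicontinuity
  preserves the bound.
\<close>
lemma duhamel_bound_upper:
  shows "\<exists>C<\<infinity>. \<forall>t. 0 \<le> t \<and> t < \<tau> \<longrightarrow> Lp_mass q' (\<lambda>x. duhamel x t) \<le> C"
proof -
  have q'1: "1 \<le> q'" using q by linarith
  obtain C1 where C1: "C1 < \<infinity>" "\<And>t. Lp_mass q' (\<lambda>x. free_part x t) \<le> C1"
    using free_part_bound[OF q'1 u0q'] by auto
  obtain C2 where C2: "C2 < \<infinity>" "AE t in lborel. 0 < t \<and> t < \<tau> \<longrightarrow> Lp_mass q' (\<lambda>x. u x t) \<le> C2"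
    using uq' unfolding bounded_exponent_def by auto
  obtain D where D: "D < \<infinity>" "\<And>t. Lp_mass (q' / p) (\<lambda>x. duhamel x t) \<le> D"
    using duhamel_bound[OF base_exponent] by auto
  let ?C = "ennreal (2 powr q') * (C2 + C1)"
  have good: "AE t in lborel. 0 < t \<and> t < \<tau> \<longrightarrow> Lp_mass q' (\<lambda>x. duhamel x t) \<le> ?C"
    using C2(2) u_eq_AE
  proof eventually_elim
    case (elim t)
    show ?case
    proof
      assume t: "0 < t \<and> t < \<tau>"
      hence "AE x in lborel. u x t = free_part x t + duhamel x t" using elim by auto
      hence "Lp_mass q' (\<lambda>x. duhamel x t) = Lp_mass q' (\<lambda>x. u x t - free_part x t)"
        by (intro Lp_mass_cong_AE) (auto elim!: eventually_mono)
      also have "\<dots> \<le> ennreal (2 powr q') * (Lp_mass q' (\<lambda>x. u x t) + Lp_mass q' (\<lambda>x. free_part x t))"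
        using t q'1 by (intro Lp_mass_diff free_part_measurable u_measurable) auto
      also have "\<dots> \<le> ?C" using elim t by (intro mult_left_mono add_mono C1) auto
      finally show "Lp_mass q' (\<lambda>x. duhamel x t) \<le> ?C" .
    qed
  qed
  have "Lp_mass q' (\<lambda>x. duhamel x t) \<le> ?C" if t: "0 \<le> t" "t < \<tau>" for t
  proof -
    have "\<exists>s. t < s \<and> s < t + 1 / real (Suc n) \<and> Lp_mass q' (\<lambda>x. duhamel x s) \<le> ?C" for n
    proof -
      have "t < min \<tau> (t + 1 / real (Suc n))" using t by simp
      from AE_lborel_Ioo_ex[OF good this] obtain s where "t < s" "s < min \<tau> (t + 1 / real (Suc n))"
        "0 < s \<and> s < \<tau> \<longrightarrow> Lp_mass q' (\<lambda>x. duhamel x s) \<le> ?C" by blast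
      thus ?thesis using t by (intro exI[of _ s]) auto
    qed
    then obtain s where s: "\<And>n. t < s n" "\<And>n. s n < t + 1 / real (Suc n)" "\<And>n. Lp_mass q' (\<lambda>x. duhamel x (s n)) \<le> ?C"
      by metis
    have "(\<lambda>n. t + 1 / real (Suc n)) \<longlonglongrightarrow> t + 0"
      by (intro tendsto_add tendsto_const LIMSEQ_Suc[OF lim_1_over_n])
    hence st: "s \<longlonglongrightarrow> t"
      by (intro tendsto_sandwich[OF _ _ tendsto_const[of t], of s]) (use s(1,2) in \<open>auto intro!: always_eventually less_imp_le\<close>)
    show ?thesis
    proof (rule Lp_mass_lower_semicontinuous[where r="q' / p" and gn="\<lambda>n x. duhamel x (s n)"])
      fix n
      have "Lp_mass (q' / p) (\<lambda>x. duhamel x (s n) - duhamel x t) \<le> ennreal (2 powr (q' / p)) * (Lp_mass (q' / p) (\<lambda>x. duhamel x (s n)) + Lp_mass (q' / p) (\<lambda>x. duhamel x t))"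
        using base_exponent(1) by (intro Lp_mass_diff duhamel_measurable) auto
      also have "\<dots> \<le> ennreal (2 powr (q' / p)) * (D + D)" by (intro mult_left_mono add_mono D) auto
      also have "\<dots> < \<infinity>" using D(1) by (simp add: ennreal_mult_less_top)
      finally show "Lp_mass (q' / p) (\<lambda>x. duhamel x (s n) - duhamel x t) < \<infinity>" .
    qed (use base_exponent(1) q'1 s(3) in \<open>auto intro!: duhamel_measurable duhamel_continuous[OF base_exponent st]\<close>)
  qed
  moreover have "?C < \<infinity>" using C1(1) C2(1) by (simp add: ennreal_mult_less_top)
  ultimately show ?thesis by blast
qed

text \<open>
  The exponent \<open>q\<close> is either at most \<open>q' / p\<close>, where the bootstrap applies, or strictly between \<open>q' / p\<close>
  and \<open>q'\<close>, where the term is continuous in the lower space and bounded in the upper one.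
\<close>
lemma duhamel_in_Lq:
  shows "\<exists>C<\<infinity>. \<forall>t. 0 \<le> t \<and> t < \<tau> \<longrightarrow> Lp_mass q (\<lambda>x. duhamel x t) \<le> C"
    and "\<lbrakk>tn \<longlonglongrightarrow> t; \<And>n. 0 \<le> tn n; \<And>n. tn n < \<tau>; 0 \<le> t; t < \<tau>\<rbrakk> \<Longrightarrow> (\<lambda>n. Lp_mass q (\<lambda>x. duhamel x (tn n) - duhamel x t)) \<longlonglongrightarrow> 0"
proof -
  have q'1: "1 \<le> q'" using q by linarith
  have "(\<exists>C<\<infinity>. \<forall>t. 0 \<le> t \<and> t < \<tau> \<longrightarrow> Lp_mass q (\<lambda>x. duhamel x t) \<le> C) \<and>
    (\<forall>tn t. tn \<longlonglongrightarrow> t \<longrightarrow> (\<forall>n. 0 \<le> tn n \<and> tn n < \<tau>) \<longrightarrow> 0 \<le> t \<longrightarrow> t < \<tau> \<longrightarrow> (\<lambda>n. Lp_mass q (\<lambda>x. duhamel x (tn n) - duhamel x t)) \<longlonglongrightarrow> 0)"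
  proof (cases "q * p \<le> q'")
    case True
    note u = bounded_exponent_bootstrap[OF True]
    show ?thesis using duhamel_bound[OF q(1) u] duhamel_continuous[OF q(1) u] by blast
  next
    case False
    define r where "r = q' / p"
    have rq: "r < q" using False p by (simp add: r_def field_simps)
    have r1: "1 \<le> r" and ur: "bounded_exponent (r * p)" using base_exponent by (simp_all add: r_def)
    obtain D1 where D1: "D1 < \<infinity>" "\<And>t. Lp_mass r (\<lambda>x. duhamel x t) \<le> D1"
      using duhamel_bound[OF r1 ur] by auto
    obtain D2 where D2: "D2 < \<infinity>" "\<And>t. 0 \<le> t \<and> t < \<tau> \<Longrightarrow> Lp_mass q' (\<lambda>x. duhamel x t) \<le> D2"
      using duhamel_bound_upper by auto
    have "Lp_mass q (\<lambda>x. duhamel x t) \<le> D1 + D2" if "0 \<le> t \<and> t < \<tau>" for t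
    proof -
      have "Lp_mass q (\<lambda>x. duhamel x t) \<le> Lp_mass r (\<lambda>x. duhamel x t) + Lp_mass q' (\<lambda>x. duhamel x t)"
        using rq q by (intro Lp_mass_between duhamel_measurable) auto
      also have "\<dots> \<le> D1 + D2" using that by (intro add_mono D1 D2) auto
      finally show ?thesis .
    qed
    moreover have "D1 + D2 < \<infinity>" using D1 D2 by simp
    moreover have "(\<lambda>n. Lp_mass q (\<lambda>x. duhamel x (tn n) - duhamel x t)) \<longlonglongrightarrow> 0"
      if tn: "tn \<longlonglongrightarrow> t" "\<forall>n. 0 \<le> tn n \<and> tn n < \<tau>" "0 \<le> t" "t < \<tau>" for tn t
    proof (rule ennreal_tendsto_0I)
      fix e :: real assume e: "e > 0"
      let ?g = "\<lambda>n x. duhamel x (tn n) - duhamel x t"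
      have gm: "?g n \<in> borel_measurable borel" for n by (intro borel_measurable_diff duhamel_measurable)
      \<comment> \<open>\<open>B\<close> bounds the differences in the upper space; \<open>R\<close> makes the upper term at most \<open>e / 2\<close>, then \<open>\<delta>\<close> the lower one.\<close>
      define B where "B = enn2real (ennreal (2 powr q') * (D2 + D2))"
      have Bfin: "ennreal (2 powr q') * (D2 + D2) < \<infinity>" using D2(1) by (simp add: ennreal_mult_less_top)
      have B: "Lp_mass q' (?g n) \<le> ennreal B" for n
      proof -
        have "Lp_mass q' (?g n) \<le> ennreal (2 powr q') * (Lp_mass q' (\<lambda>x. duhamel x (tn n)) + Lp_mass q' (\<lambda>x. duhamel x t))"
          using q'1 by (intro Lp_mass_diff duhamel_measurable) auto
        also have "\<dots> \<le> ennreal (2 powr q') * (D2 + D2)" using tn by (intro mult_left_mono add_mono D2) auto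
        also have "\<dots> = ennreal B" unfolding B_def using Bfin by (simp add: ennreal_enn2real_if)
        finally show ?thesis .
      qed
      have B0: "0 \<le> B" by (simp add: B_def)
      define R where "R = (e / (2 * (B + 1))) powr (1 / (q - q'))"
      have eB: "e / (2 * (B + 1)) > 0" using e B0 by (intro divide_pos_pos) auto
      have R: "R > 0" unfolding R_def powr_gt_zero using less_imp_neq[OF eB] by (rule not_sym)
      have Rq: "R powr (q - q') = e / (2 * (B + 1))"
      proof -
        have "(1 / (q - q')) * (q - q') = 1" using q by simp
        thus ?thesis unfolding R_def powr_powr using eB by (simp only: powr_one less_imp_le)
      qed
      have RB: "R powr (q - q') * B \<le> e / 2"
      proof -
        have "R powr (q - q') * B \<le> R powr (q - q') * (B + 1)" using B0 by (intro mult_left_mono) auto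
        also have "\<dots> = e / 2" unfolding Rq using B0 by (simp add: field_simps)
        finally show ?thesis .
      qed
      define \<delta> where "\<delta> = e / (2 * R powr (q - r))"
      have \<delta>: "0 < \<delta>" using e R by (simp add: \<delta>_def)
      have "(\<lambda>n. Lp_mass r (?g n)) \<longlonglongrightarrow> 0" by (rule duhamel_continuous[OF r1 ur tn(1)])
      hence "\<forall>\<^sub>F n in sequentially. Lp_mass r (?g n) < ennreal \<delta>"
        by (rule order_tendstoD(2)) (use \<delta> in simp)
      thus "\<forall>\<^sub>F n in sequentially. Lp_mass q (?g n) \<le> ennreal e"
      proof eventually_elim
        case (elim n)
        have "Lp_mass q (?g n) \<le> ennreal (R powr (q - r)) * Lp_mass r (?g n) + ennreal (R powr (q - q')) * Lp_mass q' (?g n)"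
          using rq q by (intro Lp_mass_interpolate gm R) auto
        also have "\<dots> \<le> ennreal (R powr (q - r)) * ennreal \<delta> + ennreal (R powr (q - q')) * ennreal B"
          using elim B by (intro add_mono mult_left_mono) auto
        also have "\<dots> = ennreal (R powr (q - r) * \<delta> + R powr (q - q') * B)"
          using \<delta> B0 by (simp flip: ennreal_plus ennreal_mult)
        also have "\<dots> \<le> ennreal e"
          using RB R by (intro ennreal_leI) (simp add: \<delta>_def)
        finally show ?case .
      qed
    qed
    ultimately show ?thesis by blast
  qed
  thus "\<exists>C<\<infinity>. \<forall>t. 0 \<le> t \<and> t < \<tau> \<longrightarrow> Lp_mass q (\<lambda>x. duhamel x t) \<le> C"
    and "\<lbrakk>tn \<longlonglongrightarrow> t; \<And>n. 0 \<le> tn n; \<And>n. tn n < \<tau>; 0 \<le> t; t < \<tau>\<rbrakk> \<Longrightarrow> (\<lambda>n. Lp_mass q (\<lambda>x. duhamel x (tn n) - duhamel x t)) \<longlonglongrightarrow> 0"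
    by blast+
qed

lemma mild_rep_bound:
  "\<exists>C<\<infinity>. \<forall>t. 0 \<le> t \<and> t < \<tau> \<longrightarrow> Lp_mass q (\<lambda>x. mild_rep p Z Y u0 u x t) \<le> C"
proof -
  obtain C1 where C1: "C1 < \<infinity>" "\<And>t. Lp_mass q (\<lambda>x. free_part x t) \<le> C1"
    using free_part_bound[OF q(1) u0q] by auto
  obtain C2 where C2: "C2 < \<infinity>" "\<And>t. 0 \<le> t \<and> t < \<tau> \<Longrightarrow> Lp_mass q (\<lambda>x. duhamel x t) \<le> C2"
    using duhamel_in_Lq(1) by auto
  let ?C = "ennreal (2 powr q) * (C1 + C2)"
  have "Lp_mass q (\<lambda>x. mild_rep p Z Y u0 u x t) \<le> ?C" if t: "0 \<le> t \<and> t < \<tau>" for t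
  proof -
    have "Lp_mass q (\<lambda>x. mild_rep p Z Y u0 u x t) = Lp_mass q (\<lambda>x. free_part x t + duhamel x t)"
      using t by (intro Lp_mass_cong_AE mild_rep_AE[OF base_exponent]) auto
    also have "\<dots> \<le> ennreal (2 powr q) * (Lp_mass q (\<lambda>x. free_part x t) + Lp_mass q (\<lambda>x. duhamel x t))"
      using q by (intro Lp_mass_add free_part_measurable duhamel_measurable) auto
    also have "\<dots> \<le> ?C" using t by (intro mult_left_mono add_mono C1 C2) auto
    finally show ?thesis .
  qed
  moreover have "?C < \<infinity>" using C1(1) C2(1) by (simp add: ennreal_mult_less_top)
  ultimately show ?thesis by blast
qed

lemma mild_rep_continuous:
  assumes tn: "tn \<longlonglongrightarrow> t" "\<And>n. 0 \<le> tn n" "\<And>n. tn n < \<tau>" "0 \<le> t" "t < \<tau>"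
  shows "(\<lambda>n. Lp_norm q (\<lambda>x. mild_rep p Z Y u0 u x (tn n) - mild_rep p Z Y u0 u x t)) \<longlonglongrightarrow> 0"
proof (rule Lp_norm_tendsto_0)
  show "(\<lambda>x. mild_rep p Z Y u0 u x (tn n) - mild_rep p Z Y u0 u x t) \<in> borel_measurable borel" for n
    using tn by (intro borel_measurable_diff mild_rep_measurable) auto
  let ?F = "\<lambda>n. Lp_mass q (\<lambda>x. free_part x (tn n) - free_part x t)" and ?D = "\<lambda>n. Lp_mass q (\<lambda>x. duhamel x (tn n) - duhamel x t)"
  have "(\<lambda>n. ?F n + ?D n) \<longlonglongrightarrow> 0 + 0"
    by (intro tendsto_add free_part_continuous[OF q(1) u0q] duhamel_in_Lq(2) tn)
  hence "(\<lambda>n. ennreal (2 powr q) * (?F n + ?D n)) \<longlonglongrightarrow> ennreal (2 powr q) * 0"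
    by (intro ennreal_tendsto_cmult) auto
  hence lim: "(\<lambda>n. ennreal (2 powr q) * (?F n + ?D n)) \<longlonglongrightarrow> 0" by simp
  have le: "Lp_mass q (\<lambda>x. mild_rep p Z Y u0 u x (tn n) - mild_rep p Z Y u0 u x t) \<le> ennreal (2 powr q) * (?F n + ?D n)" for n
  proof -
    have "Lp_mass q (\<lambda>x. mild_rep p Z Y u0 u x (tn n) - mild_rep p Z Y u0 u x t) = 
      Lp_mass q (\<lambda>x. (free_part x (tn n) - free_part x t) + (duhamel x (tn n) - duhamel x t))"
    proof (rule Lp_mass_cong_AE)
      show "AE x in lborel. mild_rep p Z Y u0 u x (tn n) - mild_rep p Z Y u0 u x t = (free_part x (tn n) - free_part x t) + (duhamel x (tn n) - duhamel x t)"
        using mild_rep_AE[OF base_exponent tn(2,3)] mild_rep_AE[OF base_exponent tn(4,5)] by eventually_elim simp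
    qed
    also have "\<dots> \<le> ennreal (2 powr q) * (?F n + ?D n)"
      using q by (intro Lp_mass_add borel_measurable_diff free_part_measurable duhamel_measurable) auto
    finally show ?thesis .
  qed
  show "(\<lambda>n. Lp_mass q (\<lambda>x. mild_rep p Z Y u0 u x (tn n) - mild_rep p Z Y u0 u x t)) \<longlonglongrightarrow> 0"
    by (rule tendsto_sandwich[OF _ _ tendsto_const lim]) (use le in auto)
qed (use q in auto)

end


lemma ereal_between_time:
  assumes "0 \<le> t" "ereal t < T"
  obtains \<tau> where "t < \<tau>" "0 < \<tau>" "ereal \<tau> < T"
proof -
  obtain \<tau> where "ereal t < ereal \<tau>" "ereal \<tau> < T"
    using ereal_dense2[OF assms(2)] by auto
  thus ?thesis using assms(1) by (intro that) auto
qed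

lemma in_Linf_loc_Lp_mass_bound:
  assumes "in_Linf_loc_Lp m T u" "0 < \<tau>" "ereal \<tau> < T" "0 < m"
  shows "\<exists>C<\<infinity>. AE s in lborel. 0 < s \<and> s < \<tau> \<longrightarrow> Lp_mass m (\<lambda>x. u x s) \<le> C"
proof -
  obtain C where C: "AE t in lborel. 0 < t \<and> t < \<tau> \<longrightarrow> in_Lp m (\<lambda>x. u x t) \<and> Lp_norm m (\<lambda>x. u x t) \<le> C"
    using assms unfolding in_Linf_loc_Lp_def by blast
  have "AE t in lborel. 0 < t \<and> t < \<tau> \<longrightarrow> Lp_mass m (\<lambda>x. u x t) \<le> ennreal (\<bar>C\<bar> powr m)"
    using C
  proof eventually_elim
    case (elim t)
    show ?case
    proof
      assume "0 < t \<and> t < \<tau>"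
      hence *: "(\<lambda>x. u x t) \<in> borel_measurable borel" "Lp_mass m (\<lambda>x. u x t) < \<infinity>" "Lp_norm m (\<lambda>x. u x t) \<le> C"
        using elim by (auto simp: in_Lp_iff_Lp_mass)
      define M where "M = enn2real (Lp_mass m (\<lambda>x. u x t))"
      have M: "Lp_mass m (\<lambda>x. u x t) = ennreal M" "0 \<le> M"
        unfolding M_def using *(2) by (simp_all add: ennreal_enn2real_if)
      have "M powr (1 / m) \<le> \<bar>C\<bar>" using *(1,3) by (simp add: Lp_norm_eq_Lp_mass M_def)
      hence "(M powr (1 / m)) powr m \<le> \<bar>C\<bar> powr m" using assms(4) by (intro powr_mono2) auto
      hence "M \<le> \<bar>C\<bar> powr m" using assms(4) M(2) by (simp add: powr_powr)
      thus "Lp_mass m (\<lambda>x. u x t) \<le> ennreal (\<bar>C\<bar> powr m)" unfolding M by (rule ennreal_leI)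
    qed
  qed
  thus ?thesis by (intro exI[of _ "ennreal (\<bar>C\<bar> powr m)"]) auto
qed

theorem theorem4p2:
  fixes \<alpha> \<beta> p p\<^sub>c l q q' :: real
    and Z Y u :: "real ^ 'n \<Rightarrow> real \<Rightarrow> real"
    and u0 :: "real ^ 'n \<Rightarrow> real"
    and T :: ereal
  assumes "0 < \<alpha>" "\<alpha> < 1" "0 < \<beta>" "\<beta> \<le> 1" "real CARD('n) > 4 * \<beta>"
    and "fundamental_solution \<alpha> \<beta> Z" "source_kernel \<alpha> Z Y"
    and "p\<^sub>c = real CARD('n) / (real CARD('n) - 2 * \<beta>)" "p\<^sub>c \<le> p"
    and "l = real CARD('n) / (2 * \<beta>) * (p - 1)"
    and "1 \<le> q" "q \<le> l"
    and "l < q'" "q' \<le> l * p" "p \<le> q'"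
    and "in_Lp q u0" "in_Lp q' u0"
    and "0 < T"
    and "Lm_solution q' p Z Y u0 T u"
  shows "Lm_solution q p Z Y u0 T u \<and>
         (\<forall>t. 0 < t \<and> ereal t < T \<longrightarrow> (AE x in lborel. mild_rhs_converges p Z Y u0 u x t)) \<and>
         in_C_Lp q T (mild_rep p Z Y u0 u)"
proof -
  let ?v = "mild_rep p Z Y u0 u"
  have pc: "1 < p\<^sub>c" unfolding assms(8) using assms(3,5) by (subst less_divide_eq_1_pos) auto
  hence p: "1 < p" using assms(9) by linarith
  have q: "0 < q" "q < q'" using assms(11-13) by linarith+
  have um: "set_borel_measurable borel (UNIV \<times> {t. 0 < t \<and> ereal t < T}) (\<lambda>(x, t). u x t)"
    and uloc: "in_Linf_loc_Lp q' T u"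
    and ueq: "AE t in lborel. 0 < t \<and> ereal t < T \<longrightarrow>
        (AE x in lborel. mild_rhs_converges p Z Y u0 u x t \<and> u x t = mild_rhs p Z Y u0 u x t)"
    using assms(19) unfolding Lm_solution_def in_Linf_loc_Lp_def by auto
  have u0: "u0 \<in> borel_measurable borel" "Lp_mass q u0 < \<infinity>" "Lp_mass q' u0 < \<infinity>"
    using assms(16,17) by (auto simp: in_Lp_iff_Lp_mass)
  have slab: "mild_solution_slab \<alpha> \<beta> p Z Y u u0 T \<tau> q q'" if \<tau>: "0 < \<tau>" "ereal \<tau> < T" for \<tau>
  proof -
    interpret mild_slab \<alpha> \<beta> p Z Y u u0 T \<tau>
      by unfold_locales (use assms p u0 um \<tau> in auto)
    show ?thesis
    proof unfold_locales
      show "bounded_exponent q'" unfolding bounded_exponent_def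
        by (rule in_Linf_loc_Lp_mass_bound[OF uloc \<tau>]) (use q in auto)
      show "AE t in lborel. 0 < t \<and> ereal t < T \<longrightarrow> (AE x in lborel. u x t = mild_rhs p Z Y u0 u x t)"
        using ueq by eventually_elim auto
    qed (use assms q u0 in auto)
  qed
  have conv: "AE x in lborel. mild_rhs_converges p Z Y u0 u x t" if t: "0 < t" "ereal t < T" for t
  proof -
    obtain \<tau> where end_slab: "t < \<tau>" "0 < \<tau>" "ereal \<tau> < T"
      using ereal_between_time[OF less_imp_le[OF t(1)] t(2)] by blast
    interpret mild_solution_slab \<alpha> \<beta> p Z Y u u0 T \<tau> q q' by (rule slab[OF end_slab(2,3)])
    show ?thesis using t end_slab by (intro mild_converges[OF base_exponent assms(11) u0(2)]) auto
  qed
  have meas: "(\<lambda>x. ?v x t) \<in> borel_measurable borel" and memb: "in_Lp q (\<lambda>x. ?v x t)" if t: "0 \<le> t" "ereal t < T" for t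
  proof -
    obtain \<tau> where end_slab: "t < \<tau>" "0 < \<tau>" "ereal \<tau> < T" using ereal_between_time[OF t] by blast
    interpret mild_solution_slab \<alpha> \<beta> p Z Y u u0 T \<tau> q q' by (rule slab[OF end_slab(2,3)])
    show m: "(\<lambda>x. ?v x t) \<in> borel_measurable borel" by (rule mild_rep_measurable[OF t(1) end_slab(1)])
    show "in_Lp q (\<lambda>x. ?v x t)"
      using mild_rep_bound t end_slab(1) m by (auto simp: in_Lp_iff_Lp_mass intro: order.strict_trans1)
  qed
  have cont: "((\<lambda>s. Lp_norm q (\<lambda>x. ?v x s - ?v x t)) \<longlongrightarrow> 0) (at t within {s. 0 \<le> s \<and> ereal s < T})"
    if t: "0 \<le> t" "ereal t < T" for t
    unfolding tendsto_at_iff_sequentially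
  proof (intro allI impI)
    fix s assume s: "\<forall>i. s i \<in> {s. 0 \<le> s \<and> ereal s < T} - {t}" "s \<longlonglongrightarrow> t"
    obtain \<tau> where end_slab: "t < \<tau>" "0 < \<tau>" "ereal \<tau> < T" using ereal_between_time[OF t] by blast
    interpret mild_solution_slab \<alpha> \<beta> p Z Y u u0 T \<tau> q q' by (rule slab[OF end_slab(2,3)])
    \<comment> \<open>The sequence may leave the slab at first, so it is shifted until it stays below \<open>\<tau>\<close>.\<close>
    obtain n0 where n0: "\<And>n. n \<ge> n0 \<Longrightarrow> s n < \<tau>"
      using order_tendstoD(2)[OF s(2) end_slab(1)] by (auto simp: eventually_sequentially)
    have "(\<lambda>n. Lp_norm q (\<lambda>x. ?v x (s (n + n0)) - ?v x t)) \<longlonglongrightarrow> 0"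
      by (rule mild_rep_continuous[OF LIMSEQ_ignore_initial_segment[OF s(2)]]) (use s n0 t end_slab in auto)
    hence "(\<lambda>n. Lp_norm q (\<lambda>x. ?v x (s n) - ?v x t)) \<longlonglongrightarrow> 0" by (rule LIMSEQ_offset)
    thus "((\<lambda>s. Lp_norm q (\<lambda>x. ?v x s - ?v x t)) \<circ> s) \<longlonglongrightarrow> 0" by (simp add: o_def)
  qed
  have uv: "AE t in lborel. 0 < t \<and> ereal t < T \<longrightarrow> (\<lambda>x. u x t) \<in> borel_measurable borel \<and> (AE x in lborel. u x t = ?v x t)"
    using ueq
  proof eventually_elim
    case (elim t)
    show ?case
    proof (intro impI conjI)
      assume t: "0 < t \<and> ereal t < T"
      then obtain \<tau> where end_slab: "t < \<tau>" "0 < \<tau>" "ereal \<tau> < T" using ereal_between_time[of t T] by auto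
      interpret mild_solution_slab \<alpha> \<beta> p Z Y u u0 T \<tau> q q' by (rule slab[OF end_slab(2,3)])
      show "(\<lambda>x. u x t) \<in> borel_measurable borel" using t end_slab by (intro u_measurable) auto
      show "AE x in lborel. u x t = ?v x t"
        using elim t by (auto simp: mild_rep_def elim!: eventually_mono)
    qed
  qed
  have "in_Linf_loc_Lp q T u"
    unfolding in_Linf_loc_Lp_def
  proof (intro conjI um allI impI)
    fix \<tau> :: real assume \<tau>: "0 < \<tau>" "ereal \<tau> < T"
    interpret mild_solution_slab \<alpha> \<beta> p Z Y u u0 T \<tau> q q' by (rule slab[OF \<tau>])
    obtain C where C: "C < \<infinity>" "\<And>t. 0 \<le> t \<and> t < \<tau> \<Longrightarrow> Lp_mass q (\<lambda>x. ?v x t) \<le> C"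
      using mild_rep_bound by auto
    have "AE t in lborel. 0 < t \<and> t < \<tau> \<longrightarrow> in_Lp q (\<lambda>x. u x t) \<and> Lp_norm q (\<lambda>x. u x t) \<le> enn2real C powr (1 / q)"
      using uv
    proof eventually_elim
      case (elim t)
      show ?case
      proof
        assume t: "0 < t \<and> t < \<tau>"
        hence "ereal t < T" using \<tau>(2) by (meson ereal_less_eq(3) less_imp_le order.strict_trans1)
        hence um: "(\<lambda>x. u x t) \<in> borel_measurable borel" and "AE x in lborel. u x t = ?v x t" using elim t by auto
        hence le: "Lp_mass q (\<lambda>x. u x t) \<le> C" using C(2)[of t] t by (simp add: Lp_mass_cong_AE)
        hence "enn2real (Lp_mass q (\<lambda>x. u x t)) \<le> enn2real C"
          using C(1) by (intro enn2real_mono) auto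
        hence "Lp_norm q (\<lambda>x. u x t) \<le> enn2real C powr (1 / q)"
          unfolding Lp_norm_eq_Lp_mass[OF um] using q by (intro powr_mono2) auto
        thus "in_Lp q (\<lambda>x. u x t) \<and> Lp_norm q (\<lambda>x. u x t) \<le> enn2real C powr (1 / q)"
          using um le C(1) by (auto simp: in_Lp_iff_Lp_mass intro: order.strict_trans1)
      qed
    qed
    thus "\<exists>C. AE t in lborel. 0 < t \<and> t < \<tau> \<longrightarrow> in_Lp q (\<lambda>x. u x t) \<and> Lp_norm q (\<lambda>x. u x t) \<le> C" by blast
  qed
  moreover have "ess_tendsto_0 (\<lambda>t. Lp_norm q (\<lambda>x. u x t - u0 x))"
    unfolding ess_tendsto_0_def
  proof (intro allI impI)
    fix \<epsilon> :: real assume e: "\<epsilon> > 0"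
    have T0: "ereal 0 < T" using assms(18) by (simp add: zero_ereal_def)
    obtain \<tau> where \<tau>: "0 < \<tau>" "ereal \<tau> < T" using ereal_between_time[OF _ T0] by auto
    have "\<forall>\<^sub>F s in at 0 within {s. 0 \<le> s \<and> ereal s < T}. Lp_norm q (\<lambda>x. ?v x s - ?v x 0) < \<epsilon>"
      by (rule order_tendstoD(2)[OF cont[OF order_refl T0] e])
    then obtain d where d: "d > 0" "\<And>s. 0 \<le> s \<Longrightarrow> ereal s < T \<Longrightarrow> s \<noteq> 0 \<Longrightarrow> \<bar>s\<bar> < d \<Longrightarrow> Lp_norm q (\<lambda>x. ?v x s - ?v x 0) < \<epsilon>"
      unfolding eventually_at by (auto simp: dist_real_def)
    have "AE t in lborel. 0 < t \<and> t < min d \<tau> \<longrightarrow> \<bar>Lp_norm q (\<lambda>x. u x t - u0 x)\<bar> \<le> \<epsilon>"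
      using uv
    proof eventually_elim
      case (elim t)
      show ?case
      proof
        assume t: "0 < t \<and> t < min d \<tau>"
        hence tT: "ereal t < T" using \<tau>(2) by (meson ereal_less_eq(3) less_imp_le min_less_iff_conj order.strict_trans1)
        hence um: "(\<lambda>x. u x t) \<in> borel_measurable borel" and "AE x in lborel. u x t = ?v x t" using elim t by auto
        hence "Lp_mass q (\<lambda>x. u x t - u0 x) = Lp_mass q (\<lambda>x. ?v x t - ?v x 0)"
          by (intro Lp_mass_cong_AE) (auto elim!: eventually_mono simp: mild_rep_def)
        hence "Lp_norm q (\<lambda>x. u x t - u0 x) = Lp_norm q (\<lambda>x. ?v x t - ?v x 0)"
          using um u0(1) meas[of t] meas[of 0] t tT T0 by (simp add: Lp_norm_eq_Lp_mass)
        moreover have "Lp_norm q (\<lambda>x. ?v x t - ?v x 0) < \<epsilon>" using t tT by (intro d) auto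
        moreover have "0 \<le> Lp_norm q (\<lambda>x. u x t - u0 x)" by (simp add: Lp_norm_def)
        ultimately show "\<bar>Lp_norm q (\<lambda>x. u x t - u0 x)\<bar> \<le> \<epsilon>" by simp
      qed
    qed
    thus "\<exists>\<delta>>0. AE t in lborel. 0 < t \<and> t < \<delta> \<longrightarrow> \<bar>Lp_norm q (\<lambda>x. u x t - u0 x)\<bar> \<le> \<epsilon>"
      using d(1) \<tau>(1) by (intro exI[of _ "min d \<tau>"]) auto
  qed
  ultimately have "Lm_solution q p Z Y u0 T u"
    unfolding Lm_solution_def using assms(16) ueq by blast
  moreover have "in_C_Lp q T ?v"
    unfolding in_C_Lp_def using memb cont by blast
  ultimately show ?thesis using conv by blast
qed

end
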